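(* Consider the control system $x_{t+1}=Ax_t+Bu^a_t+w_t$, $x_0=\overline{x}$, under the sequential transmission protocol, i.e. with plant input over one horizon $u^a_{t:N}=\mathcal{S}\bigl(\boldsymbol{\eta}_t+\boldsymbol{\Theta}_t\mathfrak{e}(w_{t:N-1})+\boldsymbol{\Lambda}_t\nu_{t:N-1}\bigr)$. Then for every $t=0,N_r,2N_r,\ldots$, the optimization problem $$\text{minimize}\quad \mathbb{E}_{x_t}\bigl[\langle x_{t:N+1},\mathcal{Q}x_{t:N+1}\rangle+\langle u^a_{t:N},\mathcal{R}u^a_{t:N}\rangle\bigr]+\mu\,\varrho_t(\boldsymbol{\eta}_t,\boldsymbol{\Theta}_t,\boldsymbol{\Lambda}_t)$$ subject to the dynamics $x_{t:N+1}=\mathcal{A}x_t+\mathcal{B}u^a_{t:N}+\mathcal{D}w_{t:N}$ and the hard constraint that every control in $u^a_{t:N}$ lies in $\mathbb{U}=\{v\in\mathbb{R}^m : \|v\|_\infty\le U_{\max}\}$, over the class of control policies $u_{t:N}=\boldsymbol{\eta}_t+\boldsymbol{\Theta}_t\mathfrak{e}(w_{t:N-1})+\boldsymbol{\Lambda}_t\nu_{t:N-1}$ (decision variables $\boldsymbol{\eta}_t,\boldsymbol{\Theta}_t,\boldsymbol{\Lambda}_t$), is convex, feasible, and can be rewritten as the following convex quadratic program: $$\begin{aligned}\underset{\boldsymbol{\eta}_t,\boldsymbol{\Theta}_t,\boldsymbol{\Lambda}_t}{\text{minimize}}\quad & \langle\Xi_t,\mathcal{L}\Xi_t\rangle+\langle\mathcal{M}\mathcal{A}x_t,\Xi_t\rangle+\langle\mathcal{A}x_t,\mathcal{Q}\mathcal{A}x_t\rangle+2\,\mathrm{tr}\bigl(\boldsymbol{\Theta}_t^\top\mu_{\mathcal{S}}^\top\mathcal{B}^\top\mathcal{Q}\mathcal{D}\Sigma_{\mathfrak{e}}'\bigr)\\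 &+\mathrm{tr}\bigl(\mathcal{D}^\top\mathcal{Q}\mathcal{D}\Sigma_W\bigr)+\mathrm{tr}\bigl(\boldsymbol{\Theta}_t^\top\Sigma_{\mathcal{S}}\boldsymbol{\Theta}_t\Sigma_{\mathfrak{e}}\bigr)+\mu\,\varrho_t(\boldsymbol{\eta}_t,\boldsymbol{\Theta}_t,\boldsymbol{\Lambda}_t)\end{aligned}$$ subject to $$\Bigl|\boldsymbol{\eta}_t^{(i)}+\tfrac12\boldsymbol{\Lambda}_t^{(i,:)}\mathbf{1}_{N-1}\Bigr|+\tfrac12\bigl\|\boldsymbol{\Lambda}_t^{(i,:)}\bigr\|_1+\bigl\|\boldsymbol{\Theta}_t^{(i,:)}\bigr\|_1\varphi_{\max}\le U_{\max},\qquad i=1,\ldots,mN.$$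
   Context: **Plant and channel.** $A\in\mathbb{R}^{d\times d}$, $B\in\mathbb{R}^{d\times m}$, $\overline{x}\in\mathbb{R}^d$ are given. $(\nu_t)_{t\ge0}$ (channel successes) are i.i.d. Bernoulli $\{0,1\}$ random variables with $\mathbb{E}[\nu_t]=p$, $0<p\le1$. $(w_t)_{t\ge0}$ are i.i.d. zero-mean random vectors in $\mathbb{R}^d$, symmetrically distributed around the origin, with finite second moments, independent of $(\nu_t)$. The state is measured perfectly, and $\nu_t$ (via acknowledgements) is causally available at the controller. $U_{\max}>0$. **Notation.** For a sequence $(s_n)$, $s_{n:k}=[s_n^\top\ s_{n+1}^\top\cdots s_{n+k-1}^\top]^\top$. $\mathbb{E}_{x_t}$ is conditional expectation given $x_t$. $V^{(i)}$ is the $i$th component of a vector; $M^{(i,:)}$, $M^{(:,i)}$ are the $i$th row and column of a matrix. $\mathbf{1}_k$ is the all-ones vector of length $k$; $\langle v,w\rangle=v^\top w$. **Horizon and cost.** $N\ge1$ is the optimization horizon, $N_r\in\{1,\ldots,N\}$ the recalculation interval. $Q,Q_f\in\mathbb{R}^{d\times d}$ are symmetric non-negative definite, $R\in\mathbb{R}^{m\times m}$ is symmetric positive definite, $\mathcal{Q}=\mathrm{blkdiag}(Q,\ldots,Q,Q_f)$ ($N$ copies of $Q$), $\mathcal{R}=\mathrm{blkdiag}(R,\ldots,R)$ ($N$ copies), $\mu\ge0$. $\mathcal{A},\mathcal{B},\mathcal{D}$ are the matrices obtained by stacking the dynamics over the horizon: block row $k\in\{0,\ldots,N\}$ of $\mathcal{A}$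 is $A^k$, and the $(k,j)$ blocks ($0\le j\le N-1$) of $\mathcal{B}$ and $\mathcal{D}$ are $A^{k-1-j}B$ and $A^{k-1-j}$ for $j<k$, and $0$ otherwise. **Policy class.** $\boldsymbol{\eta}_t\in\mathbb{R}^{mN}$; $\boldsymbol{\Theta}_t\in\mathbb{R}^{mN\times d(N-1)}$ and $\boldsymbol{\Lambda}_t\in\mathbb{R}^{mN\times(N-1)}$ are strictly lower block triangular, with blocks $\theta_{\ell,t+i}\in\mathbb{R}^{m\times d}$, respectively $\lambda_{\ell,t+i}\in\mathbb{R}^m$, in block row $\ell\in\{0,\ldots,N-1\}$ and block column $i\in\{0,\ldots,N-2\}$, zero unless $i<\ell$. $\mathfrak{e}(w_{t:N-1})=[\mathfrak{e}_1(w_t)^\top\cdots\mathfrak{e}_{N-1}(w_{t+N-2})^\top]^\top$, where each $\mathfrak{e}_i:\mathbb{R}^d\to\mathbb{R}^d$ is a component-wise saturation function symmetric about the origin (odd), and $\|\mathfrak{e}(w_{t:N-1})\|_\infty\le\varphi_{\max}$. The hard control constraint is required for all values $\nu_{t:N}\in\{0,1\}^{N}$ and all values of the vector $\mathfrak{e}(w_{t:N-1})$ with $\|\cdot\|_\infty\le\varphi_{\max}$. **Regularizer.** Let $F_t=[\boldsymbol{\eta}_t\ \boldsymbol{\Theta}_t\ \boldsymbol{\Lambda}_t]$, and let $\hat F_t$ be the matrix with $N$ rows obtained from $F_t$ by replacing each $m\times1$ block by its transpose (so $\hat F_t=F_t$ if $m=1$; the $i$th row of $\hat F_t$ lists all entries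 of the $i$th $m$-row block of $F_t$). Then $\varrho_t(\boldsymbol{\eta}_t,\boldsymbol{\Theta}_t,\boldsymbol{\Lambda}_t)=\sum_{i=1}^N\|\hat F_t^{(i,:)}\|_\infty$. **Sequential transmission protocol.** Solely the control values $u_{t+\ell}$ are computed and transmitted at each instant $t+\ell$, $\ell\in\{0,\ldots,N_r-1\}$; if a packet is lost, zero control is applied at that instant. Correspondingly $\mathcal{S}=\mathrm{blkdiag}(I_m\nu_t,\ldots,I_m\nu_{t+N_r-1},I_{m(N-N_r)})$. **Matrices of the program.** For $\ell=1,\ldots,N-1$ let $\mathfrak{C}_\ell=\begin{bmatrix}0_{m\ell\times m(N-\ell)}\\ I_{m(N-\ell)}\end{bmatrix}$, $\bar{\boldsymbol{\Lambda}}_t^{(:,\ell)}=\mathfrak{C}_\ell^\top\boldsymbol{\Lambda}_t^{(:,\ell)}$, $\tilde{\boldsymbol{\Lambda}}_t=[(\bar{\boldsymbol{\Lambda}}_t^{(:,1)})^\top\cdots(\bar{\boldsymbol{\Lambda}}_t^{(:,N-1)})^\top]^\top$, $\Xi_t=\begin{bmatrix}\boldsymbol{\eta}_t\\ \tilde{\boldsymbol{\Lambda}}_t\end{bmatrix}$, $\mathcal{S}_\ell=\nu_{t+\ell-1}\mathcal{S}$, $\alpha=\mathcal{B}^\top\mathcal{Q}\mathcal{B}+\mathcal{R}$, $\mu_{\mathcal{S}}=\mathbb{E}[\mathcal{S}]$, $\Sigma_{\mathcal{S}}=\mathbb{E}[\mathcal{S}^\top\alpha\mathcal{S}]$. Then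 $$\mathcal{L}=\begin{bmatrix}\Sigma_{\mathcal{S}}&\tilde\Sigma_{\mathcal{S}\mathcal{S}_\ell}\\ \tilde\Sigma_{\mathcal{S}\mathcal{S}_\ell}^\top&\tilde\Sigma_{\mathcal{S}_{n\ell}}\end{bmatrix},\qquad \mathcal{M}=2\begin{bmatrix}\mathcal{Q}\mathcal{B}\mu_{\mathcal{S}}&\mathcal{Q}\mathcal{B}\tilde\mu_{\mathcal{S}_\ell}\end{bmatrix}^\top,$$ with $\tilde\Sigma_{\mathcal{S}\mathcal{S}_\ell}$ the block row with blocks $\mathbb{E}[\mathcal{S}^\top\alpha\mathcal{S}_\ell]\mathfrak{C}_\ell$, $\ell=1,\ldots,N-1$; $\tilde\Sigma_{\mathcal{S}_{n\ell}}$ the block matrix with $(n,\ell)$ block $\mathfrak{C}_n^\top\mathbb{E}[\mathcal{S}_n^\top\alpha\mathcal{S}_\ell]\mathfrak{C}_\ell$, $n,\ell=1,\ldots,N-1$; $\tilde\mu_{\mathcal{S}_\ell}$ the block row with blocks $\mathbb{E}[\mathcal{S}_\ell]\mathfrak{C}_\ell$, $\ell=1,\ldots,N-1$. Further $\Sigma_{\mathfrak{e}}'=\mathbb{E}[w_{t:N}\,\mathfrak{e}(w_{t:N-1})^\top]$, $\Sigma_W=\mathbb{E}[w_{t:N}w_{t:N}^\top]$, $\Sigma_{\mathfrak{e}}=\mathbb{E}[\mathfrak{e}(w_{t:N-1})\mathfrak{e}(w_{t:N-1})^\top]$. "Convex quadratic program" is understood in the paper's sense: a convex quadratic objective plus the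 (convex, piecewise linear) $\ell_1/\ell_\infty$ regularizer, with convex piecewise linear constraints. *)

theory Defs
  imports "HOL-Probability.Probability" "Jordan_Normal_Form.Matrix"
begin

hide_const (open) Finite_Cartesian_Product.mat Finite_Cartesian_Product.vec
  Finite_Cartesian_Product.row Finite_Cartesian_Product.column
unbundle no vec_syntax
no_notation inner (infix "\<bullet>" 70)

definition linf_norm :: "real vec \<Rightarrow> real" where
  "linf_norm v = Max (insert 0 ((\<lambda>i. \<bar>v $ i\<bar>) ` {..<dim_vec v}))"

definition l1_norm :: "real vec \<Rightarrow> real" where
  "l1_norm v = (\<Sum>i<dim_vec v. \<bar>v $ i\<bar>)"

definition tr :: "real mat \<Rightarrow> real" where
  "tr A = (\<Sum>i<dim_row A. A $$ (i, i))"

definition sym_psd :: "nat \<Rightarrow> real mat \<Rightarrow> bool" where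
  "sym_psd n A \<longleftrightarrow> A \<in> carrier_mat n n \<and> A\<^sup>T = A \<and> (\<forall>v\<in>carrier_vec n. 0 \<le> v \<bullet> (A *\<^sub>v v))"

definition sym_pd :: "nat \<Rightarrow> real mat \<Rightarrow> bool" where
  "sym_pd n A \<longleftrightarrow> A \<in> carrier_mat n n \<and> A\<^sup>T = A \<and>
     (\<forall>v\<in>carrier_vec n. v \<noteq> 0\<^sub>v n \<longrightarrow> 0 < v \<bullet> (A *\<^sub>v v))"

definition beside :: "real mat \<Rightarrow> real mat \<Rightarrow> real mat" where
  "beside A B = four_block_mat A B (0\<^sub>m 0 (dim_col A)) (0\<^sub>m 0 (dim_col B))"

text \<open>
  Concatenation of a (possibly empty) list of matrices with \<open>r\<close> rows into a block row, and of a
  list of matrices with \<open>c\<close> columns into a block column.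
\<close>
definition hcat :: "nat \<Rightarrow> real mat list \<Rightarrow> real mat" where
  "hcat r Ms = foldr beside Ms (0\<^sub>m r 0)"

definition vcat :: "nat \<Rightarrow> real mat list \<Rightarrow> real mat" where
  "vcat c Ms = foldr append_rows Ms (0\<^sub>m 0 c)"

text \<open>The stacked vector of the \<open>k\<close> vectors \<open>s n, \<dots>, s (n + k - 1)\<close> of length \<open>b\<close>.\<close>
definition stack :: "nat \<Rightarrow> (nat \<Rightarrow> real vec) \<Rightarrow> nat \<Rightarrow> nat \<Rightarrow> real vec" where
  "stack b s n k = vec (b * k) (\<lambda>i. s (n + i div b) $ (i mod b))"

definition block :: "nat \<Rightarrow> nat \<Rightarrow> real vec \<Rightarrow> real vec" where
  "block b k v = vec b (\<lambda>i. v $ (b * k + i))"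

text \<open>The Borel \<open>\<sigma>\<close>-algebra on vectors of length \<open>n\<close>, transported from the product space.\<close>
definition vec_borel :: "nat \<Rightarrow> real vec measure" where
  "vec_borel n = vimage_algebra (carrier_vec n) (\<lambda>v. \<lambda>i\<in>{..<n}. v $ i) (\<Pi>\<^sub>M i\<in>{..<n}. borel)"

record 'w ncs =
  pspace :: "'w measure"
  dim_x :: nat
  dim_u :: nat
  mat_A :: "real mat"
  mat_B :: "real mat"
  x_init :: "real vec"
  noise :: "nat \<Rightarrow> 'w \<Rightarrow> real vec"
  channel :: "nat \<Rightarrow> 'w \<Rightarrow> real"
  succ_prob :: real
  u_max :: real
  horizon :: nat
  recalc :: nat
  cost_Q :: "real mat"
  cost_Qf :: "real mat"
  cost_R :: "real mat"
  reg_weight :: real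
  sat :: "nat \<Rightarrow> real vec \<Rightarrow> real vec"
  phi_max :: real

text \<open>
  The index of \<open>sat\<close> runs from one to \<open>horizon - 1\<close>.
  A component-wise odd saturation function; the scalar functions may differ between components.
  Monotonicity is not required, only measurability, oddness and boundedness.
\<close>
definition saturation :: "nat \<Rightarrow> real \<Rightarrow> (real vec \<Rightarrow> real vec) \<Rightarrow> bool" where
  "saturation d b f \<longleftrightarrow> (\<exists>\<sigma> :: nat \<Rightarrow> real \<Rightarrow> real.
     (\<forall>j<d. \<sigma> j \<in> borel_measurable borel \<and> (\<forall>r. \<sigma> j (- r) = - \<sigma> j r) \<and> (\<forall>r. \<bar>\<sigma> j r\<bar> \<le> b)) \<and>
     (\<forall>v\<in>carrier_vec d. f v = vec d (\<lambda>j. \<sigma> j (v $ j))))"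

text \<open>
  The bound \<open>0 \<le> phi_max\<close> is implied by the saturation bound unless the horizon is one, when
  it says that the norm of the empty vector is at most \<open>phi_max\<close>. Independence of the two
  processes is stated by \<open>indep_set\<close> because \<open>indep_var\<close> needs a common value type.
\<close>
locale networked_control = prob_space "pspace P" for P :: "'w ncs" +
  assumes dims: "0 < dim_x P" "0 < dim_u P"
    and plant: "mat_A P \<in> carrier_mat (dim_x P) (dim_x P)"
      "mat_B P \<in> carrier_mat (dim_x P) (dim_u P)" "x_init P \<in> carrier_vec (dim_x P)"
    and channel_range: "\<And>t \<omega>. \<omega> \<in> space (pspace P) \<Longrightarrow> channel P t \<omega> \<in> {0, 1}"
    and channel_indep: "indep_vars (\<lambda>_. borel) (channel P) UNIV"
    and channel_mean: "\<And>t. expectation (channel P t) = succ_prob P"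
    and succ_prob: "0 < succ_prob P" "succ_prob P \<le> 1"
    and noise_indep: "indep_vars (\<lambda>_. vec_borel (dim_x P)) (noise P) UNIV"
    and noise_ident: "\<And>t. distr (pspace P) (vec_borel (dim_x P)) (noise P t) =
      distr (pspace P) (vec_borel (dim_x P)) (noise P 0)"
    and noise_symmetric: "\<And>t. distr (pspace P) (vec_borel (dim_x P)) (\<lambda>\<omega>. - noise P t \<omega>) =
      distr (pspace P) (vec_borel (dim_x P)) (noise P t)"
    and noise_second_moment:
      "\<And>t i. i < dim_x P \<Longrightarrow> integrable (pspace P) (\<lambda>\<omega>. (noise P t \<omega> $ i)\<^sup>2)"
    and noise_mean: "\<And>t i. i < dim_x P \<Longrightarrow> expectation (\<lambda>\<omega>. noise P t \<omega> $ i) = 0"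
    and noise_channel_indep: "indep_set
      (sets (vimage_algebra (space (pspace P)) (\<lambda>\<omega> t. noise P t \<omega>)
        (\<Pi>\<^sub>M t\<in>UNIV. vec_borel (dim_x P))))
      (sets (vimage_algebra (space (pspace P)) (\<lambda>\<omega> t. channel P t \<omega>)
        (\<Pi>\<^sub>M t\<in>UNIV. borel)))"
    and u_max: "0 < u_max P"
    and horizon: "1 \<le> horizon P" "1 \<le> recalc P" "recalc P \<le> horizon P"
    and cost_mats: "sym_psd (dim_x P) (cost_Q P)" "sym_psd (dim_x P) (cost_Qf P)"
      "sym_pd (dim_u P) (cost_R P)"
    and reg_weight: "0 \<le> reg_weight P"
    and sat: "\<And>i. 1 \<le> i \<Longrightarrow> i < horizon P \<Longrightarrow> saturation (dim_x P) (phi_max P) (sat P i)"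
    and phi_max: "0 \<le> phi_max P"

definition calA :: "'w ncs \<Rightarrow> real mat" where
  "calA P = (let d = dim_x P in
     mat (d * (horizon P + 1)) d (\<lambda>(i, j). (mat_A P ^\<^sub>m (i div d)) $$ (i mod d, j)))"

definition calB :: "'w ncs \<Rightarrow> real mat" where
  "calB P = (let d = dim_x P; m = dim_u P in
     mat (d * (horizon P + 1)) (m * horizon P) (\<lambda>(i, j).
       if j div m < i div d
       then (mat_A P ^\<^sub>m (i div d - 1 - j div m) * mat_B P) $$ (i mod d, j mod m) else 0))"

definition calD :: "'w ncs \<Rightarrow> real mat" where
  "calD P = (let d = dim_x P in
     mat (d * (horizon P + 1)) (d * horizon P) (\<lambda>(i, j).
       if j div d < i div d
       then (mat_A P ^\<^sub>m (i div d - 1 - j div d)) $$ (i mod d, j mod d) else 0))"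

definition calQ :: "'w ncs \<Rightarrow> real mat" where
  "calQ P = diag_block_mat (replicate (horizon P) (cost_Q P) @ [cost_Qf P])"

definition calR :: "'w ncs \<Rightarrow> real mat" where
  "calR P = diag_block_mat (replicate (horizon P) (cost_R P))"

text \<open>A policy is a triple \<open>(\<eta>, \<Theta>, \<Lambda>)\<close>.\<close>
type_synonym policy = "real vec \<times> real mat \<times> real mat"

definition policy_class :: "'w ncs \<Rightarrow> policy set" where
  "policy_class P = (let d = dim_x P; m = dim_u P; N = horizon P in
     {(\<eta>, \<Theta>, \<Lambda>). \<eta> \<in> carrier_vec (m * N) \<and>
        \<Theta> \<in> carrier_mat (m * N) (d * (N - 1)) \<and> \<Lambda> \<in> carrier_mat (m * N) (N - 1) \<and>
        (\<forall>i<m * N. \<forall>j<d * (N - 1). \<not> j div d < i div m \<longrightarrow> \<Theta> $$ (i, j) = 0) \<and>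
        (\<forall>i<m * N. \<forall>j<N - 1. \<not> j < i div m \<longrightarrow> \<Lambda> $$ (i, j) = 0)})"

fun mix :: "real \<Rightarrow> policy \<Rightarrow> policy \<Rightarrow> policy" where
  "mix u (\<eta>, \<Theta>, \<Lambda>) (\<eta>', \<Theta>', \<Lambda>') =
     (u \<cdot>\<^sub>v \<eta> + (1 - u) \<cdot>\<^sub>v \<eta>', u \<cdot>\<^sub>m \<Theta> + (1 - u) \<cdot>\<^sub>m \<Theta>', u \<cdot>\<^sub>m \<Lambda> + (1 - u) \<cdot>\<^sub>m \<Lambda>')"

fun control :: "policy \<Rightarrow> real vec \<Rightarrow> real vec \<Rightarrow> real vec" where
  "control (\<eta>, \<Theta>, \<Lambda>) e n = \<eta> + \<Theta> *\<^sub>v e + \<Lambda> *\<^sub>v n"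

fun policy_mat :: "'w ncs \<Rightarrow> policy \<Rightarrow> real mat" where
  "policy_mat P (\<eta>, \<Theta>, \<Lambda>) =
     (let r = dim_u P * horizon P in hcat r [mat_of_cols r [\<eta>], \<Theta>, \<Lambda>])"

definition policy_mat_hat :: "'w ncs \<Rightarrow> policy \<Rightarrow> real mat" where
  "policy_mat_hat P F = (let m = dim_u P; G = policy_mat P F in
     mat (horizon P) (m * dim_col G) (\<lambda>(i, j). G $$ (m * i + j mod m, j div m)))"

definition regularizer :: "'w ncs \<Rightarrow> policy \<Rightarrow> real" where
  "regularizer P F = (\<Sum>i<horizon P. linf_norm (row (policy_mat_hat P F) i))"

text \<open>All entries of a policy listed as one vector, row by row of \<open>policy_mat\<close>.\<close>
definition num_coords :: "'w ncs \<Rightarrow> nat" where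
  "num_coords P = (let N = horizon P in dim_u P * N * (1 + dim_x P * (N - 1) + (N - 1)))"

definition coords :: "'w ncs \<Rightarrow> policy \<Rightarrow> real vec" where
  "coords P F = (let G = policy_mat P F in
     vec (num_coords P) (\<lambda>k. G $$ (k div dim_col G, k mod dim_col G)))"

text \<open>The matrix \<open>\<S>\<close> for a given vector \<open>b\<close> of \<open>N\<close> channel outcomes.\<close>
definition protocol_mat :: "'w ncs \<Rightarrow> real vec \<Rightarrow> real mat" where
  "protocol_mat P b = diag_block_mat
     (map (\<lambda>k. b $ k \<cdot>\<^sub>m 1\<^sub>m (dim_u P)) [0..<recalc P] @
      [1\<^sub>m (dim_u P * (horizon P - recalc P))])"

definition channel_vec :: "'w ncs \<Rightarrow> nat \<Rightarrow> nat \<Rightarrow> 'w \<Rightarrow> real vec" where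
  "channel_vec P t k \<omega> = vec k (\<lambda>i. channel P (t + i) \<omega>)"

definition noise_vec :: "'w ncs \<Rightarrow> nat \<Rightarrow> 'w \<Rightarrow> real vec" where
  "noise_vec P t \<omega> = stack (dim_x P) (\<lambda>s. noise P s \<omega>) t (horizon P)"

definition sat_vec :: "'w ncs \<Rightarrow> nat \<Rightarrow> 'w \<Rightarrow> real vec" where
  "sat_vec P t \<omega> = stack (dim_x P) (\<lambda>i. sat P i (noise P (t + i - 1) \<omega>)) 1 (horizon P - 1)"

definition calS :: "'w ncs \<Rightarrow> nat \<Rightarrow> 'w \<Rightarrow> real mat" where
  "calS P t \<omega> = protocol_mat P (channel_vec P t (horizon P) \<omega>)"

definition plant_input :: "'w ncs \<Rightarrow> nat \<Rightarrow> policy \<Rightarrow> 'w \<Rightarrow> real vec" where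
  "plant_input P t F \<omega> =
     calS P t \<omega> *\<^sub>v control F (sat_vec P t \<omega>) (channel_vec P t (horizon P - 1) \<omega>)"

definition stacked_state :: "'w ncs \<Rightarrow> nat \<Rightarrow> real vec \<Rightarrow> policy \<Rightarrow> 'w \<Rightarrow> real vec" where
  "stacked_state P t x F \<omega> =
     calA P *\<^sub>v x + calB P *\<^sub>v plant_input P t F \<omega> + calD P *\<^sub>v noise_vec P t \<omega>"

definition cost :: "'w ncs \<Rightarrow> nat \<Rightarrow> real vec \<Rightarrow> policy \<Rightarrow> 'w \<Rightarrow> real" where
  "cost P t x F \<omega> =
     stacked_state P t x F \<omega> \<bullet> (calQ P *\<^sub>v stacked_state P t x F \<omega>) +
     plant_input P t F \<omega> \<bullet> (calR P *\<^sub>v plant_input P t F \<omega>)"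

definition control_set :: "'w ncs \<Rightarrow> real vec set" where
  "control_set P = {v \<in> carrier_vec (dim_u P). linf_norm v \<le> u_max P}"

definition hard_feasible :: "'w ncs \<Rightarrow> policy set" where
  "hard_feasible P = (let N = horizon P in
     {F \<in> policy_class P. \<forall>b\<in>carrier_vec N. \<forall>e\<in>carrier_vec (dim_x P * (N - 1)).
        (\<forall>i<N. b $ i \<in> {0, 1}) \<longrightarrow> linf_norm e \<le> phi_max P \<longrightarrow>
        (\<forall>k<N. block (dim_u P) k (protocol_mat P b *\<^sub>v control F e (vec_first b (N - 1)))
           \<in> control_set P)})"

text \<open>
  The decision at a recalculation instant is taken on the basis of the current state, that is,
  by a measurable map from states to policies. Deterministic policies are the constant rules.
  Since a conditional expectation is determined only almost surely, for each integrand
  separately, quantifying over rules (rather than over the uncountably many policies at a fixed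
  outcome) is what lets the objective be compared at the policy selected for each state.
\<close>
definition decision_rules :: "'w ncs \<Rightarrow> (real vec \<Rightarrow> policy) set" where
  "decision_rules P = {g. (\<forall>x\<in>carrier_vec (dim_x P). g x \<in> policy_class P) \<and>
     (\<lambda>x. coords P (g x)) \<in> vec_borel (dim_x P) \<rightarrow>\<^sub>M vec_borel (num_coords P)}"

definition feasible_rules :: "'w ncs \<Rightarrow> (real vec \<Rightarrow> policy) set" where
  "feasible_rules P =
     {g \<in> decision_rules P. \<forall>x\<in>carrier_vec (dim_x P). g x \<in> hard_feasible P}"

text \<open>
  The state process when the rule \<open>K k\<close> is used at the instant \<open>k * recalc P\<close> and the first
  \<open>recalc P\<close> blocks of the resulting plant input are applied. The input is causal although
  \<open>plant_input\<close> mentions the whole horizon: by strict block triangularity, block \<open>l\<close> ignores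
  the noise from the instant \<open>k * recalc P + l\<close> on and all later channel outcomes.
\<close>
definition closed_loop ::
  "'w ncs \<Rightarrow> (nat \<Rightarrow> real vec \<Rightarrow> policy) \<Rightarrow> (nat \<Rightarrow> 'w \<Rightarrow> real vec) \<Rightarrow> bool" where
  "closed_loop P K x \<longleftrightarrow> (\<forall>\<omega>\<in>space (pspace P). x 0 \<omega> = x_init P \<and>
     (\<forall>s. let k = s div recalc P; \<tau> = k * recalc P in
        x (Suc s) \<omega> = mat_A P *\<^sub>v x s \<omega> +
          mat_B P *\<^sub>v block (dim_u P) (s mod recalc P) (plant_input P \<tau> (K k (x \<tau> \<omega>)) \<omega>) +
          noise P s \<omega>))"

definition state_algebra :: "'w ncs \<Rightarrow> ('w \<Rightarrow> real vec) \<Rightarrow> 'w measure" where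
  "state_algebra P y = vimage_algebra (space (pspace P)) y (vec_borel (dim_x P))"

definition rule_cost ::
  "'w ncs \<Rightarrow> (nat \<Rightarrow> 'w \<Rightarrow> real vec) \<Rightarrow> nat \<Rightarrow> (real vec \<Rightarrow> policy) \<Rightarrow> 'w \<Rightarrow> real" where
  "rule_cost P x t g \<omega> = cost P t (x t \<omega>) (g (x t \<omega>)) \<omega>"

definition objective ::
  "'w ncs \<Rightarrow> (nat \<Rightarrow> 'w \<Rightarrow> real vec) \<Rightarrow> nat \<Rightarrow> (real vec \<Rightarrow> policy) \<Rightarrow> 'w \<Rightarrow> real" where
  "objective P x t g \<omega> =
     real_cond_exp (pspace P) (state_algebra P (x t)) (rule_cost P x t g) \<omega> +
     reg_weight P * regularizer P (g (x t \<omega>))"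

definition mean_mat :: "'w ncs \<Rightarrow> nat \<Rightarrow> nat \<Rightarrow> ('w \<Rightarrow> real mat) \<Rightarrow> real mat" where
  "mean_mat P r c X = mat r c (\<lambda>(i, j). integral\<^sup>L (pspace P) (\<lambda>\<omega>. X \<omega> $$ (i, j)))"

definition outer :: "real vec \<Rightarrow> real vec \<Rightarrow> real mat" where
  "outer v w = mat (dim_vec v) (dim_vec w) (\<lambda>(i, j). v $ i * w $ j)"

definition calC :: "'w ncs \<Rightarrow> nat \<Rightarrow> real mat" where
  "calC P l = (let m = dim_u P; N = horizon P in 0\<^sub>m (m * l) (m * (N - l)) @\<^sub>r 1\<^sub>m (m * (N - l)))"

text \<open>\<open>\<Xi>\<close>; the columns of \<open>\<Lambda>\<close> are numbered from zero here.\<close>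
fun Xi :: "'w ncs \<Rightarrow> policy \<Rightarrow> real vec" where
  "Xi P (\<eta>, \<Theta>, \<Lambda>) =
     \<eta> @\<^sub>v foldr (@\<^sub>v) (map (\<lambda>l. (calC P l)\<^sup>T *\<^sub>v col \<Lambda> (l - 1)) [1..<horizon P]) vNil"

definition calS_l :: "'w ncs \<Rightarrow> nat \<Rightarrow> nat \<Rightarrow> 'w \<Rightarrow> real mat" where
  "calS_l P t l \<omega> = channel P (t + l - 1) \<omega> \<cdot>\<^sub>m calS P t \<omega>"

definition alpha :: "'w ncs \<Rightarrow> real mat" where
  "alpha P = (calB P)\<^sup>T * calQ P * calB P + calR P"

definition mean_sq :: "'w ncs \<Rightarrow> ('w \<Rightarrow> real mat) \<Rightarrow> real mat" where
  "mean_sq P = mean_mat P (dim_u P * horizon P) (dim_u P * horizon P)"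

definition mu_S :: "'w ncs \<Rightarrow> nat \<Rightarrow> real mat" where
  "mu_S P t = mean_sq P (calS P t)"

definition Sigma_S :: "'w ncs \<Rightarrow> nat \<Rightarrow> real mat" where
  "Sigma_S P t = mean_sq P (\<lambda>\<omega>. (calS P t \<omega>)\<^sup>T * alpha P * calS P t \<omega>)"

definition Sigma_SSl :: "'w ncs \<Rightarrow> nat \<Rightarrow> real mat" where
  "Sigma_SSl P t = hcat (dim_u P * horizon P)
     (map (\<lambda>l. mean_sq P (\<lambda>\<omega>. (calS P t \<omega>)\<^sup>T * alpha P * calS_l P t l \<omega>) * calC P l)
        [1..<horizon P])"

definition Sigma_Snl :: "'w ncs \<Rightarrow> nat \<Rightarrow> real mat" where
  "Sigma_Snl P t = vcat (\<Sum>l=1..<horizon P. dim_u P * (horizon P - l))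
     (map (\<lambda>n. hcat (dim_u P * (horizon P - n))
        (map (\<lambda>l. (calC P n)\<^sup>T *
            mean_sq P (\<lambda>\<omega>. (calS_l P t n \<omega>)\<^sup>T * alpha P * calS_l P t l \<omega>) * calC P l)
          [1..<horizon P]))
      [1..<horizon P])"

definition mu_Sl :: "'w ncs \<Rightarrow> nat \<Rightarrow> real mat" where
  "mu_Sl P t = hcat (dim_u P * horizon P)
     (map (\<lambda>l. mean_sq P (calS_l P t l) * calC P l) [1..<horizon P])"

definition calL :: "'w ncs \<Rightarrow> nat \<Rightarrow> real mat" where
  "calL P t = four_block_mat (Sigma_S P t) (Sigma_SSl P t) ((Sigma_SSl P t)\<^sup>T) (Sigma_Snl P t)"

definition calM :: "'w ncs \<Rightarrow> nat \<Rightarrow> real mat" where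
  "calM P t = 2 \<cdot>\<^sub>m (beside (calQ P * calB P * mu_S P t) (calQ P * calB P * mu_Sl P t))\<^sup>T"

definition Sigma_e' :: "'w ncs \<Rightarrow> nat \<Rightarrow> real mat" where
  "Sigma_e' P t = mean_mat P (dim_x P * horizon P) (dim_x P * (horizon P - 1))
     (\<lambda>\<omega>. outer (noise_vec P t \<omega>) (sat_vec P t \<omega>))"

definition Sigma_W :: "'w ncs \<Rightarrow> nat \<Rightarrow> real mat" where
  "Sigma_W P t = mean_mat P (dim_x P * horizon P) (dim_x P * horizon P)
     (\<lambda>\<omega>. outer (noise_vec P t \<omega>) (noise_vec P t \<omega>))"

definition Sigma_e :: "'w ncs \<Rightarrow> nat \<Rightarrow> real mat" where
  "Sigma_e P t = mean_mat P (dim_x P * (horizon P - 1)) (dim_x P * (horizon P - 1))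
     (\<lambda>\<omega>. outer (sat_vec P t \<omega>) (sat_vec P t \<omega>))"

fun qp_quadratic :: "'w ncs \<Rightarrow> nat \<Rightarrow> real vec \<Rightarrow> policy \<Rightarrow> real" where
  "qp_quadratic P t x (\<eta>, \<Theta>, \<Lambda>) = (let \<Xi> = Xi P (\<eta>, \<Theta>, \<Lambda>) in
     \<Xi> \<bullet> (calL P t *\<^sub>v \<Xi>) + (calM P t *\<^sub>v (calA P *\<^sub>v x)) \<bullet> \<Xi> +
     (calA P *\<^sub>v x) \<bullet> (calQ P *\<^sub>v (calA P *\<^sub>v x)) +
     2 * tr (\<Theta>\<^sup>T * (mu_S P t)\<^sup>T * (calB P)\<^sup>T * calQ P * calD P * Sigma_e' P t) +
     tr ((calD P)\<^sup>T * calQ P * calD P * Sigma_W P t) +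
     tr (\<Theta>\<^sup>T * Sigma_S P t * \<Theta> * Sigma_e P t))"

definition qp_objective :: "'w ncs \<Rightarrow> nat \<Rightarrow> real vec \<Rightarrow> policy \<Rightarrow> real" where
  "qp_objective P t x F = qp_quadratic P t x F + reg_weight P * regularizer P F"

fun qp_constraint :: "'w ncs \<Rightarrow> nat \<Rightarrow> policy \<Rightarrow> real" where
  "qp_constraint P i (\<eta>, \<Theta>, \<Lambda>) =
     \<bar>\<eta> $ i + 1 / 2 * (row \<Lambda> i \<bullet> vec (horizon P - 1) (\<lambda>_. 1))\<bar> +
     1 / 2 * l1_norm (row \<Lambda> i) + l1_norm (row \<Theta> i) * phi_max P"

definition qp_feasible :: "'w ncs \<Rightarrow> policy set" where
  "qp_feasible P =
     {F \<in> policy_class P. \<forall>i<dim_u P * horizon P. qp_constraint P i F \<le> u_max P}"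

definition convex_policies :: "policy set \<Rightarrow> bool" where
  "convex_policies X \<longleftrightarrow> (\<forall>F\<in>X. \<forall>G\<in>X. \<forall>u\<in>{0..1}. mix u F G \<in> X)"

text \<open>Functions on the policy class that are convex quadratic, resp. maxima of finitely many
  affine functions, of the entries of the policy.\<close>
definition convex_quadratic :: "'w ncs \<Rightarrow> (policy \<Rightarrow> real) \<Rightarrow> bool" where
  "convex_quadratic P f \<longleftrightarrow> (\<exists>H c r. sym_psd (num_coords P) H \<and> c \<in> carrier_vec (num_coords P) \<and>
     (\<forall>F\<in>policy_class P.
        f F = coords P F \<bullet> (H *\<^sub>v coords P F) + c \<bullet> coords P F + r))"

definition convex_piecewise_linear :: "'w ncs \<Rightarrow> (policy \<Rightarrow> real) \<Rightarrow> bool" where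
  "convex_piecewise_linear P f \<longleftrightarrow> (\<exists>A :: (real vec \<times> real) set. finite A \<and> A \<noteq> {} \<and>
     A \<subseteq> carrier_vec (num_coords P) \<times> UNIV \<and>
     (\<forall>F\<in>policy_class P. f F = Max ((\<lambda>(a, b). a \<bullet> coords P F + b) ` A)))"

definition convex_quadratic_program :: "'w ncs \<Rightarrow> nat \<Rightarrow> real vec \<Rightarrow> bool" where
  "convex_quadratic_program P t x \<longleftrightarrow>
     convex_quadratic P (qp_quadratic P t x) \<and>
     convex_piecewise_linear P (\<lambda>F. reg_weight P * regularizer P F) \<and>
     (\<forall>i<dim_u P * horizon P. convex_piecewise_linear P (qp_constraint P i))"

end

theory Submission
  imports Defs
begin

text \<open>
  Why the theorem holds. Fix the recalculation instant \<open>t\<close>. Everything that happens over the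
  horizon is driven by the noise and the channel from \<open>t\<close> on, whereas the state \<open>x t\<close> is a function
  of the noise and the channel before \<open>t\<close> (\<open>state_past\<close>): block triangularity makes the inputs
  causal. Past and future are independent, so the conditional expectation of the cost given \<open>x t\<close>
  is obtained by freezing the state and the policy selected for it, and averaging over the future
  (\<open>cond_exp_freeze\<close>, \<open>cond_exp_rule_cost\<close>). It remains to compute the mean of the cost
  for a frozen state and a frozen policy.

  That computation rests on one representation. With \<open>s i\<close> the diagonal entries of
  the protocol matrix, the plant input has the entries
  \<open>u i = (\<Sum>l. A l i * \<sigma> l * s i) + (\<Sum>j. \<Theta> (i, j) * s i * e j)\<close>, where \<open>\<sigma> 0 = 1\<close>, \<open>A 0 = \<eta>\<close> and,
  for positive \<open>l\<close>, \<open>\<sigma> l\<close> is the channel outcome multiplying the column \<open>A l\<close> of \<open>\<Lambda>\<close>. The factors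
  \<open>\<sigma> l * s i\<close> depend on the channel only, the saturated noise \<open>e\<close> and the noise on the
  noise only, and these two are independent. Moreover \<open>e\<close> has mean zero because an odd function of a
  symmetric variable has mean zero (\<open>sat_vec_mean\<close>). Hence all cross terms between the channel
  part and the noise part vanish (\<open>plant_input_mean\<close>, \<open>plant_input_second_moment\<close>,
  \<open>plant_input_noise_moment\<close>), and the surviving moments are precisely the entries of the block
  matrices of the program (\<open>calL_quadratic\<close>, \<open>calM_linear\<close> and the three trace lemmas). This
  gives \<open>expected_cost_eq_qp\<close>.

  Convexity of the quadratic part does not need to be read off the block matrices. The plant input
  is a random linear map \<open>G\<close> of the coordinates of the policy, so the matrix of the quadratic form is
  the mean of \<open>G\<^sup>T * alpha * G\<close>, which is positive semidefinite since \<open>alpha\<close> is (\<open>convex_quadratic_qp\<close>).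

  For the hard constraint, each entry of the control is affine in the channel outcomes and in the
  saturated noise, so its worst case over the cube is attained at a vertex and equals the left-hand
  side of the constraint of the program. The factor \<open>s i\<close> does no harm: the outcome that
  decides about the transmission of a control is not among those on which that control depends, hence
  may be taken to be a success (\<open>hard_feasible_eq\<close>). The zero policy shows feasibility. Finally a
  feasible policy produces uniformly bounded inputs, which makes the states square integrable and the
  cost integrable.
\<close>

section \<open>Entries of vectors and matrices\<close>

(* N - 1 is a dimension throughout; rewriting 1 to Suc 0 would make its occurrences differ. *)
declare One_nat_def [simp del] policy_mat.simps [simp del] qp_constraint.simps [simp del]
  qp_quadratic.simps [simp del] Xi.simps [simp del]

lemma scalar_prod_mult_mat_vec:
  fixes M :: "'a::comm_semiring_0 mat"
  assumes "M \<in> carrier_mat r c" "v \<in> carrier_vec r" "w \<in> carrier_vec c"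
  shows "v \<bullet> (M *\<^sub>v w) = (\<Sum>i<r. \<Sum>j<c. v $ i * M $$ (i, j) * w $ j)"
  using assms by (auto simp: scalar_prod_def sum_distrib_left lessThan_atLeast0 mult.assoc
      intro!: sum.cong)

lemma mult_mat_vec_index:
  fixes M :: "real mat"
  assumes "M \<in> carrier_mat r c" "v \<in> carrier_vec c" "i < r"
  shows "(M *\<^sub>v v) $ i = (\<Sum>j<c. M $$ (i, j) * v $ j)"
  using assms by (auto simp: scalar_prod_def lessThan_atLeast0)

lemma linf_norm_le_iff:
  "linf_norm v \<le> c \<longleftrightarrow> 0 \<le> c \<and> (\<forall>i<dim_vec v. \<bar>v $ i\<bar> \<le> c)"
  unfolding linf_norm_def by (subst Max_le_iff) auto

lemma dim_beside: "dim_row (beside A B) = dim_row A" "dim_col (beside A B) = dim_col A + dim_col B"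
  by (simp_all add: beside_def)

lemma index_beside:
  assumes "dim_row B = dim_row A" "i < dim_row A" "j < dim_col A + dim_col B"
  shows "beside A B $$ (i, j) = (if j < dim_col A then A $$ (i, j) else B $$ (i, j - dim_col A))"
  using assms by (simp add: beside_def)

section \<open>Policies as coordinate vectors\<close>

context networked_control
begin

abbreviation "nx \<equiv> dim_x P"
abbreviation "nu \<equiv> dim_u P"
abbreviation "N \<equiv> horizon P"

text \<open>
  The number of columns of \<open>policy_mat\<close>: one for \<open>\<eta>\<close>, then those of \<open>\<Theta>\<close>, then those of \<open>\<Lambda>\<close>.
\<close>
definition ncols :: nat where
  "ncols = Suc (nx * (N - 1) + (N - 1))"

lemma nx_pos: "0 < nx" and nu_pos: "0 < nu" and N_pos: "0 < N"
  using dims horizon by auto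

lemma policy_class_iff:
  "(\<eta>, \<Theta>, \<Lambda>) \<in> policy_class P \<longleftrightarrow> \<eta> \<in> carrier_vec (nu * N) \<and>
     \<Theta> \<in> carrier_mat (nu * N) (nx * (N - 1)) \<and> \<Lambda> \<in> carrier_mat (nu * N) (N - 1) \<and>
     (\<forall>i<nu * N. \<forall>j<nx * (N - 1). \<not> j div nx < i div nu \<longrightarrow> \<Theta> $$ (i, j) = 0) \<and>
     (\<forall>i<nu * N. \<forall>j<N - 1. \<not> j < i div nu \<longrightarrow> \<Lambda> $$ (i, j) = 0)"
  by (auto simp: policy_class_def Let_def)

lemma policy_class_cases:
  assumes "F \<in> policy_class P"
  obtains \<eta> \<Theta> \<Lambda> where "F = (\<eta>, \<Theta>, \<Lambda>)" "\<eta> \<in> carrier_vec (nu * N)"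
    "\<Theta> \<in> carrier_mat (nu * N) (nx * (N - 1))" "\<Lambda> \<in> carrier_mat (nu * N) (N - 1)"
    "\<And>i j. i < nu * N \<Longrightarrow> j < nx * (N - 1) \<Longrightarrow> \<not> j div nx < i div nu \<Longrightarrow> \<Theta> $$ (i, j) = 0"
    "\<And>i j. i < nu * N \<Longrightarrow> j < N - 1 \<Longrightarrow> \<not> j < i div nu \<Longrightarrow> \<Lambda> $$ (i, j) = 0"
  using assms by (cases F) (auto simp: policy_class_iff)

lemma policy_mat_carrier:
  assumes "(\<eta>, \<Theta>, \<Lambda>) \<in> policy_class P"
  shows "policy_mat P (\<eta>, \<Theta>, \<Lambda>) \<in> carrier_mat (nu * N) ncols"
proof -
  have "dim_col \<Theta> = nx * (N - 1)" "dim_col \<Lambda> = N - 1"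
    using assms unfolding policy_class_iff by auto
  then show ?thesis
    by (intro carrier_matI) (simp_all add: ncols_def policy_mat.simps hcat_def Let_def dim_beside)
qed

lemma policy_mat_index:
  assumes "(\<eta>, \<Theta>, \<Lambda>) \<in> policy_class P" "i < nu * N"
  shows "policy_mat P (\<eta>, \<Theta>, \<Lambda>) $$ (i, 0) = \<eta> $ i"
    "j < nx * (N - 1) \<Longrightarrow> policy_mat P (\<eta>, \<Theta>, \<Lambda>) $$ (i, Suc j) = \<Theta> $$ (i, j)"
    "j < N - 1 \<Longrightarrow> policy_mat P (\<eta>, \<Theta>, \<Lambda>) $$ (i, Suc (nx * (N - 1) + j)) = \<Lambda> $$ (i, j)"
proof -
  have "dim_row \<Theta> = nu * N" "dim_row \<Lambda> = nu * N" "dim_col \<Theta> = nx * (N - 1)" "dim_col \<Lambda> = N - 1"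
    using assms(1) unfolding policy_class_iff by auto
  then show "policy_mat P (\<eta>, \<Theta>, \<Lambda>) $$ (i, 0) = \<eta> $ i"
    "j < nx * (N - 1) \<Longrightarrow> policy_mat P (\<eta>, \<Theta>, \<Lambda>) $$ (i, Suc j) = \<Theta> $$ (i, j)"
    "j < N - 1 \<Longrightarrow> policy_mat P (\<eta>, \<Theta>, \<Lambda>) $$ (i, Suc (nx * (N - 1) + j)) = \<Lambda> $$ (i, j)"
    using assms(2) by (simp_all add: policy_mat.simps hcat_def Let_def dim_beside index_beside mat_of_cols_index)
qed

lemma num_coords_eq: "num_coords P = nu * N * ncols"
  by (simp add: num_coords_def Let_def ncols_def algebra_simps)

lemma coords_carrier: "coords P F \<in> carrier_vec (num_coords P)"
  by (simp add: coords_def Let_def)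

lemma coord_less: "i < nu * N \<Longrightarrow> c < ncols \<Longrightarrow> i * ncols + c < num_coords P"
proof -
  assume "i < nu * N" "c < ncols"
  then have "i * ncols + c < Suc i * ncols" "Suc i * ncols \<le> nu * N * ncols"
    by (simp, intro mult_le_mono1) simp
  then show ?thesis by (simp only: num_coords_eq)
qed

lemma coords_index:
  assumes "F \<in> policy_class P" "i < nu * N" "c < ncols"
  shows "coords P F $ (i * ncols + c) = policy_mat P F $$ (i, c)"
proof -
  have "dim_col (policy_mat P F) = ncols"
    using policy_mat_carrier assms(1) by (cases F) auto
  then show ?thesis
    using coord_less[OF assms(2,3)] assms(3)
    by (simp add: coords_def Let_def)
qed

lemma mix_policy_class:
  assumes "F \<in> policy_class P" "G \<in> policy_class P"
  shows "mix u F G \<in> policy_class P"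
  using assms by (cases F; cases G) (auto simp: policy_class_iff)

lemma policy_mat_mix:
  assumes F: "F \<in> policy_class P" and G: "G \<in> policy_class P" and i: "i < nu * N" and c: "c < ncols"
  shows "policy_mat P (mix u F G) $$ (i, c) =
    u * policy_mat P F $$ (i, c) + (1 - u) * policy_mat P G $$ (i, c)"
proof -
  obtain \<eta> \<Theta> \<Lambda> \<eta>' \<Theta>' \<Lambda>' where FG: "F = (\<eta>, \<Theta>, \<Lambda>)" "G = (\<eta>', \<Theta>', \<Lambda>')"
    by (metis prod_cases3)
  note mm = mix_policy_class[OF F G, of u, unfolded FG mix.simps]
  note FG' = F[unfolded FG] G[unfolded FG]
  consider "c = 0" | j where "c = Suc j" "j < nx * (N - 1)"
    | j where "c = Suc (nx * (N - 1) + j)" "j < N - 1"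
  proof (cases c)
    case (Suc k)
    then show ?thesis
      using that(2)[of k] that(3)[of "k - nx * (N - 1)"] c by (cases "k < nx * (N - 1)") (auto simp: ncols_def)
  qed (rule that(1))
  then show ?thesis
    using FG' i
    by cases (auto simp: FG policy_mat_index[OF mm i] policy_mat_index[OF FG'(1) i]
        policy_mat_index[OF FG'(2) i] policy_class_iff)
qed

lemma coords_mix:
  assumes "F \<in> policy_class P" "G \<in> policy_class P"
  shows "coords P (mix u F G) = u \<cdot>\<^sub>v coords P F + (1 - u) \<cdot>\<^sub>v coords P G"
proof (rule eq_vecI)
  fix k assume "k < dim_vec (u \<cdot>\<^sub>v coords P F + (1 - u) \<cdot>\<^sub>v coords P G)"
  then have k: "k < nu * N * ncols" using coords_carrier[of G] num_coords_eq by auto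
  define i c where "i = k div ncols" and "c = k mod ncols"
  have ic: "i < nu * N" "c < ncols" "k = i * ncols + c"
    using k by (simp_all only: i_def c_def less_mult_imp_div_less div_mult_mod_eq)
      (simp add: ncols_def)
  show "coords P (mix u F G) $ k = (u \<cdot>\<^sub>v coords P F + (1 - u) \<cdot>\<^sub>v coords P G) $ k"
    unfolding ic(3)
    using coord_less[OF ic(1,2)] coords_carrier[of F] coords_carrier[of G]
    by (simp add: coords_index[OF _ ic(1,2)] assms mix_policy_class policy_mat_mix ic(1,2)
       )
qed (use coords_carrier[of "mix u F G"] coords_carrier[of G] in auto)

section \<open>Piecewise linear functions of a policy\<close>

text \<open>
  Agreement is asked on the policy class only, because the coordinates describe a policy only there.
\<close>
definition affine_in_policy :: "(policy \<Rightarrow> real) \<Rightarrow> bool" where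
  "affine_in_policy f \<longleftrightarrow> (\<exists>a\<in>carrier_vec (num_coords P). \<exists>b.
     \<forall>F\<in>policy_class P. f F = a \<bullet> coords P F + b)"

lemma affine_const: "affine_in_policy (\<lambda>_. c)"
  unfolding affine_in_policy_def using coords_carrier
  by (intro bexI[of _ "0\<^sub>v (num_coords P)"] exI[of _ c]) auto

lemma affine_add:
  assumes "affine_in_policy f" "affine_in_policy g"
  shows "affine_in_policy (\<lambda>F. f F + g F)"
proof -
  from assms obtain a b a' b' where "a \<in> carrier_vec (num_coords P)"
    "a' \<in> carrier_vec (num_coords P)" "\<forall>F\<in>policy_class P. f F = a \<bullet> coords P F + b"
    "\<forall>F\<in>policy_class P. g F = a' \<bullet> coords P F + b'"
    unfolding affine_in_policy_def by blast
  then show ?thesis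
    unfolding affine_in_policy_def using coords_carrier
    by (intro bexI[of _ "a + a'"] exI[of _ "b + b'"])
      (auto simp: add_scalar_prod_distrib[of _ "num_coords P"])
qed

lemma affine_cmult:
  assumes "affine_in_policy f"
  shows "affine_in_policy (\<lambda>F. c * f F)"
proof -
  from assms obtain a b where "a \<in> carrier_vec (num_coords P)"
    "\<forall>F\<in>policy_class P. f F = a \<bullet> coords P F + b"
    unfolding affine_in_policy_def by blast
  then show ?thesis
    unfolding affine_in_policy_def using coords_carrier
    by (intro bexI[of _ "c \<cdot>\<^sub>v a"] exI[of _ "c * b"])
      (auto simp: algebra_simps smult_scalar_prod_distrib[of _ "num_coords P"])
qed

lemma affine_sum:
  assumes "finite I" "\<And>i. i \<in> I \<Longrightarrow> affine_in_policy (f i)"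
  shows "affine_in_policy (\<lambda>F. \<Sum>i\<in>I. f i F)"
  using assms by (induction I) (auto intro: affine_const affine_add)

lemma affine_policy_mat:
  assumes "i < nu * N" "c < ncols"
  shows "affine_in_policy (\<lambda>F. policy_mat P F $$ (i, c))"
  unfolding affine_in_policy_def
  by (intro bexI[of _ "unit_vec (num_coords P) (i * ncols + c)"] exI[of _ 0])
    (use coord_less[OF assms] coords_index[OF _ assms] coords_carrier in
      \<open>auto simp: scalar_prod_left_unit[of _ "num_coords P"]\<close>)

lemma cpl_cong:
  "convex_piecewise_linear P f \<Longrightarrow> (\<And>F. F \<in> policy_class P \<Longrightarrow> g F = f F) \<Longrightarrow>
    convex_piecewise_linear P g"
  unfolding convex_piecewise_linear_def by metis

lemma cpl_affine:
  assumes "affine_in_policy f"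
  shows "convex_piecewise_linear P f"
proof -
  from assms obtain a b where "a \<in> carrier_vec (num_coords P)"
    "\<forall>F\<in>policy_class P. f F = a \<bullet> coords P F + b"
    unfolding affine_in_policy_def by blast
  then show ?thesis
    unfolding convex_piecewise_linear_def by (intro exI[of _ "{(a, b)}"]) auto
qed

lemma cpl_max:
  assumes "convex_piecewise_linear P f" "convex_piecewise_linear P g"
  shows "convex_piecewise_linear P (\<lambda>F. max (f F) (g F))"
proof -
  from assms obtain A B where A: "finite A" "A \<noteq> {}" "A \<subseteq> carrier_vec (num_coords P) \<times> UNIV"
      "\<forall>F\<in>policy_class P. f F = Max ((\<lambda>(a, b). a \<bullet> coords P F + b) ` A)"
    and B: "finite B" "B \<noteq> {}" "B \<subseteq> carrier_vec (num_coords P) \<times> UNIV"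
      "\<forall>F\<in>policy_class P. g F = Max ((\<lambda>(a, b). a \<bullet> coords P F + b) ` B)"
    unfolding convex_piecewise_linear_def by auto
  then show ?thesis
    unfolding convex_piecewise_linear_def
    by (intro exI[of _ "A \<union> B"]) (auto simp: image_Un Max_Un)
qed

text \<open>
  The pieces of a sum are the pairwise sums of pieces: maximizing over both indices independently
  turns the sum of two maxima into one maximum.
\<close>
lemma cpl_add:
  assumes "convex_piecewise_linear P f" "convex_piecewise_linear P g"
  shows "convex_piecewise_linear P (\<lambda>F. f F + g F)"
proof -
  from assms obtain A B where A: "finite A" "A \<noteq> {}" "A \<subseteq> carrier_vec (num_coords P) \<times> UNIV"
      "\<forall>F\<in>policy_class P. f F = Max ((\<lambda>(a, b). a \<bullet> coords P F + b) ` A)"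
    and B: "finite B" "B \<noteq> {}" "B \<subseteq> carrier_vec (num_coords P) \<times> UNIV"
      "\<forall>F\<in>policy_class P. g F = Max ((\<lambda>(a, b). a \<bullet> coords P F + b) ` B)"
    unfolding convex_piecewise_linear_def by auto
  let ?C = "(\<lambda>((a, b), (a', b')). (a + a', b + b')) ` (A \<times> B)"
  have "f F + g F = Max ((\<lambda>(a, b). a \<bullet> coords P F + b) ` ?C)" if F: "F \<in> policy_class P" for F
  proof -
    let ?v = "\<lambda>(a, b). a \<bullet> coords P F + b"
    have fin: "finite (?v ` ?C)" using A(1) B(1) by auto
    have val: "?v (a + a', b + b') = ?v (a, b) + ?v (a', b')"
      if "(a, b) \<in> A" "(a', b') \<in> B" for a b a' b'
      using add_scalar_prod_distrib[OF _ _ coords_carrier, of a a' F] that A(3) B(3) by auto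
    have "Max (?v ` A) \<in> ?v ` A" "Max (?v ` B) \<in> ?v ` B"
      using A(1,2) B(1,2) by (auto intro!: Max_in)
    then obtain a b a' b' where ab: "(a, b) \<in> A" "Max (?v ` A) = ?v (a, b)"
      "(a', b') \<in> B" "Max (?v ` B) = ?v (a', b')" by auto
    have "Max (?v ` ?C) = Max (?v ` A) + Max (?v ` B)"
    proof (rule Max_eqI[OF fin])
      fix y assume "y \<in> ?v ` ?C"
      then obtain a b a' b' where c: "(a, b) \<in> A" "(a', b') \<in> B" "y = ?v (a + a', b + b')" by auto
      then have "?v (a, b) \<le> Max (?v ` A)" "?v (a', b') \<le> Max (?v ` B)"
        using A(1) B(1) by (auto intro!: Max_ge simp: image_iff)
      then show "y \<le> Max (?v ` A) + Max (?v ` B)"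
        using val[OF c(1,2)] c(3) by linarith
    next
      show "Max (?v ` A) + Max (?v ` B) \<in> ?v ` ?C"
        unfolding ab(2,4) val[OF ab(1,3), symmetric] using ab(1,3) by (intro imageI) force
    qed
    then show ?thesis using A(4) B(4) F by simp
  qed
  moreover have "finite ?C" "?C \<noteq> {}" "?C \<subseteq> carrier_vec (num_coords P) \<times> UNIV"
    using A(1-3) B(1-3) by (force intro: add_carrier_vec)+
  ultimately show ?thesis unfolding convex_piecewise_linear_def by blast
qed

lemma cpl_cmult:
  assumes "convex_piecewise_linear P f" "0 \<le> c"
  shows "convex_piecewise_linear P (\<lambda>F. c * f F)"
proof -
  from assms obtain A where A: "finite A" "A \<noteq> {}" "A \<subseteq> carrier_vec (num_coords P) \<times> UNIV"
      "\<forall>F\<in>policy_class P. f F = Max ((\<lambda>(a, b). a \<bullet> coords P F + b) ` A)"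
    unfolding convex_piecewise_linear_def by auto
  let ?C = "(\<lambda>(a, b). (c \<cdot>\<^sub>v a, c * b)) ` A"
  have "c * f F = Max ((\<lambda>(a, b). a \<bullet> coords P F + b) ` ?C)" if F: "F \<in> policy_class P" for F
  proof -
    let ?v = "\<lambda>(a, b). a \<bullet> coords P F + b"
    have "c * Max (?v ` A) = Max ((*) c ` ?v ` A)"
      by (rule mono_Max_commute) (use A assms(2) in \<open>auto simp: mono_def mult_left_mono\<close>)
    also have "(*) c ` ?v ` A = ?v ` ?C"
      unfolding image_image using A(3) coords_carrier[of F]
      by (intro image_cong) (auto simp: smult_scalar_prod_distrib[of _ "num_coords P"] algebra_simps)
    finally show ?thesis using A(4) F by simp
  qed
  moreover have "finite ?C" "?C \<noteq> {}" "?C \<subseteq> carrier_vec (num_coords P) \<times> UNIV"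
    using A(1-3) by auto
  ultimately show ?thesis unfolding convex_piecewise_linear_def by blast
qed

lemma cpl_sum:
  assumes "finite I" "\<And>i. i \<in> I \<Longrightarrow> convex_piecewise_linear P (f i)"
  shows "convex_piecewise_linear P (\<lambda>F. \<Sum>i\<in>I. f i F)"
  using assms by (induction I) (auto intro: cpl_affine[OF affine_const] cpl_add)

lemma cpl_Max:
  assumes "finite I" "convex_piecewise_linear P g" "\<And>i. i \<in> I \<Longrightarrow> convex_piecewise_linear P (f i)"
  shows "convex_piecewise_linear P (\<lambda>F. Max (insert (g F) ((\<lambda>i. f i F) ` I)))"
  using assms(1,3)
proof (induction I)
  case (insert i I)
  have "Max (insert (g F) ((\<lambda>i. f i F) ` insert i I)) =
      max (f i F) (Max (insert (g F) ((\<lambda>i. f i F) ` I)))" for F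
    using insert(1) by (cases "I = {}") (simp_all add: insert_commute[of "g F"] max.commute)
  then show ?case using insert by (simp add: cpl_max)
qed (simp add: assms)

lemma cpl_abs:
  assumes "affine_in_policy f"
  shows "convex_piecewise_linear P (\<lambda>F. \<bar>f F\<bar>)"
proof -
  have "convex_piecewise_linear P (\<lambda>F. max (f F) ((-1) * f F))"
    using assms by (intro cpl_max cpl_affine affine_cmult)
  then show ?thesis by (rule cpl_cong) (auto simp: abs_if)
qed

text \<open>
  The entry \<open>j\<close> of row \<open>i\<close> of the rearranged matrix is an entry of the \<open>i\<close>-th block of rows of
  \<open>policy_mat\<close>, so the regularizer is a sum of maxima of absolute values of coordinates.
\<close>
lemma cpl_regularizer: "convex_piecewise_linear P (\<lambda>F. reg_weight P * regularizer P F)"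
proof (rule cpl_cmult[OF _ reg_weight])
  let ?e = "\<lambda>i j F. policy_mat P F $$ (nu * i + j mod nu, j div nu)"
  have "convex_piecewise_linear P
      (\<lambda>F. \<Sum>i<N. Max (insert 0 ((\<lambda>j. \<bar>?e i j F\<bar>) ` {..<nu * ncols})))"
  proof (intro cpl_sum cpl_Max cpl_abs affine_policy_mat cpl_affine[OF affine_const])
    fix i j assume "i \<in> {..<N}" and j: "j \<in> {..<nu * ncols}"
    then have "nu * i + j mod nu < nu * Suc i" "nu * Suc i \<le> nu * N"
      using nu_pos by (simp, intro mult_le_mono2) auto
    then show "nu * i + j mod nu < nu * N" by linarith
    show "j div nu < ncols"
      using j by (simp add: less_mult_imp_div_less mult.commute)
  qed auto
  then show "convex_piecewise_linear P (regularizer P)"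
  proof (rule cpl_cong)
    fix F assume F: "F \<in> policy_class P"
    have "dim_col (policy_mat P F) = ncols"
      using policy_mat_carrier F by (cases F) auto
    then have "linf_norm (row (policy_mat_hat P F) i) =
      Max (insert 0 ((\<lambda>j. \<bar>?e i j F\<bar>) ` {..<nu * ncols}))" if "i < N" for i
      using that unfolding linf_norm_def
      by (intro arg_cong[where f = Max] arg_cong[where f = "insert 0"] image_cong)
        (simp_all add: policy_mat_hat_def Let_def)
    then show "regularizer P F =
        (\<Sum>i<N. Max (insert 0 ((\<lambda>j. \<bar>?e i j F\<bar>) ` {..<nu * ncols})))"
      by (simp add: regularizer_def)
  qed
qed

lemma qp_constraint_eq:
  assumes "(\<eta>, \<Theta>, \<Lambda>) \<in> policy_class P" "i < nu * N"
  shows "qp_constraint P i (\<eta>, \<Theta>, \<Lambda>) = \<bar>\<eta> $ i + 1 / 2 * (\<Sum>j<N - 1. \<Lambda> $$ (i, j))\<bar> +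
    1 / 2 * (\<Sum>j<N - 1. \<bar>\<Lambda> $$ (i, j)\<bar>) + (\<Sum>j<nx * (N - 1). phi_max P * \<bar>\<Theta> $$ (i, j)\<bar>)"
  using assms unfolding policy_class_iff
  by (auto simp: qp_constraint.simps l1_norm_def scalar_prod_def sum_distrib_left lessThan_atLeast0 mult.commute
      intro!: arg_cong2[where f = "(+)"] arg_cong[where f = abs] sum.cong)

lemma cpl_qp_constraint:
  assumes i: "i < nu * N"
  shows "convex_piecewise_linear P (qp_constraint P i)"
proof -
  let ?e = "\<lambda>c F. policy_mat P F $$ (i, c)"
  have "convex_piecewise_linear P (\<lambda>F. \<bar>?e 0 F + 1 / 2 * (\<Sum>j<N - 1. ?e (Suc (nx * (N - 1) + j)) F)\<bar> +
    1 / 2 * (\<Sum>j<N - 1. \<bar>?e (Suc (nx * (N - 1) + j)) F\<bar>) +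
    (\<Sum>j<nx * (N - 1). phi_max P * \<bar>?e (Suc j) F\<bar>))"
    by (intro cpl_add cpl_abs cpl_cmult cpl_sum affine_add affine_sum affine_cmult
        affine_policy_mat[OF i]) (use phi_max in \<open>auto simp: ncols_def\<close>)
  then show ?thesis
  proof (rule cpl_cong)
    fix F assume "F \<in> policy_class P"
    then show "qp_constraint P i F = \<bar>?e 0 F + 1 / 2 * (\<Sum>j<N - 1. ?e (Suc (nx * (N - 1) + j)) F)\<bar> +
    1 / 2 * (\<Sum>j<N - 1. \<bar>?e (Suc (nx * (N - 1) + j)) F\<bar>) +
    (\<Sum>j<nx * (N - 1). phi_max P * \<bar>?e (Suc j) F\<bar>)"
      by (cases F) (simp add: qp_constraint_eq i policy_mat_index)
  qed
qed

lemma cpl_convex: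
  assumes f: "convex_piecewise_linear P f" and F: "F \<in> policy_class P" and G: "G \<in> policy_class P"
    and u: "u \<in> {0..1}"
  shows "f (mix u F G) \<le> u * f F + (1 - u) * f G"
proof -
  from f obtain A where A: "finite A" "A \<noteq> {}" "A \<subseteq> carrier_vec (num_coords P) \<times> UNIV"
      "\<forall>F\<in>policy_class P. f F = Max ((\<lambda>(a, b). a \<bullet> coords P F + b) ` A)"
    unfolding convex_piecewise_linear_def by auto
  have le: "a \<bullet> coords P F + b \<le> f F" if "(a, b) \<in> A" "F \<in> policy_class P" for a b F
    using A that by (auto intro!: Max_ge simp: image_iff)
  have "a \<bullet> coords P (mix u F G) + b \<le> u * f F + (1 - u) * f G" if ab: "(a, b) \<in> A" for a b
  proof -
    have "a \<in> carrier_vec (num_coords P)" using A(3) ab by auto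
    then have "a \<bullet> coords P (mix u F G) + b =
        u * (a \<bullet> coords P F + b) + (1 - u) * (a \<bullet> coords P G + b)"
      using coords_carrier[of F] coords_carrier[of G]
      by (simp add: coords_mix[OF F G] scalar_prod_add_distrib[of _ "num_coords P"] algebra_simps)
    also have "\<dots> \<le> u * f F + (1 - u) * f G"
      using u le[OF ab F] le[OF ab G] by (intro add_mono mult_left_mono) auto
    finally show ?thesis .
  qed
  then show ?thesis
    using A mix_policy_class[OF F G, of u] by (auto simp: Max_le_iff)
qed

text \<open>
  The gap between chord and graph is \<open>u * (1 - u)\<close> times the quadratic form of the difference of
  the two coordinate vectors.
\<close>
lemma convex_quadratic_convex:
  assumes f: "convex_quadratic P f" and F: "F \<in> policy_class P" and G: "G \<in> policy_class P"
    and u: "u \<in> {0..1}"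
  shows "f (mix u F G) \<le> u * f F + (1 - u) * f G"
proof -
  let ?n = "num_coords P"
  from f obtain H c r where H: "sym_psd ?n H" and c: "c \<in> carrier_vec ?n"
    and fF: "\<And>F. F \<in> policy_class P \<Longrightarrow> f F = coords P F \<bullet> (H *\<^sub>v coords P F) + c \<bullet> coords P F + r"
    unfolding convex_quadratic_def by auto
  note [simp] = coords_carrier
  have Hc: "H \<in> carrier_mat ?n ?n" using H by (simp add: sym_psd_def)
  define v w where "v = coords P F" and "w = coords P G"
  have [simp]: "v \<in> carrier_vec ?n" "w \<in> carrier_vec ?n" by (auto simp: v_def w_def)
  then have [simp]: "dim_vec v = ?n" "dim_vec w = ?n" by auto
  have "0 \<le> (v - w) \<bullet> (H *\<^sub>v (v - w))"
    using H by (auto simp: sym_psd_def)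
  moreover have "(v - w) \<bullet> (H *\<^sub>v (v - w)) =
      v \<bullet> (H *\<^sub>v v) - v \<bullet> (H *\<^sub>v w) - w \<bullet> (H *\<^sub>v v) + w \<bullet> (H *\<^sub>v w)"
    by (simp add: scalar_prod_mult_mat_vec[OF Hc] algebra_simps sum.distrib sum_subtractf)
  moreover have "(u \<cdot>\<^sub>v v + (1 - u) \<cdot>\<^sub>v w) \<bullet> (H *\<^sub>v (u \<cdot>\<^sub>v v + (1 - u) \<cdot>\<^sub>v w)) =
      u * (v \<bullet> (H *\<^sub>v v)) + (1 - u) * (w \<bullet> (H *\<^sub>v w)) - u * (1 - u) *
      (v \<bullet> (H *\<^sub>v v) - v \<bullet> (H *\<^sub>v w) - w \<bullet> (H *\<^sub>v v) + w \<bullet> (H *\<^sub>v w))"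
    by (simp add: scalar_prod_mult_mat_vec[OF Hc] algebra_simps sum.distrib sum_subtractf
        sum_distrib_left)
  moreover have "c \<bullet> (u \<cdot>\<^sub>v v + (1 - u) \<cdot>\<^sub>v w) = u * (c \<bullet> v) + (1 - u) * (c \<bullet> w)"
    using c by (simp add: scalar_prod_add_distrib[of _ ?n])
  moreover have "0 \<le> u * (1 - u)" using u by auto
  ultimately have "(u \<cdot>\<^sub>v v + (1 - u) \<cdot>\<^sub>v w) \<bullet> (H *\<^sub>v (u \<cdot>\<^sub>v v + (1 - u) \<cdot>\<^sub>v w)) \<le>
      u * (v \<bullet> (H *\<^sub>v v)) + (1 - u) * (w \<bullet> (H *\<^sub>v w))"
    by simp
  with \<open>c \<bullet> (u \<cdot>\<^sub>v v + (1 - u) \<cdot>\<^sub>v w) = _\<close> show ?thesis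
    by (simp add: fF F G mix_policy_class coords_mix v_def[symmetric] w_def[symmetric] algebra_simps)
qed

lemma convex_qp_feasible: "convex_policies (qp_feasible P)"
  unfolding convex_policies_def
proof (intro ballI)
  fix F G and u :: real assume FG: "F \<in> qp_feasible P" "G \<in> qp_feasible P" and u: "u \<in> {0..1}"
  have cl: "F \<in> policy_class P" "G \<in> policy_class P" using FG by (auto simp: qp_feasible_def)
  have "qp_constraint P i (mix u F G) \<le> u_max P" if i: "i < nu * N" for i
  proof -
    have "qp_constraint P i (mix u F G) \<le> u * qp_constraint P i F + (1 - u) * qp_constraint P i G"
      by (rule cpl_convex[OF cpl_qp_constraint[OF i] cl u])
    also have "\<dots> \<le> u * u_max P + (1 - u) * u_max P"
      using FG i u by (intro add_mono mult_left_mono) (auto simp: qp_feasible_def)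
    finally show ?thesis by (simp add: algebra_simps)
  qed
  then show "mix u F G \<in> qp_feasible P" using mix_policy_class[OF cl] by (simp add: qp_feasible_def)
qed

lemma qp_feasible_nonempty: "qp_feasible P \<noteq> {}"
proof -
  let ?F = "(0\<^sub>v (nu * N), 0\<^sub>m (nu * N) (nx * (N - 1)), 0\<^sub>m (nu * N) (N - 1))"
  have "?F \<in> policy_class P" by (simp add: policy_class_iff)
  then have "?F \<in> qp_feasible P"
    using u_max by (simp add: qp_feasible_def qp_constraint_eq)
  then show ?thesis by blast
qed

end

section \<open>The hard input constraint\<close>

lemma diag_block_mat_scalar_blocks:
  fixes cs :: "real list" and m p :: nat
  assumes "0 < m"
  defines "M \<equiv> diag_block_mat (map (\<lambda>c. c \<cdot>\<^sub>m 1\<^sub>m m) cs @ [1\<^sub>m p])"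
  shows "M = mat (m * length cs + p) (m * length cs + p)
    (\<lambda>(i, j). if i = j then if i div m < length cs then cs ! (i div m) else 1 else 0)"
  unfolding M_def
proof (induction cs)
  case Nil
  show ?case by (intro eq_matI) (auto simp: Let_def)
next
  case (Cons c cs)
  have div: "\<not> i < m \<Longrightarrow> i div m = Suc ((i - m) div m)" for i
    using assms by (simp add: le_div_geq)
  let ?R = "mat (m * length (c # cs) + p) (m * length (c # cs) + p)
    (\<lambda>(i, j). if i = j then if i div m < length (c # cs) then (c # cs) ! (i div m) else 1 else 0)"
  show ?case (is "?L = _")
  proof (rule eq_matI)
    fix i j assume ij: "i < dim_row ?R" "j < dim_col ?R"
    then show "?L $$ (i, j) = ?R $$ (i, j)"
      by (cases "i < m"; cases "j < m") (auto simp: Cons Let_def div)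
  qed (simp_all add: Cons Let_def)
qed

context networked_control
begin

text \<open>
  The \<open>i\<close>-th diagonal entry of the protocol matrix. The last \<open>horizon P - recalc P\<close> blocks of the
  matrix are identities, whence the value one.
\<close>
definition gain :: "real vec \<Rightarrow> nat \<Rightarrow> real" where
  "gain b i = (if i div nu < recalc P then b $ (i div nu) else 1)"

lemma protocol_mat_eq:
  "protocol_mat P b = mat (nu * N) (nu * N) (\<lambda>(i, j). if i = j then gain b i else 0)"
proof -
  have "nu * recalc P + nu * (N - recalc P) = nu * N"
    using horizon by (simp flip: distrib_left)
  moreover have "map (\<lambda>k. b $ k \<cdot>\<^sub>m 1\<^sub>m nu) [0..<recalc P] =
      map (\<lambda>c. c \<cdot>\<^sub>m 1\<^sub>m nu) (map (\<lambda>k. b $ k) [0..<recalc P])" by simp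
  ultimately show ?thesis
    unfolding protocol_mat_def
    by (simp only: diag_block_mat_scalar_blocks[OF nu_pos] length_map length_upt)
      (auto simp: gain_def intro!: eq_matI)
qed

lemma protocol_mat_mult:
  assumes "v \<in> carrier_vec (nu * N)" "i < nu * N"
  shows "(protocol_mat P b *\<^sub>v v) $ i = gain b i * v $ i"
proof -
  have "(protocol_mat P b *\<^sub>v v) $ i = (\<Sum>j<nu * N. (if i = j then gain b i else 0) * v $ j)"
    using assms by (simp add: protocol_mat_eq scalar_prod_def lessThan_atLeast0)
  also have "\<dots> = (\<Sum>j<nu * N. if i = j then gain b i * v $ i else 0)"
    by (intro sum.cong) auto
  finally show ?thesis using assms by simp
qed

lemma control_carrier:
  "(\<eta>, \<Theta>, \<Lambda>) \<in> policy_class P \<Longrightarrow> control (\<eta>, \<Theta>, \<Lambda>) e n \<in> carrier_vec (nu * N)"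
  by (auto simp: policy_class_iff intro!: carrier_vecI)

lemma control_index:
  assumes "(\<eta>, \<Theta>, \<Lambda>) \<in> policy_class P" "e \<in> carrier_vec (nx * (N - 1))" "n \<in> carrier_vec (N - 1)"
    "i < nu * N"
  shows "control (\<eta>, \<Theta>, \<Lambda>) e n $ i =
    \<eta> $ i + (\<Sum>j<nx * (N - 1). \<Theta> $$ (i, j) * e $ j) + (\<Sum>j<N - 1. \<Lambda> $$ (i, j) * n $ j)"
  using assms by (auto simp: policy_class_iff scalar_prod_def lessThan_atLeast0)

lemma all_blocks_iff: "(\<forall>k<N. \<forall>r<nu. Q (nu * k + r)) \<longleftrightarrow> (\<forall>i<nu * N. Q i)"
proof safe
  fix i assume *: "\<forall>k<N. \<forall>r<nu. Q (nu * k + r)" "i < nu * N"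
  then have "i div nu < N" "i mod nu < nu"
    using nu_pos by (auto simp: less_mult_imp_div_less mult.commute)
  with *(1) have "Q (nu * (i div nu) + i mod nu)" by blast
  then show "Q i" by simp
next
  fix k r assume *: "\<forall>i<nu * N. Q i" "k < N" "r < nu"
  have "nu * k + r < nu * Suc k" using * by simp
  also have "\<dots> \<le> nu * N" using * by (intro mult_le_mono2) auto
  finally show "Q (nu * k + r)" using * by blast
qed

lemma blocks_in_control_set_iff:
  "(\<forall>k<N. block nu k v \<in> control_set P) \<longleftrightarrow> (\<forall>i<nu * N. \<bar>v $ i\<bar> \<le> u_max P)"
proof -
  have "block nu k v \<in> control_set P \<longleftrightarrow> (\<forall>r<nu. \<bar>v $ (nu * k + r)\<bar> \<le> u_max P)" for k
    using u_max by (auto simp: control_set_def linf_norm_le_iff block_def)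
  then show ?thesis using all_blocks_iff[of "\<lambda>i. \<bar>v $ i\<bar> \<le> u_max P"] by simp
qed

lemma hard_feasible_iff:
  "F \<in> hard_feasible P \<longleftrightarrow> F \<in> policy_class P \<and>
    (\<forall>b\<in>carrier_vec N. \<forall>e\<in>carrier_vec (nx * (N - 1)).
      (\<forall>i<N. b $ i \<in> {0, 1}) \<longrightarrow> linf_norm e \<le> phi_max P \<longrightarrow>
      (\<forall>i<nu * N. \<bar>gain b i * control F e (vec_first b (N - 1)) $ i\<bar> \<le> u_max P))"
proof -
  have "control F e n \<in> carrier_vec (nu * N)" if "F \<in> policy_class P" for e n
    using control_carrier that by (cases F) blast
  then show ?thesis
    unfolding hard_feasible_def Let_def mem_Collect_eq blocks_in_control_set_iff
    by (auto simp: protocol_mat_mult)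
qed

lemma gain_range:
  assumes "\<And>k. k < N \<Longrightarrow> b $ k \<in> {0, 1}" "i < nu * N"
  shows "gain b i \<in> {0, 1}"
  using assms by (auto simp: gain_def less_mult_imp_div_less mult.commute)

text \<open>
  The entry \<open>i\<close> of the control is \<open>c\<close> plus terms that vary in symmetric intervals,
  where \<open>c = \<eta> $ i + 1 / 2 * (\<Sum>j. \<Lambda> $$ (i, j))\<close>: write each channel outcome as \<open>1 / 2\<close> plus or minus
  \<open>1 / 2\<close>. The largest absolute value is thus \<open>\<bar>c\<bar>\<close> plus the half-lengths of these intervals, which is the
  constraint function of the program.
\<close>
lemma hard_feasible_eq: "hard_feasible P = qp_feasible P"
proof (intro equalityI subsetI)
  fix F assume "F \<in> qp_feasible P"
  then have F: "F \<in> policy_class P" and qp: "\<And>i. i < nu * N \<Longrightarrow> qp_constraint P i F \<le> u_max P"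
    by (auto simp: qp_feasible_def)
  obtain \<eta> \<Theta> \<Lambda> where FF: "F = (\<eta>, \<Theta>, \<Lambda>)" using F by (rule policy_class_cases)
  show "F \<in> hard_feasible P"
    unfolding hard_feasible_iff
  proof (intro conjI F ballI impI allI)
    fix b e :: "real vec" and i assume b: "b \<in> carrier_vec N" "\<forall>i<N. b $ i \<in> {0, 1}"
      and e: "e \<in> carrier_vec (nx * (N - 1))" "linf_norm e \<le> phi_max P" and i: "i < nu * N"
    let ?n = "vec_first b (N - 1)"
    have n: "?n \<in> carrier_vec (N - 1)" "\<And>j. j < N - 1 \<Longrightarrow> ?n $ j = b $ j"
      by (auto simp: vec_first_def)
    have "control F e ?n $ i = (\<eta> $ i + 1 / 2 * (\<Sum>j<N - 1. \<Lambda> $$ (i, j))) +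
        (\<Sum>j<N - 1. \<Lambda> $$ (i, j) * (b $ j - 1 / 2)) + (\<Sum>j<nx * (N - 1). \<Theta> $$ (i, j) * e $ j)"
      unfolding FF control_index[OF F[unfolded FF] e(1) n(1) i]
      using n(2) by (simp add: sum_subtractf right_diff_distrib sum_distrib_left mult.commute)
    also have "\<bar>\<dots>\<bar> \<le> \<bar>\<eta> $ i + 1 / 2 * (\<Sum>j<N - 1. \<Lambda> $$ (i, j))\<bar> +
        (\<Sum>j<N - 1. \<bar>\<Lambda> $$ (i, j) * (b $ j - 1 / 2)\<bar>) + (\<Sum>j<nx * (N - 1). \<bar>\<Theta> $$ (i, j) * e $ j\<bar>)"
      by (intro abs_triangle_ineq[THEN order_trans] add_mono sum_abs order_refl)
    also have "(\<Sum>j<N - 1. \<bar>\<Lambda> $$ (i, j) * (b $ j - 1 / 2)\<bar>) = (\<Sum>j<N - 1. 1 / 2 * \<bar>\<Lambda> $$ (i, j)\<bar>)"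
    proof (rule sum.cong[OF refl])
      fix j assume "j \<in> {..<N - 1}"
      then have "b $ j = 0 \<or> b $ j = 1" using b(2) by auto
      then show "\<bar>\<Lambda> $$ (i, j) * (b $ j - 1 / 2)\<bar> = 1 / 2 * \<bar>\<Lambda> $$ (i, j)\<bar>" by (auto simp: abs_mult)
    qed
    also have "(\<Sum>j<nx * (N - 1). \<bar>\<Theta> $$ (i, j) * e $ j\<bar>) \<le>
        (\<Sum>j<nx * (N - 1). phi_max P * \<bar>\<Theta> $$ (i, j)\<bar>)"
      using e by (intro sum_mono)
        (auto simp: linf_norm_le_iff abs_mult mult.commute[of "phi_max P"] intro!: mult_left_mono)
    finally have "\<bar>control F e ?n $ i\<bar> \<le> qp_constraint P i F"
      unfolding FF qp_constraint_eq[OF F[unfolded FF] i] by (simp add: sum_distrib_left)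
    then show "\<bar>gain b i * control F e ?n $ i\<bar> \<le> u_max P"
      using gain_range[of b i] b(2) i qp[OF i] u_max by auto
  qed
next
  fix F assume hard: "F \<in> hard_feasible P"
  then have F: "F \<in> policy_class P" by (simp add: hard_feasible_iff)
  obtain \<eta> \<Theta> \<Lambda> where FF: "F = (\<eta>, \<Theta>, \<Lambda>)" using F by (rule policy_class_cases)
  have "qp_constraint P i F \<le> u_max P" if i: "i < nu * N" for i
  proof -
    define c where "c = \<eta> $ i + 1 / 2 * (\<Sum>j<N - 1. \<Lambda> $$ (i, j))"
    (* s is the sign of c; the outcomes b and the saturated noise e push every other term in that
       direction. The outcome of the own instant, on which the control does not depend, is a success,
       so that the gain is one. *)
    define s :: real where "s = (if 0 \<le> c then 1 else - 1)"
    define e where "e = vec (nx * (N - 1)) (\<lambda>j. s * phi_max P * sgn (\<Theta> $$ (i, j)))"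
    define b where "b = vec N (\<lambda>j. if j = i div nu \<or> j < N - 1 \<and> 0 < s * \<Lambda> $$ (i, j) then 1 else 0 :: real)"
    let ?n = "vec_first b (N - 1)"
    have s: "s * c = \<bar>c\<bar>" "s * s = 1" "\<bar>s\<bar> = 1" by (auto simp: s_def)
    have idiv: "i div nu < N" using i by (simp add: less_mult_imp_div_less mult.commute)
    have n: "?n \<in> carrier_vec (N - 1)" "\<And>j. j < N - 1 \<Longrightarrow> ?n $ j = b $ j"
      by (auto simp: vec_first_def)
    have e: "e \<in> carrier_vec (nx * (N - 1))" "linf_norm e \<le> phi_max P"
      using phi_max s(3) by (auto simp: e_def linf_norm_le_iff abs_mult abs_sgn_eq)
    have b: "b \<in> carrier_vec N" "\<forall>i<N. b $ i \<in> {0, 1}" "gain b i = 1"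
      using idiv by (auto simp: b_def gain_def)
    have "s * (\<Lambda> $$ (i, j) * b $ j) = 1 / 2 * (s * \<Lambda> $$ (i, j)) + 1 / 2 * \<bar>\<Lambda> $$ (i, j)\<bar>"
      if j: "j < N - 1" for j
    proof (cases "j = i div nu")
      case True
      then have "\<Lambda> $$ (i, j) = 0" using F i j by (auto simp: FF policy_class_iff)
      then show ?thesis by simp
    next
      case False
      have "\<bar>\<Lambda> $$ (i, j)\<bar> = \<bar>s * \<Lambda> $$ (i, j)\<bar>" using s(3) by (simp add: abs_mult)
      then show ?thesis using False j by (auto simp: b_def)
    qed
    then have L: "s * (\<Sum>j<N - 1. \<Lambda> $$ (i, j) * b $ j) =
        s * (1 / 2 * (\<Sum>j<N - 1. \<Lambda> $$ (i, j))) + 1 / 2 * (\<Sum>j<N - 1. \<bar>\<Lambda> $$ (i, j)\<bar>)"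
      by (simp add: sum_distrib_left sum.distrib algebra_simps)
    have TT: "s * (\<Theta> $$ (i, j) * (s * phi_max P * sgn (\<Theta> $$ (i, j)))) = phi_max P * \<bar>\<Theta> $$ (i, j)\<bar>" for j
    proof -
      have "s * (\<Theta> $$ (i, j) * (s * phi_max P * sgn (\<Theta> $$ (i, j)))) =
        (s * s) * phi_max P * (\<Theta> $$ (i, j) * sgn (\<Theta> $$ (i, j)))" by (simp only: mult_ac)
      then show ?thesis by (simp add: s(2) abs_sgn)
    qed
    then have T: "s * (\<Sum>j<nx * (N - 1). \<Theta> $$ (i, j) * e $ j) =
        (\<Sum>j<nx * (N - 1). phi_max P * \<bar>\<Theta> $$ (i, j)\<bar>)"
      unfolding sum_distrib_left by (intro sum.cong refl) (use TT in \<open>simp only: e_def index_vec lessThan_iff\<close>)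
    have "s * control F e ?n $ i = s * \<eta> $ i + s * (\<Sum>j<nx * (N - 1). \<Theta> $$ (i, j) * e $ j) +
        s * (\<Sum>j<N - 1. \<Lambda> $$ (i, j) * b $ j)"
      unfolding FF control_index[OF F[unfolded FF] e(1) n(1) i] by (simp add: n(2) distrib_left)
    also have "\<dots> = s * c + 1 / 2 * (\<Sum>j<N - 1. \<bar>\<Lambda> $$ (i, j)\<bar>) +
        (\<Sum>j<nx * (N - 1). phi_max P * \<bar>\<Theta> $$ (i, j)\<bar>)"
      unfolding L T c_def by (simp add: distrib_left)
    also have "\<dots> = qp_constraint P i F"
      unfolding FF qp_constraint_eq[OF F[unfolded FF] i] s(1) by (simp add: c_def)
    finally have "qp_constraint P i F \<le> \<bar>s * control F e ?n $ i\<bar>" by linarith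
    also have "\<dots> = \<bar>gain b i * control F e ?n $ i\<bar>" using s(3) b(3) by (simp add: abs_mult)
    also have "\<dots> \<le> u_max P"
      using hard b(1,2) e i unfolding hard_feasible_iff by blast
    finally show ?thesis .
  qed
  then show "F \<in> qp_feasible P" using F by (simp add: qp_feasible_def)
qed

end

section \<open>Measurable vectors and frozen conditional expectations\<close>

lemma space_vec_borel [simp]: "space (vec_borel n) = carrier_vec n"
  by (simp add: vec_borel_def)

lemma measurable_vec_borel_iff:
  "f \<in> M \<rightarrow>\<^sub>M vec_borel n \<longleftrightarrow>
    f \<in> space M \<rightarrow> carrier_vec n \<and> (\<forall>i<n. (\<lambda>x. f x $ i) \<in> borel_measurable M)"
proof safe
  assume f: "f \<in> M \<rightarrow>\<^sub>M vec_borel n"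
  show "f x \<in> carrier_vec n" if "x \<in> space M" for x
    using measurable_space[OF f that] by simp
  fix i assume i: "i < n"
  have "(\<lambda>v. \<lambda>i\<in>{..<n}. v $ i) \<in> vec_borel n \<rightarrow>\<^sub>M (\<Pi>\<^sub>M i\<in>{..<n}. borel :: real measure)"
    unfolding vec_borel_def by (rule measurable_vimage_algebra1) (auto simp: space_PiM)
  from measurable_comp[OF f this]
  have "(\<lambda>x. (\<lambda>i\<in>{..<n}. f x $ i)) \<in> M \<rightarrow>\<^sub>M (\<Pi>\<^sub>M i\<in>{..<n}. borel :: real measure)"
    by (simp add: comp_def)
  from measurable_compose[OF this measurable_component_singleton, of i] i
  have "(\<lambda>x. (\<lambda>i\<in>{..<n}. f x $ i) i) \<in> borel_measurable M" by simp
  then show "(\<lambda>x. f x $ i) \<in> borel_measurable M" using i by simp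
next
  assume f: "f \<in> space M \<rightarrow> carrier_vec n" and c: "\<forall>i<n. (\<lambda>x. f x $ i) \<in> borel_measurable M"
  have "(\<lambda>x. (\<lambda>i\<in>{..<n}. f x $ i)) \<in> M \<rightarrow>\<^sub>M (\<Pi>\<^sub>M i\<in>{..<n}. borel :: real measure)"
    using c by (intro measurable_restrict) auto
  then show "f \<in> M \<rightarrow>\<^sub>M vec_borel n"
    unfolding vec_borel_def using f by (intro measurable_vimage_algebra2) auto
qed

lemma measurable_vec_index: "i < n \<Longrightarrow> (\<lambda>v. v $ i) \<in> borel_measurable (vec_borel n)"
  using measurable_vec_borel_iff[of "\<lambda>v. v" "vec_borel n" n] by (auto simp: measurable_ident)

lemma measurable_subalgebra_id:
  assumes "subalgebra M F"
  shows "(\<lambda>\<omega>. \<omega>) \<in> M \<rightarrow>\<^sub>M F"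
  using measurable_from_subalg[OF assms measurable_ident] by (simp add: id_def)

context prob_space
begin

lemma indep_var_id:
  assumes F: "subalgebra M F" and G: "subalgebra M G" and ind: "indep_set (sets F) (sets G)"
  shows "indep_var F (\<lambda>\<omega>. \<omega>) G (\<lambda>\<omega>. \<omega>)"
proof -
  have *: "sigma_sets (space M) {(\<lambda>\<omega>. \<omega>) -` A \<inter> space M |A. A \<in> sets H} = sets H" if "subalgebra M H" for H
  proof -
    have sp: "space H = space M" using that by (simp add: subalgebra_def)
    have "{(\<lambda>\<omega>. \<omega>) -` A \<inter> space M |A. A \<in> sets H} = sets H"
    proof -
      have "(\<lambda>\<omega>. \<omega>) -` A \<inter> space M = A" if "A \<in> sets H" for A
        using sets.sets_into_space[OF that] sp by auto
      then have "(\<lambda>A. (\<lambda>\<omega>. \<omega>) -` A \<inter> space M) ` sets H = (\<lambda>A. A) ` sets H"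
        by (intro image_cong) auto
      then show ?thesis by (simp add: Setcompr_eq_image)
    qed
    then show ?thesis using sets.sigma_sets_eq[of H] sp by simp
  qed
  show ?thesis
    unfolding indep_var_eq *[OF F] *[OF G]
    using F G ind by (auto intro!: measurable_subalgebra_id)
qed

text \<open>
  Independence says that the diagonal map sends the probability measure to the product of its
  restrictions to \<open>F\<close> and \<open>G\<close>; integrating the second argument first (Fubini) yields the claim.
  Taking both arguments from the sample space, with the coarse \<open>\<sigma>\<close>-algebras \<open>F\<close> and \<open>G\<close>, makes
  the lemma applicable to variables with values of different types.
\<close>
lemma cond_exp_freeze:
  fixes f :: "'a \<times> 'a \<Rightarrow> real"
  assumes F: "subalgebra M F" and G: "subalgebra M G" and ind: "indep_set (sets F) (sets G)"
    and f: "f \<in> borel_measurable (F \<Otimes>\<^sub>M G)" and int: "integrable M (\<lambda>\<omega>. f (\<omega>, \<omega>))"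
  shows "AE \<omega> in M. real_cond_exp M F (\<lambda>\<omega>. f (\<omega>, \<omega>)) \<omega> = (\<integral>\<omega>'. f (\<omega>, \<omega>') \<partial>M)"
proof -
  let ?id = "\<lambda>\<omega>. \<omega>"
  interpret sf: sigma_finite_subalgebra M F
    using F by (intro finite_measure_subalgebra_is_sigma_finite) (auto simp: finite_measure_subalgebra_def finite_measure_axioms finite_measure_subalgebra_axioms_def)
  have idF: "?id \<in> M \<rightarrow>\<^sub>M F" and idG: "?id \<in> M \<rightarrow>\<^sub>M G"
    using F G by (auto intro!: measurable_subalgebra_id)
  let ?F = "distr M F ?id" and ?G = "distr M G ?id"
  interpret PF: prob_space ?F by (rule prob_space_distr[OF idF])
  interpret PG: prob_space ?G by (rule prob_space_distr[OF idG])
  interpret pair: pair_prob_space ?F ?G ..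
  have prod: "?F \<Otimes>\<^sub>M ?G = distr M (F \<Otimes>\<^sub>M G) (\<lambda>\<omega>. (\<omega>, \<omega>))"
    using indep_var_id[OF F G ind] unfolding indep_var_distribution_eq by blast
  have diag: "(\<lambda>\<omega>. (\<omega>, \<omega>)) \<in> M \<rightarrow>\<^sub>M F \<Otimes>\<^sub>M G" using idF idG by simp
  have slice: "(\<lambda>\<omega>'. f (\<omega>, \<omega>')) \<in> borel_measurable G" if "\<omega> \<in> space M" for \<omega>
    using f that F by (intro measurable_Pair2[of f F G borel]) (auto simp: subalgebra_def)
  have fpair: "integrable (?F \<Otimes>\<^sub>M ?G) f"
    unfolding prod using int diag f by (simp add: integrable_distr_eq)
  have inner: "(\<integral>\<omega>'. f (\<omega>, \<omega>') \<partial>?G) = (\<integral>\<omega>'. f (\<omega>, \<omega>') \<partial>M)" if "\<omega> \<in> space M" for \<omega>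
    using slice[OF that] idG by (simp add: integral_distr)
  define h where "h \<omega> = (\<integral>\<omega>'. f (\<omega>, \<omega>') \<partial>?G)" for \<omega>
  have f': "f \<in> borel_measurable (F \<Otimes>\<^sub>M ?G)"
    using f by (subst measurable_cong_sets[OF sets_pair_measure_cong[OF refl sets_distr] refl])
  have h: "h \<in> borel_measurable F"
    unfolding h_def using f' by (intro PG.borel_measurable_lebesgue_integral) (simp add: case_prod_eta[of f])
  have hint: "integrable M h"
    using pair.integrable_fst'[OF fpair] idF h unfolding h_def[symmetric] by (simp add: integrable_distr_eq)
  have "(\<integral>\<omega>\<in>A. f (\<omega>, \<omega>) \<partial>M) = (\<integral>\<omega>\<in>A. h \<omega> \<partial>M)" if A: "A \<in> sets F" for A
  proof -
    let ?fA = "\<lambda>p. indicator A (fst p) * f p"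
    have fA: "?fA \<in> borel_measurable (F \<Otimes>\<^sub>M G)" using f A by measurable
    have "integrable (?F \<Otimes>\<^sub>M ?G) ?fA"
    proof (rule Bochner_Integration.integrable_bound[OF fpair])
      show "?fA \<in> borel_measurable (?F \<Otimes>\<^sub>M ?G)"
        using fA by (subst measurable_cong_sets[OF sets_pair_measure_cong[OF sets_distr sets_distr] refl])
    qed (auto simp: indicator_def)
    from pair.integral_fst'[OF this]
    have "(\<integral>\<omega>. indicator A \<omega> * h \<omega> \<partial>?F) = (\<integral>p. ?fA p \<partial>(?F \<Otimes>\<^sub>M ?G))"
      by (simp add: h_def)
    also have "\<dots> = (\<integral>\<omega>. indicator A \<omega> * f (\<omega>, \<omega>) \<partial>M)"
      unfolding prod using diag fA by (simp add: integral_distr)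
    also have "(\<integral>\<omega>. indicator A \<omega> * h \<omega> \<partial>?F) = (\<integral>\<omega>. indicator A \<omega> * h \<omega> \<partial>M)"
      using h A idF by (intro integral_distr) auto
    finally show ?thesis by (simp add: set_lebesgue_integral_def)
  qed
  then have "AE \<omega> in M. real_cond_exp M F (\<lambda>\<omega>. f (\<omega>, \<omega>)) \<omega> = h \<omega>"
    by (rule sf.real_cond_exp_charact) (use int hint h in auto)
  then show ?thesis
    by (rule AE_mp) (intro AE_I2, simp add: h_def inner)
qed

end

section \<open>The information carried by noise and channel\<close>

context networked_control
begin

lemma noise_measurable: "noise P t \<in> pspace P \<rightarrow>\<^sub>M vec_borel nx"
  using noise_indep by (simp add: indep_vars_def2)

lemma channel_measurable: "channel P t \<in> borel_measurable (pspace P)"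
  using channel_indep by (simp add: indep_vars_def2)

lemma noise_carrier: "\<omega> \<in> space (pspace P) \<Longrightarrow> noise P t \<omega> \<in> carrier_vec nx"
  using measurable_space[OF noise_measurable] by simp

text \<open>
  The elementary sources of randomness: \<open>Inl s\<close> is the noise and \<open>Inr s\<close> the channel outcome at the
  instant \<open>s\<close>. A common index type lets one independence statement cover both processes.
\<close>
fun source :: "nat + nat \<Rightarrow> 'w set set" where
  "source (Inl s) = {noise P s -` A \<inter> space (pspace P) | A. A \<in> sets (vec_borel nx)}"
| "source (Inr s) = {channel P s -` A \<inter> space (pspace P) | A. A \<in> sets borel}"

lemma source_events: "source i \<subseteq> events"
  using measurable_sets[OF noise_measurable] measurable_sets[OF channel_measurable]
  by (cases i) auto

lemma Int_stable_source: "Int_stable (source i)"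
proof (cases i)
  case (Inl s)
  then show ?thesis
    by (auto simp: Int_stable_def) (metis sets.Int vimage_Int Int_assoc Int_left_commute Int_absorb)
next
  case (Inr s)
  then show ?thesis
    by (auto simp: Int_stable_def) (metis sets.Int vimage_Int Int_assoc Int_left_commute Int_absorb)
qed

lemma prob_Inter:
  assumes "indep_sets F UNIV" "finite J" "\<And>s. s \<in> J \<Longrightarrow> A s \<in> F s"
  shows "prob (space (pspace P) \<inter> (\<Inter>s\<in>J. A s)) = (\<Prod>s\<in>J. prob (A s))"
proof (cases "J = {}")
  case False
  have "A s \<subseteq> space (pspace P)" if "s \<in> J" for s
    using assms(1) assms(3)[OF that] sets.sets_into_space unfolding indep_sets_def by blast
  then have "space (pspace P) \<inter> (\<Inter>s\<in>J. A s) = (\<Inter>s\<in>J. A s)" using False by blast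
  then show ?thesis using indep_setsD[OF assms(1) subset_UNIV False assms(2)] assms(3) by simp
qed (simp add: prob_space)

text \<open>
  Given finitely many events, collect those of the noise and those of the channel; the two processes
  are independent of each other, and each is independent over time. Intersecting with the whole space
  takes care of an empty collection.
\<close>
lemma indep_sources: "indep_sets source UNIV"
proof (rule indep_setsI)
  fix A J assume J: "J \<noteq> {}" "finite J" and A: "\<forall>j\<in>J. A j \<in> source j"
  let ?S = "space (pspace P)"
  define JN JC where "JN = {s. Inl s \<in> J}" and "JC = {s. Inr s \<in> J}"
  have J_eq: "J = Inl ` JN \<union> Inr ` JC"
  proof (rule Set.set_eqI)
    show "i \<in> J \<longleftrightarrow> i \<in> Inl ` JN \<union> Inr ` JC" for i by (cases i) (auto simp: JN_def JC_def)
  qed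
  have fin: "finite JN" "finite JC"
    using J(2) unfolding J_eq by (auto dest: finite_imageD)
  let ?XN = "?S \<inter> (\<Inter>s\<in>JN. A (Inl s))" and ?XC = "?S \<inter> (\<Inter>s\<in>JC. A (Inr s))"
  let ?VN = "vimage_algebra ?S (\<lambda>\<omega> t. noise P t \<omega>) (\<Pi>\<^sub>M t\<in>UNIV. vec_borel nx)"
  let ?VC = "vimage_algebra ?S (\<lambda>\<omega> t. channel P t \<omega>) (\<Pi>\<^sub>M t\<in>UNIV. borel :: real measure)"
  have "noise P s \<in> ?VN \<rightarrow>\<^sub>M vec_borel nx" for s
  proof -
    have "(\<lambda>\<omega> t. noise P t \<omega>) \<in> ?VN \<rightarrow>\<^sub>M (\<Pi>\<^sub>M t\<in>UNIV. vec_borel nx)"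
      using noise_carrier by (intro measurable_vimage_algebra1) (auto simp: space_PiM)
    from measurable_compose[OF this measurable_component_singleton[of s UNIV "\<lambda>_. vec_borel nx"]]
    show ?thesis by simp
  qed
  from measurable_sets[OF this] have "A (Inl s) \<in> sets ?VN" if "s \<in> JN" for s
    using A that by (fastforce simp: JN_def)
  then have XN: "?XN \<in> sets ?VN"
    using fin sets.finite_INT[of JN "\<lambda>s. A (Inl s)" ?VN] sets.top[of ?VN]
    by (cases "JN = {}") (auto intro: sets.Int)
  have "channel P s \<in> borel_measurable ?VC" for s
  proof -
    have "(\<lambda>\<omega> t. channel P t \<omega>) \<in> ?VC \<rightarrow>\<^sub>M (\<Pi>\<^sub>M t\<in>UNIV. borel :: real measure)"
      by (intro measurable_vimage_algebra1) (auto simp: space_PiM)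
    from measurable_compose[OF this measurable_component_singleton[of s UNIV "\<lambda>_. borel"]]
    show ?thesis by simp
  qed
  from measurable_sets[OF this] have "A (Inr s) \<in> sets ?VC" if "s \<in> JC" for s
    using A that by (fastforce simp: JC_def)
  then have XC: "?XC \<in> sets ?VC"
    using fin sets.finite_INT[of JC "\<lambda>s. A (Inr s)" ?VC] sets.top[of ?VC]
    by (cases "JC = {}") (auto intro: sets.Int)
  have PN: "prob ?XN = (\<Prod>s\<in>JN. prob (A (Inl s)))"
  proof (rule prob_Inter[OF _ fin(1)])
    show "indep_sets (\<lambda>s. source (Inl s)) UNIV"
      using noise_indep by (simp add: indep_vars_def2)
  qed (use A in \<open>auto simp: JN_def\<close>)
  have PC: "prob ?XC = (\<Prod>s\<in>JC. prob (A (Inr s)))"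
  proof (rule prob_Inter[OF _ fin(2)])
    show "indep_sets (\<lambda>s. source (Inr s)) UNIV"
      using channel_indep by (simp add: indep_vars_def2)
  qed (use A in \<open>auto simp: JC_def\<close>)
  have "A j \<subseteq> ?S" if "j \<in> J" for j
    using A that source_events[of j] sets.sets_into_space by blast
  then have "(\<Inter>j\<in>J. A j) \<subseteq> ?S"
    using J(1) by blast
  moreover have "(\<Inter>j\<in>J. A j) = (\<Inter>s\<in>JN. A (Inl s)) \<inter> (\<Inter>s\<in>JC. A (Inr s))"
    unfolding J_eq by (simp only: INT_Un INF_image comp_def)
  ultimately have "(\<Inter>j\<in>J. A j) = ?XN \<inter> ?XC" by auto
  then have "prob (\<Inter>j\<in>J. A j) = prob ?XN * prob ?XC"
    using indep_setD[OF noise_channel_indep XN XC] by simp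
  also have "\<dots> = (\<Prod>j\<in>J. prob (A j))"
    unfolding PN PC J_eq using fin
    by (subst prod.union_disjoint) (auto simp: prod.reindex)
  finally show "prob (\<Inter>j\<in>J. A j) = (\<Prod>j\<in>J. prob (A j))" .
qed (use source_events in auto)

text \<open>
  The events that can be decided by observing the sources in \<open>I\<close>.
\<close>
definition info :: "(nat + nat) set \<Rightarrow> 'w measure" where
  "info I = sigma (space (pspace P)) (\<Union>i\<in>I. source i)"

lemma source_space: "(\<Union>i\<in>I. source i) \<subseteq> Pow (space (pspace P))"
  using source_events sets.sets_into_space by blast

lemma space_info [simp]: "space (info I) = space (pspace P)"
  by (simp add: info_def source_space)

lemma sets_info: "sets (info I) = sigma_sets (space (pspace P)) (\<Union>i\<in>I. source i)"
  by (simp add: info_def source_space)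

lemma subalgebra_info: "subalgebra (pspace P) (info I)"
  unfolding subalgebra_def sets_info using source_events by (auto intro!: sets.sigma_sets_subset)

lemma info_mono: "I \<subseteq> J \<Longrightarrow> subalgebra (info J) (info I)"
  unfolding subalgebra_def sets_info by (auto intro!: sigma_sets_mono' UN_mono)

lemma noise_info: "Inl s \<in> I \<Longrightarrow> noise P s \<in> info I \<rightarrow>\<^sub>M vec_borel nx"
proof (rule measurableI)
  fix A assume s: "Inl s \<in> I" and "A \<in> sets (vec_borel nx)"
  then have "noise P s -` A \<inter> space (pspace P) \<in> source (Inl s)" by auto
  with s show "noise P s -` A \<inter> space (info I) \<in> sets (info I)"
    unfolding sets_info space_info by (blast intro: sigma_sets.Basic)
qed (simp add: noise_carrier)

lemma channel_info: "Inr s \<in> I \<Longrightarrow> channel P s \<in> borel_measurable (info I)"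
proof (rule measurableI)
  fix A :: "real set" assume s: "Inr s \<in> I" and "A \<in> sets borel"
  then have "channel P s -` A \<inter> space (pspace P) \<in> source (Inr s)" by auto
  with s show "channel P s -` A \<inter> space (info I) \<in> sets (info I)"
    unfolding sets_info space_info by (blast intro: sigma_sets.Basic)
qed simp

lemma indep_info:
  assumes "I \<inter> J = {}"
  shows "indep_set (sets (info I)) (sets (info J))"
proof -
  have "indep_sets (\<lambda>b. sigma_sets (space (pspace P)) (\<Union>i\<in>case_bool I J b. source i)) UNIV"
  proof (rule indep_sets_collect_sigma)
    show "indep_sets source (\<Union>b\<in>UNIV. case_bool I J b)"
      by (rule indep_sets_mono_index[OF subset_UNIV indep_sources])
    show "disjoint_family_on (case_bool I J) UNIV"
      using assms by (auto simp: disjoint_family_on_def split: bool.split)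
  qed (rule Int_stable_source)
  also have "(\<lambda>b. sigma_sets (space (pspace P)) (\<Union>i\<in>case_bool I J b. source i)) =
      case_bool (sets (info I)) (sets (info J))"
    by (auto simp: sets_info fun_eq_iff split: bool.split)
  finally show ?thesis by (simp add: indep_set_def)
qed

lemma
  fixes f g :: "'w \<Rightarrow> real"
  assumes "I \<inter> J = {}" "f \<in> borel_measurable (info I)" "g \<in> borel_measurable (info J)"
    "integrable (pspace P) f" "integrable (pspace P) g"
  shows integral_indep: "expectation (\<lambda>\<omega>. f \<omega> * g \<omega>) = expectation f * expectation g"
    and integrable_indep: "integrable (pspace P) (\<lambda>\<omega>. f \<omega> * g \<omega>)"
proof -
  have "indep_var borel (f \<circ> (\<lambda>\<omega>. \<omega>)) borel (g \<circ> (\<lambda>\<omega>. \<omega>))"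
    by (rule indep_var_compose[OF indep_var_id[OF subalgebra_info subalgebra_info indep_info[OF assms(1)]]])
      (use assms in auto)
  then have "indep_var borel f borel g" by (simp add: comp_def)
  then show "expectation (\<lambda>\<omega>. f \<omega> * g \<omega>) = expectation f * expectation g"
    "integrable (pspace P) (\<lambda>\<omega>. f \<omega> * g \<omega>)"
    using assms(4,5) by (auto intro: indep_var_lebesgue_integral indep_var_integrable)
qed

lemma measurable_info: "f \<in> info I \<rightarrow>\<^sub>M S \<Longrightarrow> f \<in> pspace P \<rightarrow>\<^sub>M S"
  by (rule measurable_from_subalg[OF subalgebra_info])

section \<open>Causality and measurability of input and cost\<close>

lemma stack_index: "i < b * k \<Longrightarrow> stack b s n k $ i = s (n + i div b) $ (i mod b)"
  by (simp add: stack_def)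

lemma sat_vec_carrier: "sat_vec P t \<omega> \<in> carrier_vec (nx * (N - 1))"
  by (simp add: sat_vec_def stack_def)

lemma sat_vec_index:
  "j < nx * (N - 1) \<Longrightarrow>
    sat_vec P t \<omega> $ j = sat P (Suc (j div nx)) (noise P (t + j div nx) \<omega>) $ (j mod nx)"
  by (simp add: sat_vec_def stack_index Suc_eq_plus1_left)

lemma noise_vec_carrier: "noise_vec P t \<omega> \<in> carrier_vec (nx * N)"
  by (simp add: noise_vec_def stack_def)

lemma noise_vec_index:
  "j < nx * N \<Longrightarrow> noise_vec P t \<omega> $ j = noise P (t + j div nx) \<omega> $ (j mod nx)"
  by (simp add: noise_vec_def stack_index)

lemma channel_vec_carrier: "channel_vec P t k \<omega> \<in> carrier_vec k"
  by (simp add: channel_vec_def)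

lemma channel_vec_index: "i < k \<Longrightarrow> channel_vec P t k \<omega> $ i = channel P (t + i) \<omega>"
  by (simp add: channel_vec_def)

lemma sat_vec_component:
  assumes "j < nx * (N - 1)"
  obtains \<sigma> :: "real \<Rightarrow> real" where "\<sigma> \<in> borel_measurable borel" "\<And>r. \<sigma> (- r) = - \<sigma> r"
    "\<And>r. \<bar>\<sigma> r\<bar> \<le> phi_max P"
    "\<And>t \<omega>. noise P (t + j div nx) \<omega> \<in> carrier_vec nx \<Longrightarrow>
      sat_vec P t \<omega> $ j = \<sigma> (noise P (t + j div nx) \<omega> $ (j mod nx))"
proof -
  have j: "j div nx < N - 1" "j mod nx < nx"
    using assms nx_pos by (simp_all add: less_mult_imp_div_less mult.commute)
  then have "saturation nx (phi_max P) (sat P (Suc (j div nx)))"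
    by (intro sat) auto
  then obtain \<sigma> :: "nat \<Rightarrow> real \<Rightarrow> real" where
    "\<forall>j<nx. \<sigma> j \<in> borel_measurable borel \<and> (\<forall>r. \<sigma> j (- r) = - \<sigma> j r) \<and> (\<forall>r. \<bar>\<sigma> j r\<bar> \<le> phi_max P)"
    "\<forall>v\<in>carrier_vec nx. sat P (Suc (j div nx)) v = vec nx (\<lambda>j. \<sigma> j (v $ j))"
    unfolding saturation_def by blast
  then show thesis using j assms by (intro that[of "\<sigma> (j mod nx)"]) (auto simp: sat_vec_index)
qed

lemma sat_vec_bound:
  assumes "\<omega> \<in> space (pspace P)" "j < nx * (N - 1)"
  shows "\<bar>sat_vec P t \<omega> $ j\<bar> \<le> phi_max P"
  using sat_vec_component[OF assms(2)] noise_carrier[OF assms(1)] by metis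

lemma gain_channel_range:
  "\<omega> \<in> space (pspace P) \<Longrightarrow> i < nu * N \<Longrightarrow> gain (channel_vec P t N \<omega>) i \<in> {0, 1}"
  by (rule gain_range) (use channel_range in \<open>auto simp: channel_vec_index\<close>)

lemma plant_input_carrier: "plant_input P t F \<omega> \<in> carrier_vec (nu * N)"
  unfolding plant_input_def calS_def
  by (rule carrier_vecI) (simp add: protocol_mat_eq)

lemma plant_input_index:
  assumes F: "F \<in> policy_class P" and i: "i < nu * N"
  shows "plant_input P t F \<omega> $ i = gain (channel_vec P t N \<omega>) i *
    control F (sat_vec P t \<omega>) (channel_vec P t (N - 1) \<omega>) $ i"
  using assms control_carrier
  by (cases F) (auto simp: plant_input_def calS_def protocol_mat_mult simp del: control.simps)

text \<open>
  Strict block triangularity removes from row \<open>i\<close> every noise from the instant \<open>t + i div nu\<close> on and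
  every channel outcome from that instant on, the gain excepted.
\<close>
lemma plant_input_causal:
  assumes F: "F \<in> policy_class P" and i: "i < nu * N"
  shows "plant_input P t F \<omega> $ i = gain (channel_vec P t N \<omega>) i *
    (policy_mat P F $$ (i, 0) +
     (\<Sum>j<nx * (N - 1). if j div nx < i div nu then policy_mat P F $$ (i, Suc j) * sat_vec P t \<omega> $ j else 0) +
     (\<Sum>j<N - 1. if j < i div nu then policy_mat P F $$ (i, Suc (nx * (N - 1) + j)) *
        channel P (t + j) \<omega> else 0))"
proof -
  obtain \<eta> \<Theta> \<Lambda> where FF: "F = (\<eta>, \<Theta>, \<Lambda>)" using F by (rule policy_class_cases)
  show ?thesis
    unfolding plant_input_index[OF F i] unfolding FF
    unfolding control_index[OF F[unfolded FF] sat_vec_carrier channel_vec_carrier i]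
    using F i unfolding FF policy_class_iff
    by (auto simp: policy_mat_index[OF F[unfolded FF]] channel_vec_index
        intro!: arg_cong2[where f = "(*)"] arg_cong2[where f = "(+)"] sum.cong)
qed

lemma sat_vec_measurable:
  assumes "j < nx * (N - 1)" "(\<lambda>p. noise P (t + j div nx) (\<pi> p)) \<in> S \<rightarrow>\<^sub>M vec_borel nx"
  shows "(\<lambda>p. sat_vec P t (\<pi> p) $ j) \<in> borel_measurable S"
proof -
  obtain \<sigma> where \<sigma>: "\<sigma> \<in> borel_measurable borel"
    "\<And>t \<omega>. noise P (t + j div nx) \<omega> \<in> carrier_vec nx \<Longrightarrow>
      sat_vec P t \<omega> $ j = \<sigma> (noise P (t + j div nx) \<omega> $ (j mod nx))"
    using sat_vec_component[OF assms(1)] by metis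
  have "(\<lambda>p. noise P (t + j div nx) (\<pi> p) $ (j mod nx)) \<in> borel_measurable S"
    using assms(2) nx_pos by (simp add: measurable_vec_borel_iff)
  from measurable_compose[OF this \<sigma>(1)]
  have m: "(\<lambda>p. \<sigma> (noise P (t + j div nx) (\<pi> p) $ (j mod nx))) \<in> borel_measurable S" .
  have "noise P (t + j div nx) (\<pi> p) \<in> carrier_vec nx" if "p \<in> space S" for p
    using measurable_space[OF assms(2) that] by simp
  then have eq: "sat_vec P t (\<pi> p) $ j = \<sigma> (noise P (t + j div nx) (\<pi> p) $ (j mod nx))"
    if "p \<in> space S" for p
    using \<sigma>(2) that by blast
  show ?thesis by (rule iffD2[OF measurable_cong m]) (rule eq)
qed

lemma gain_measurable:
  assumes "i < nu * N" "(\<lambda>p. channel P (t + i div nu) (\<pi> p)) \<in> borel_measurable S"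
  shows "(\<lambda>p. gain (channel_vec P t N (\<pi> p)) i) \<in> borel_measurable S"
proof -
  have "i div nu < N" using assms(1) by (simp add: less_mult_imp_div_less mult.commute)
  then show ?thesis using assms(2) by (cases "i div nu < recalc P") (simp_all add: gain_def channel_vec_index)
qed

text \<open>
  The map \<open>\<pi>\<close> separates the outcome that drives noise and channel from the outcome that selects the
  policy; it is the identity along the closed loop and a projection when the state is frozen.
\<close>
lemma plant_input_measurable:
  assumes i: "i < nu * N" and G: "\<And>p. p \<in> space S \<Longrightarrow> G p \<in> policy_class P"
    and Gm: "\<And>i c. i < nu * N \<Longrightarrow> c < ncols \<Longrightarrow> (\<lambda>p. policy_mat P (G p) $$ (i, c)) \<in> borel_measurable S"
    and noise: "\<And>s. s < i div nu \<Longrightarrow> (\<lambda>p. noise P (t + s) (\<pi> p)) \<in> S \<rightarrow>\<^sub>M vec_borel nx"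
    and channel: "\<And>s. s \<le> i div nu \<Longrightarrow> (\<lambda>p. channel P (t + s) (\<pi> p)) \<in> borel_measurable S"
  shows "(\<lambda>p. plant_input P t (G p) (\<pi> p) $ i) \<in> borel_measurable S"
proof -
  have m: "(\<lambda>p. gain (channel_vec P t N (\<pi> p)) i *
    (policy_mat P (G p) $$ (i, 0) +
     (\<Sum>j<nx * (N - 1). if j div nx < i div nu then policy_mat P (G p) $$ (i, Suc j) * sat_vec P t (\<pi> p) $ j else 0) +
     (\<Sum>j<N - 1. if j < i div nu then policy_mat P (G p) $$ (i, Suc (nx * (N - 1) + j)) *
        channel P (t + j) (\<pi> p) else 0))) \<in> borel_measurable S"
  proof (intro borel_measurable_times borel_measurable_add borel_measurable_sum)
    show "(\<lambda>p. gain (channel_vec P t N (\<pi> p)) i) \<in> borel_measurable S"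
      using i channel by (intro gain_measurable) auto
    show "(\<lambda>p. policy_mat P (G p) $$ (i, 0)) \<in> borel_measurable S"
      using i by (intro Gm) (auto simp: ncols_def)
  next
    fix j assume j: "j \<in> {..<nx * (N - 1)}"
    show "(\<lambda>p. if j div nx < i div nu then policy_mat P (G p) $$ (i, Suc j) * sat_vec P t (\<pi> p) $ j else 0)
        \<in> borel_measurable S"
    proof (cases "j div nx < i div nu")
      case True
      then show ?thesis
        using i j by (auto intro!: borel_measurable_times Gm sat_vec_measurable noise simp: ncols_def)
    qed simp
  next
    fix j assume j: "j \<in> {..<N - 1}"
    show "(\<lambda>p. if j < i div nu then policy_mat P (G p) $$ (i, Suc (nx * (N - 1) + j)) *
        channel P (t + j) (\<pi> p) else 0) \<in> borel_measurable S"
    proof (cases "j < i div nu")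
      case True
      then show ?thesis
        using i j by (auto intro!: borel_measurable_times Gm channel simp: ncols_def)
    qed simp
  qed
  show ?thesis by (rule iffD2[OF measurable_cong m]) (rule plant_input_causal[OF G i])
qed

lemma calA_carrier [simp]: "calA P \<in> carrier_mat (nx * (N + 1)) nx"
  and calB_carrier [simp]: "calB P \<in> carrier_mat (nx * (N + 1)) (nu * N)"
  and calD_carrier [simp]: "calD P \<in> carrier_mat (nx * (N + 1)) (nx * N)"
  by (simp_all add: calA_def calB_def calD_def Let_def)

lemma stacked_state_carrier: "stacked_state P t y F \<omega> \<in> carrier_vec (nx * (N + 1))"
  by (rule carrier_vecI) (simp add: stacked_state_def calD_def Let_def)

lemma stacked_state_index:
  assumes "y \<in> carrier_vec nx" "i < nx * (N + 1)"
  shows "stacked_state P t y F \<omega> $ i = (\<Sum>j<nx. calA P $$ (i, j) * y $ j) +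
    (\<Sum>j<nu * N. calB P $$ (i, j) * plant_input P t F \<omega> $ j) +
    (\<Sum>j<nx * N. calD P $$ (i, j) * noise_vec P t \<omega> $ j)"
proof -
  have "dim_row (calB P) = nx * (N + 1)" "dim_row (calD P) = nx * (N + 1)"
    using carrier_matD(1)[OF calB_carrier] carrier_matD(1)[OF calD_carrier] .
  then show ?thesis
    unfolding stacked_state_def using assms(2)
    by (simp only: index_add_vec dim_mult_mat_vec
        mult_mat_vec_index[OF calA_carrier assms]
        mult_mat_vec_index[OF calB_carrier plant_input_carrier assms(2)]
        mult_mat_vec_index[OF calD_carrier noise_vec_carrier assms(2)])
qed

text \<open>
  A block diagonal form is the sum of the forms of its blocks.
\<close>
lemma sym_psd_diag_block:
  assumes "\<And>A. A \<in> set As \<Longrightarrow> sym_psd n A"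
  shows "sym_psd (n * length As) (diag_block_mat As)"
  using assms
proof (induction As)
  case Nil
  show ?case by (auto simp: sym_psd_def scalar_prod_def)
next
  case (Cons A As)
  let ?B = "diag_block_mat As" and ?k = "n * length As"
  have A: "sym_psd n A" and B: "sym_psd ?k ?B" using Cons by auto
  then have c: "A \<in> carrier_mat n n" "?B \<in> carrier_mat ?k ?k" "A\<^sup>T = A" "?B\<^sup>T = ?B"
    by (auto simp: sym_psd_def)
  have eq: "diag_block_mat (A # As) = four_block_mat A (0\<^sub>m n ?k) (0\<^sub>m ?k n) ?B"
    using c by (auto simp: Let_def)
  show ?case unfolding sym_psd_def eq
  proof (intro conjI ballI)
    show "four_block_mat A (0\<^sub>m n ?k) (0\<^sub>m ?k n) ?B \<in> carrier_mat (n * length (A # As)) (n * length (A # As))"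
      using four_block_carrier_mat[OF c(1,2)] by simp
    show "(four_block_mat A (0\<^sub>m n ?k) (0\<^sub>m ?k n) ?B)\<^sup>T = four_block_mat A (0\<^sub>m n ?k) (0\<^sub>m ?k n) ?B"
      using c by (subst transpose_four_block_mat) auto
    fix v :: "real vec" assume "v \<in> carrier_vec (n * length (A # As))"
    then have v: "v \<in> carrier_vec (n + ?k)" by simp
    define v1 v2 where "v1 = vec_first v n" and "v2 = vec_last v ?k"
    have v12: "v = v1 @\<^sub>v v2" "v1 \<in> carrier_vec n" "v2 \<in> carrier_vec ?k"
      using vec_first_last_append[OF v] by (auto simp: v1_def v2_def)
    have "four_block_mat A (0\<^sub>m n ?k) (0\<^sub>m ?k n) ?B *\<^sub>v v = (A *\<^sub>v v1) @\<^sub>v (?B *\<^sub>v v2)"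
      unfolding v12(1)
      by (subst four_block_mat_mult_vec[OF c(1) zero_carrier_mat zero_carrier_mat c(2) v12(2,3)])
        (use c v12(2,3) in auto)
    then have "v \<bullet> (four_block_mat A (0\<^sub>m n ?k) (0\<^sub>m ?k n) ?B *\<^sub>v v) =
        v1 \<bullet> (A *\<^sub>v v1) + v2 \<bullet> (?B *\<^sub>v v2)"
      unfolding v12(1)
      by (simp add: scalar_prod_append[OF v12(2,3) mult_mat_vec_carrier[OF c(1) v12(2)]
            mult_mat_vec_carrier[OF c(2) v12(3)]])
    then show "0 \<le> v \<bullet> (four_block_mat A (0\<^sub>m n ?k) (0\<^sub>m ?k n) ?B *\<^sub>v v)"
      using A B v12 by (simp add: sym_psd_def)
  qed
qed

lemma calQ_psd: "sym_psd (nx * (N + 1)) (calQ P)"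
  using sym_psd_diag_block[of "replicate N (cost_Q P) @ [cost_Qf P]" nx] cost_mats
  by (auto simp: calQ_def distrib_left add.commute)

lemma calR_psd: "sym_psd (nu * N) (calR P)"
proof -
  have "sym_psd nu (cost_R P)"
    unfolding sym_psd_def
  proof (intro conjI ballI)
    fix v :: "real vec" assume v: "v \<in> carrier_vec nu"
    show "0 \<le> v \<bullet> (cost_R P *\<^sub>v v)"
    proof (cases "v = 0\<^sub>v nu")
      case True
      then show ?thesis using cost_mats(3) by (auto simp: sym_pd_def)
    qed (use cost_mats(3) v in \<open>auto simp: sym_pd_def less_imp_le\<close>)
  qed (use cost_mats(3) in \<open>auto simp: sym_pd_def\<close>)
  then show ?thesis
    using sym_psd_diag_block[of "replicate N (cost_R P)" nu] by (auto simp: calR_def)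
qed

lemma calQ_carrier [simp]: "calQ P \<in> carrier_mat (nx * (N + 1)) (nx * (N + 1))"
  and calR_carrier [simp]: "calR P \<in> carrier_mat (nu * N) (nu * N)"
  using calQ_psd calR_psd by (auto simp: sym_psd_def)

lemma cost_index:
  "cost P t y F \<omega> = (\<Sum>i<nx * (N + 1). \<Sum>j<nx * (N + 1). stacked_state P t y F \<omega> $ i *
      calQ P $$ (i, j) * stacked_state P t y F \<omega> $ j) +
    (\<Sum>i<nu * N. \<Sum>j<nu * N. plant_input P t F \<omega> $ i * calR P $$ (i, j) * plant_input P t F \<omega> $ j)"
  unfolding cost_def
  by (simp only: scalar_prod_mult_mat_vec[OF calQ_carrier stacked_state_carrier stacked_state_carrier]
      scalar_prod_mult_mat_vec[OF calR_carrier plant_input_carrier plant_input_carrier])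

lemma cost_measurable:
  assumes y: "y \<in> S \<rightarrow>\<^sub>M vec_borel nx" and G: "\<And>p. p \<in> space S \<Longrightarrow> G p \<in> policy_class P"
    and Gm: "\<And>i c. i < nu * N \<Longrightarrow> c < ncols \<Longrightarrow> (\<lambda>p. policy_mat P (G p) $$ (i, c)) \<in> borel_measurable S"
    and noise: "\<And>s. (\<lambda>p. noise P (t + s) (\<pi> p)) \<in> S \<rightarrow>\<^sub>M vec_borel nx"
    and channel: "\<And>s. (\<lambda>p. channel P (t + s) (\<pi> p)) \<in> borel_measurable S"
  shows "(\<lambda>p. cost P t (y p) (G p) (\<pi> p)) \<in> borel_measurable S"
proof -
  have [measurable]: "(\<lambda>p. plant_input P t (G p) (\<pi> p) $ i) \<in> borel_measurable S" if "i < nu * N" for i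
    using that by (rule plant_input_measurable) (use assms in auto)
  have [measurable]: "(\<lambda>p. y p $ i) \<in> borel_measurable S" if "i < nx" for i
    using y that by (simp add: measurable_vec_borel_iff)
  have [measurable]: "(\<lambda>p. noise_vec P t (\<pi> p) $ i) \<in> borel_measurable S" if "i < nx * N" for i
    using noise[of "i div nx"] that nx_pos by (simp add: noise_vec_index measurable_vec_borel_iff)
  have [measurable]: "(\<lambda>p. stacked_state P t (y p) (G p) (\<pi> p) $ i) \<in> borel_measurable S"
    if i: "i < nx * (N + 1)" for i
  proof (subst measurable_cong[OF stacked_state_index])
    show "y p \<in> carrier_vec nx" if "p \<in> space S" for p
      using y that by (auto simp: measurable_vec_borel_iff)
    show "(\<lambda>p. (\<Sum>j<nx. calA P $$ (i, j) * y p $ j) +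
      (\<Sum>j<nu * N. calB P $$ (i, j) * plant_input P t (G p) (\<pi> p) $ j) +
      (\<Sum>j<nx * N. calD P $$ (i, j) * noise_vec P t (\<pi> p) $ j)) \<in> borel_measurable S"
      by (intro borel_measurable_add borel_measurable_sum borel_measurable_times) auto
  qed (rule i)
  show ?thesis
    unfolding cost_index
    by (intro borel_measurable_add borel_measurable_sum borel_measurable_times) auto
qed

end

section \<open>Square integrable variables\<close>

context prob_space
begin

definition sq_integrable :: "('a \<Rightarrow> real) \<Rightarrow> bool" where
  "sq_integrable f \<longleftrightarrow> f \<in> borel_measurable M \<and> integrable M (\<lambda>\<omega>. (f \<omega>)\<^sup>2)"

lemma sq_integrable_mult:
  assumes "sq_integrable f" "sq_integrable g"
  shows "integrable M (\<lambda>\<omega>. f \<omega> * g \<omega>)"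
proof (rule Bochner_Integration.integrable_bound)
  show "integrable M (\<lambda>\<omega>. (f \<omega>)\<^sup>2 + (g \<omega>)\<^sup>2)"
    using assms by (simp add: sq_integrable_def)
  show "(\<lambda>\<omega>. f \<omega> * g \<omega>) \<in> borel_measurable M"
    using assms by (auto simp: sq_integrable_def)
  have "\<bar>f \<omega> * g \<omega>\<bar> \<le> \<bar>(f \<omega>)\<^sup>2 + (g \<omega>)\<^sup>2\<bar>" for \<omega>
  proof -
    have "0 \<le> (\<bar>f \<omega>\<bar> - \<bar>g \<omega>\<bar>)\<^sup>2" by simp
    then have "2 * (\<bar>f \<omega>\<bar> * \<bar>g \<omega>\<bar>) \<le> (f \<omega>)\<^sup>2 + (g \<omega>)\<^sup>2" by (simp add: power2_diff)
    moreover have "0 \<le> \<bar>f \<omega>\<bar> * \<bar>g \<omega>\<bar>" by simp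
    ultimately show ?thesis unfolding abs_mult by linarith
  qed
  then show "AE \<omega> in M. norm (f \<omega> * g \<omega>) \<le> norm ((f \<omega>)\<^sup>2 + (g \<omega>)\<^sup>2)" by simp
qed

lemma sq_integrable_bounded:
  assumes "f \<in> borel_measurable M" "\<And>\<omega>. \<omega> \<in> space M \<Longrightarrow> \<bar>f \<omega>\<bar> \<le> c"
  shows "sq_integrable f"
proof -
  have "(f \<omega>)\<^sup>2 \<le> c\<^sup>2" if "\<omega> \<in> space M" for \<omega>
    using power_mono[OF assms(2)[OF that], of 2] by simp
  then have "integrable M (\<lambda>\<omega>. (f \<omega>)\<^sup>2)"
    by (intro integrable_const_bound[of _ "c\<^sup>2"]) (use assms in auto)
  then show ?thesis using assms(1) by (simp add: sq_integrable_def)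
qed

lemma sq_integrable_const: "sq_integrable (\<lambda>_. c)"
  by (rule sq_integrable_bounded[of _ "\<bar>c\<bar>"]) auto

lemma sq_integrable_integrable: "sq_integrable f \<Longrightarrow> integrable M f"
  using sq_integrable_mult[OF _ sq_integrable_const[of 1]] by simp

lemma sq_integrable_cmult: "sq_integrable f \<Longrightarrow> sq_integrable (\<lambda>\<omega>. c * f \<omega>)"
  by (auto simp: sq_integrable_def power_mult_distrib)

lemma sq_integrable_add:
  assumes "sq_integrable f" "sq_integrable g"
  shows "sq_integrable (\<lambda>\<omega>. f \<omega> + g \<omega>)"
proof -
  have "integrable M (\<lambda>\<omega>. (f \<omega>)\<^sup>2 + (g \<omega>)\<^sup>2 + 2 * (f \<omega> * g \<omega>))"
    using assms sq_integrable_mult[OF assms] by (auto simp: sq_integrable_def)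
  then show ?thesis
    using assms by (auto simp: sq_integrable_def power2_sum algebra_simps)
qed

lemma sq_integrable_sum:
  assumes "finite I" "\<And>i. i \<in> I \<Longrightarrow> sq_integrable (f i)"
  shows "sq_integrable (\<lambda>\<omega>. \<Sum>i\<in>I. f i \<omega>)"
  using assms by (induction I) (auto intro: sq_integrable_const sq_integrable_add)

lemma sq_integrable_cong:
  assumes "sq_integrable g" "\<And>\<omega>. \<omega> \<in> space M \<Longrightarrow> f \<omega> = g \<omega>"
  shows "sq_integrable f"
proof -
  have "f \<in> borel_measurable M"
    by (rule iffD2[OF measurable_cong]) (use assms in \<open>auto simp: sq_integrable_def\<close>)
  moreover have "integrable M (\<lambda>\<omega>. (f \<omega>)\<^sup>2)"
    by (rule iffD2[OF Bochner_Integration.integrable_cong[OF refl]])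
      (use assms in \<open>auto simp: sq_integrable_def\<close>)
  ultimately show ?thesis by (simp add: sq_integrable_def)
qed

end

section \<open>The closed loop\<close>

context networked_control
begin

lemma noise_sq_integrable:
  assumes "i < nx"
  shows "sq_integrable (\<lambda>\<omega>. noise P t \<omega> $ i)"
  using noise_measurable noise_second_moment[OF assms] assms
  by (simp add: sq_integrable_def measurable_vec_borel_iff)

lemma noise_vec_sq_integrable:
  assumes "i < nx * N"
  shows "sq_integrable (\<lambda>\<omega>. noise_vec P t \<omega> $ i)"
  using assms nx_pos by (simp add: noise_vec_index noise_sq_integrable)

lemma cost_integrable:
  assumes y: "\<And>i. i < nx \<Longrightarrow> sq_integrable (\<lambda>\<omega>. y \<omega> $ i)"
      "\<And>\<omega>. \<omega> \<in> space (pspace P) \<Longrightarrow> y \<omega> \<in> carrier_vec nx"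
    and u: "\<And>i. i < nu * N \<Longrightarrow> sq_integrable (\<lambda>\<omega>. plant_input P t (G \<omega>) \<omega> $ i)"
  shows "integrable (pspace P) (\<lambda>\<omega>. cost P t (y \<omega>) (G \<omega>) \<omega>)"
proof -
  have x: "sq_integrable (\<lambda>\<omega>. stacked_state P t (y \<omega>) (G \<omega>) \<omega> $ i)" if i: "i < nx * (N + 1)" for i
  proof (rule sq_integrable_cong)
    show "sq_integrable (\<lambda>\<omega>. (\<Sum>j<nx. calA P $$ (i, j) * y \<omega> $ j) +
      (\<Sum>j<nu * N. calB P $$ (i, j) * plant_input P t (G \<omega>) \<omega> $ j) +
      (\<Sum>j<nx * N. calD P $$ (i, j) * noise_vec P t \<omega> $ j))"
      by (intro sq_integrable_add sq_integrable_sum sq_integrable_cmult noise_vec_sq_integrable y u) auto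
  qed (rule stacked_state_index[OF y(2) i])
  have prod: "integrable (pspace P) (\<lambda>\<omega>. f \<omega> * c * g \<omega>)"
    if "sq_integrable f" "sq_integrable g" for f g and c :: real
    using sq_integrable_mult[OF that(1) sq_integrable_cmult[OF that(2), of c]] by (simp add: mult.assoc)
  show ?thesis
    unfolding cost_index
    by (intro Bochner_Integration.integrable_add Bochner_Integration.integrable_sum prod x u) auto
qed

lemma channel_vec_first:
  "vec_first (channel_vec P t N \<omega>) (N - 1) = channel_vec P t (N - 1) \<omega>"
  by (rule eq_vecI) (auto simp: vec_first_def channel_vec_def)

text \<open>
  The realized channel outcomes and saturated noise are among the values quantified over in the hard
  constraint. It is the input, not the policy, that is bounded: for \<open>phi_max P = 0\<close> the constraint
  leaves \<open>\<Theta>\<close> unbounded.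
\<close>
lemma plant_input_hard_bound:
  assumes F: "F \<in> hard_feasible P" and \<omega>: "\<omega> \<in> space (pspace P)" and i: "i < nu * N"
  shows "\<bar>plant_input P t F \<omega> $ i\<bar> \<le> u_max P"
proof -
  have "linf_norm (sat_vec P t \<omega>) \<le> phi_max P"
    using sat_vec_bound[OF \<omega>] phi_max sat_vec_carrier[of t \<omega>] by (auto simp: linf_norm_le_iff)
  moreover have "\<forall>k<N. channel_vec P t N \<omega> $ k \<in> {0, 1}"
    using channel_range[OF \<omega>] by (auto simp: channel_vec_index)
  ultimately show ?thesis
    using F[unfolded hard_feasible_iff, THEN conjunct2, rule_format, OF channel_vec_carrier sat_vec_carrier _ _ i]
      F plant_input_index[OF _ i, of F] by (simp add: channel_vec_first hard_feasible_iff)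
qed

lemma plant_input_bound:
  assumes F: "(\<eta>, \<Theta>, \<Lambda>) \<in> policy_class P" and \<omega>: "\<omega> \<in> space (pspace P)" and i: "i < nu * N"
  shows "\<bar>plant_input P t (\<eta>, \<Theta>, \<Lambda>) \<omega> $ i\<bar> \<le> \<bar>\<eta> $ i\<bar> +
    (\<Sum>j<nx * (N - 1). \<bar>\<Theta> $$ (i, j)\<bar> * phi_max P) + (\<Sum>j<N - 1. \<bar>\<Lambda> $$ (i, j)\<bar>)"
proof -
  have "\<bar>plant_input P t (\<eta>, \<Theta>, \<Lambda>) \<omega> $ i\<bar> \<le>
      \<bar>control (\<eta>, \<Theta>, \<Lambda>) (sat_vec P t \<omega>) (channel_vec P t (N - 1) \<omega>) $ i\<bar>"
    using gain_channel_range[OF \<omega> i, of t] unfolding plant_input_index[OF F i] by (auto simp del: control.simps)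
  also have "\<dots> \<le> \<bar>\<eta> $ i\<bar> + (\<Sum>j<nx * (N - 1). \<bar>\<Theta> $$ (i, j) * sat_vec P t \<omega> $ j\<bar>) +
      (\<Sum>j<N - 1. \<bar>\<Lambda> $$ (i, j) * channel_vec P t (N - 1) \<omega> $ j\<bar>)"
    unfolding control_index[OF F sat_vec_carrier channel_vec_carrier i]
    by (intro abs_triangle_ineq[THEN order_trans] add_mono sum_abs order_refl)
  also have "\<dots> \<le> \<bar>\<eta> $ i\<bar> +
    (\<Sum>j<nx * (N - 1). \<bar>\<Theta> $$ (i, j)\<bar> * phi_max P) + (\<Sum>j<N - 1. \<bar>\<Lambda> $$ (i, j)\<bar>)"
  proof (intro add_mono sum_mono order_refl)
    fix j assume "j \<in> {..<nx * (N - 1)}"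
    then show "\<bar>\<Theta> $$ (i, j) * sat_vec P t \<omega> $ j\<bar> \<le> \<bar>\<Theta> $$ (i, j)\<bar> * phi_max P"
      using sat_vec_bound[OF \<omega>] by (simp add: abs_mult mult_left_mono)
  next
    fix j assume "j \<in> {..<N - 1}"
    then show "\<bar>\<Lambda> $$ (i, j) * channel_vec P t (N - 1) \<omega> $ j\<bar> \<le> \<bar>\<Lambda> $$ (i, j)\<bar>"
      using channel_range[OF \<omega>, of "t + j"] by (auto simp: channel_vec_index)
  qed
  finally show ?thesis .
qed

lemma decision_rule_policy:
  "g \<in> decision_rules P \<Longrightarrow> y \<in> carrier_vec nx \<Longrightarrow> g y \<in> policy_class P"
  by (simp add: decision_rules_def)

lemma decision_rule_measurable:
  assumes g: "g \<in> decision_rules P" and y: "y \<in> S \<rightarrow>\<^sub>M vec_borel nx" and i: "i < nu * N" "c < ncols"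
  shows "(\<lambda>p. policy_mat P (g (y p)) $$ (i, c)) \<in> borel_measurable S"
proof -
  have "(\<lambda>z. coords P (g z)) \<in> vec_borel nx \<rightarrow>\<^sub>M vec_borel (num_coords P)"
    using g by (simp add: decision_rules_def)
  from measurable_compose[OF y this]
  have m: "(\<lambda>p. coords P (g (y p)) $ (i * ncols + c)) \<in> borel_measurable S"
    using coord_less[OF i] by (simp add: measurable_vec_borel_iff)
  show ?thesis
  proof (rule iffD2[OF measurable_cong m])
    fix p assume "p \<in> space S"
    then have "g (y p) \<in> policy_class P"
      using measurable_space[OF y] by (intro decision_rule_policy[OF g]) simp
    then show "policy_mat P (g (y p)) $$ (i, c) = coords P (g (y p)) $ (i * ncols + c)"
      by (simp add: coords_index i)
  qed
qed

lemma rule_input_measurable: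
  assumes "g \<in> decision_rules P" "y \<in> pspace P \<rightarrow>\<^sub>M vec_borel nx" "i < nu * N"
  shows "(\<lambda>\<omega>. plant_input P t (g (y \<omega>)) \<omega> $ i) \<in> borel_measurable (pspace P)"
  by (rule plant_input_measurable)
    (use assms measurable_space[OF assms(2)] in
      \<open>auto intro: decision_rule_policy decision_rule_measurable noise_measurable channel_measurable\<close>)

lemma feasible_decision: "g \<in> feasible_rules P \<Longrightarrow> g \<in> decision_rules P"
  by (simp add: feasible_rules_def)

definition past :: "nat \<Rightarrow> (nat + nat) set" where
  "past t = Inl ` {..<t} \<union> Inr ` {..<t}"

definition future :: "nat \<Rightarrow> (nat + nat) set" where
  "future t = Inl ` {t..} \<union> Inr ` {t..}"

lemma past_future: "past t \<inter> future t = {}"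
  by (auto simp: past_def future_def)

context
  fixes K :: "nat \<Rightarrow> real vec \<Rightarrow> policy" and x :: "nat \<Rightarrow> 'w \<Rightarrow> real vec"
  assumes K: "\<And>k. K k \<in> feasible_rules P" and loop: "closed_loop P K x"
begin

lemma state_0: "\<omega> \<in> space (pspace P) \<Longrightarrow> x 0 \<omega> = x_init P"
  using loop by (simp add: closed_loop_def)

lemma state_Suc:
  fixes s
  defines "\<tau> \<equiv> s div recalc P * recalc P" and "l \<equiv> s mod recalc P"
  assumes "\<omega> \<in> space (pspace P)"
  shows "x (Suc s) \<omega> = mat_A P *\<^sub>v x s \<omega> +
    mat_B P *\<^sub>v block nu l (plant_input P \<tau> (K (s div recalc P) (x \<tau> \<omega>)) \<omega>) + noise P s \<omega>"
  using loop assms by (simp add: closed_loop_def Let_def)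

lemma state_index:
  fixes s
  defines "\<tau> \<equiv> s div recalc P * recalc P" and "l \<equiv> s mod recalc P"
  assumes \<omega>: "\<omega> \<in> space (pspace P)" and xs: "x s \<omega> \<in> carrier_vec nx" and i: "i < nx"
  shows "x (Suc s) \<omega> $ i = (\<Sum>j<nx. mat_A P $$ (i, j) * x s \<omega> $ j) +
    (\<Sum>j<nu. mat_B P $$ (i, j) * plant_input P \<tau> (K (s div recalc P) (x \<tau> \<omega>)) \<omega> $ (nu * l + j)) +
    noise P s \<omega> $ i"
proof -
  let ?b = "block nu l (plant_input P \<tau> (K (s div recalc P) (x \<tau> \<omega>)) \<omega>)"
  have b: "?b \<in> carrier_vec nu" by (simp add: block_def)
  have "dim_row (mat_B P) = nx" "dim_vec (noise P s \<omega>) = nx"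
    using plant noise_carrier[OF \<omega>] by auto
  then show ?thesis
    using i unfolding state_Suc[OF \<omega>] \<tau>_def[symmetric] l_def[symmetric]
    by (simp only: index_add_vec dim_mult_mat_vec mult_mat_vec_index[OF plant(1) xs i]
        mult_mat_vec_index[OF plant(2) b i]) (simp add: block_def)
qed

lemma state_carrier: "\<omega> \<in> space (pspace P) \<Longrightarrow> x s \<omega> \<in> carrier_vec nx"
proof (cases s)
  case (Suc s')
  assume \<omega>: "\<omega> \<in> space (pspace P)"
  then show ?thesis
    unfolding Suc state_Suc[OF \<omega>] using noise_carrier[OF \<omega>, of s'] by (intro carrier_vecI) simp
qed (simp add: state_0 plant)

lemma input_index_less:
  assumes "j < nu"
  shows "nu * (s mod recalc P) + j < nu * N" "(nu * (s mod recalc P) + j) div nu = s mod recalc P"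
proof -
  have "s mod recalc P < N"
    using mod_less_divisor[of "recalc P" s] horizon by linarith
  then have "nu * Suc (s mod recalc P) \<le> nu * N" by (intro mult_le_mono2) simp
  then show "nu * (s mod recalc P) + j < nu * N" using assms by simp
  show "(nu * (s mod recalc P) + j) div nu = s mod recalc P" using assms by simp
qed

text \<open>
  The input at the instant \<open>s\<close> is computed from the state at the last recalculation instant and from noise
  and channel outcomes up to \<open>s\<close>, hence strong induction.
\<close>
lemma state_past: "x s \<in> info (past s) \<rightarrow>\<^sub>M vec_borel nx"
proof (induction s rule: less_induct)
  case (less s)
  show ?case
  proof (cases s)
    case 0
    have "(\<lambda>\<omega>. x 0 \<omega> $ i) \<in> borel_measurable (info (past 0))" for i
      by (rule iffD2[OF measurable_cong, where g1 = "\<lambda>_. x_init P $ i"]) (auto simp: state_0)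
    then show ?thesis
      unfolding 0 by (auto simp: measurable_vec_borel_iff state_carrier)
  next
    case (Suc s')
    define \<tau> l where "\<tau> = s' div recalc P * recalc P" and "l = s' mod recalc P"
    have \<tau>l: "\<tau> + l = s'" by (simp add: \<tau>_def l_def)
    let ?I = "past (Suc s')"
    let ?next = "\<lambda>i \<omega>. (\<Sum>j<nx. mat_A P $$ (i, j) * x s' \<omega> $ j) +
      (\<Sum>j<nu. mat_B P $$ (i, j) * plant_input P \<tau> (K (s' div recalc P) (x \<tau> \<omega>)) \<omega> $ (nu * l + j)) +
      noise P s' \<omega> $ i"
    have sub: "x r \<in> info ?I \<rightarrow>\<^sub>M vec_borel nx" if "r \<le> s'" for r
    proof -
      have "past r \<subseteq> ?I" using that by (auto simp: past_def)
      moreover have "x r \<in> info (past r) \<rightarrow>\<^sub>M vec_borel nx"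
        using that Suc by (intro less) simp
      ultimately show ?thesis by (rule measurable_from_subalg[OF info_mono])
    qed
    have x\<tau>: "x \<tau> \<in> info ?I \<rightarrow>\<^sub>M vec_borel nx" using \<tau>l by (intro sub) simp
    have u: "(\<lambda>\<omega>. plant_input P \<tau> (K (s' div recalc P) (x \<tau> \<omega>)) \<omega> $ (nu * l + j)) \<in>
        borel_measurable (info ?I)" if j: "j < nu" for j
    proof (rule plant_input_measurable)
      note less = input_index_less[OF j, of s', folded l_def]
      show "nu * l + j < nu * N" by (rule less)
      show "K (s' div recalc P) (x \<tau> \<omega>) \<in> policy_class P" if "\<omega> \<in> space (info ?I)" for \<omega>
        using that state_carrier by (intro decision_rule_policy[OF feasible_decision[OF K]]) simp
      show "(\<lambda>\<omega>. policy_mat P (K (s' div recalc P) (x \<tau> \<omega>)) $$ (i, c)) \<in> borel_measurable (info ?I)"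
        if "i < nu * N" "c < ncols" for i c
        by (rule decision_rule_measurable[OF feasible_decision[OF K] x\<tau> that])
      show "noise P (\<tau> + r) \<in> info ?I \<rightarrow>\<^sub>M vec_borel nx" if "r < (nu * l + j) div nu" for r
        using that less \<tau>l by (intro noise_info) (auto simp: past_def)
      show "channel P (\<tau> + r) \<in> borel_measurable (info ?I)" if "r \<le> (nu * l + j) div nu" for r
        using that less \<tau>l by (intro channel_info) (auto simp: past_def)
    qed
    have n: "noise P s' \<in> info ?I \<rightarrow>\<^sub>M vec_borel nx"
      by (rule noise_info) (auto simp: past_def)
    have "(\<lambda>\<omega>. x (Suc s') \<omega> $ i) \<in> borel_measurable (info ?I)" if i: "i < nx" for i
    proof (rule iffD2[OF measurable_cong])
      fix \<omega> assume "\<omega> \<in> space (info ?I)"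
      then have "\<omega> \<in> space (pspace P)" by simp
      then show "x (Suc s') \<omega> $ i = ?next i \<omega>"
        unfolding \<tau>_def l_def by (intro state_index state_carrier i)
    next
      show "(?next i) \<in> borel_measurable (info ?I)"
        using sub[OF order_refl] n i
        by (intro borel_measurable_add borel_measurable_sum borel_measurable_times u)
          (auto simp: measurable_vec_borel_iff)
    qed
    then show ?thesis
      unfolding Suc by (auto simp: measurable_vec_borel_iff state_carrier)
  qed
qed

lemma state_measurable: "x s \<in> pspace P \<rightarrow>\<^sub>M vec_borel nx"
  by (rule measurable_info[OF state_past])

text \<open>
  The inputs are bounded, so square integrability propagates through the linear dynamics.
\<close>
lemma state_sq_integrable: "i < nx \<Longrightarrow> sq_integrable (\<lambda>\<omega>. x s \<omega> $ i)"
proof (induction s arbitrary: i)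
  case 0
  show ?case
    by (rule sq_integrable_cong[OF sq_integrable_const[of "x_init P $ i"]]) (simp add: state_0)
next
  case (Suc s)
  define \<tau> l where "\<tau> = s div recalc P * recalc P" and "l = s mod recalc P"
  let ?next = "\<lambda>i \<omega>. (\<Sum>j<nx. mat_A P $$ (i, j) * x s \<omega> $ j) +
    (\<Sum>j<nu. mat_B P $$ (i, j) * plant_input P \<tau> (K (s div recalc P) (x \<tau> \<omega>)) \<omega> $ (nu * l + j)) +
    noise P s \<omega> $ i"
  have u: "sq_integrable (\<lambda>\<omega>. plant_input P \<tau> (K (s div recalc P) (x \<tau> \<omega>)) \<omega> $ (nu * l + j))"
    if j: "j < nu" for j
  proof (rule sq_integrable_bounded)
    note less = input_index_less[OF j, of s, folded l_def]
    show "(\<lambda>\<omega>. plant_input P \<tau> (K (s div recalc P) (x \<tau> \<omega>)) \<omega> $ (nu * l + j)) \<in> borel_measurable (pspace P)"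
      by (rule rule_input_measurable[OF feasible_decision[OF K] state_measurable less(1)])
    show "\<bar>plant_input P \<tau> (K (s div recalc P) (x \<tau> \<omega>)) \<omega> $ (nu * l + j)\<bar> \<le> u_max P"
      if "\<omega> \<in> space (pspace P)" for \<omega>
      using K[of "s div recalc P"] state_carrier[OF that]
      by (intro plant_input_hard_bound that less) (simp add: feasible_rules_def)
  qed
  show ?case
  proof (rule sq_integrable_cong)
    show "sq_integrable (?next i)"
      using Suc by (intro sq_integrable_add sq_integrable_sum sq_integrable_cmult u noise_sq_integrable) auto
    show "x (Suc s) \<omega> $ i = ?next i \<omega>" if "\<omega> \<in> space (pspace P)" for \<omega>
      unfolding \<tau>_def l_def by (intro state_index state_carrier that Suc.prems)
  qed
qed

lemma rule_cost_integrable_if_input_bounded: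
  assumes g: "g \<in> decision_rules P"
    and bound: "\<And>\<omega> i. \<omega> \<in> space (pspace P) \<Longrightarrow> i < nu * N \<Longrightarrow> \<bar>plant_input P t (g (x t \<omega>)) \<omega> $ i\<bar> \<le> c i"
  shows "integrable (pspace P) (rule_cost P x t g)"
  unfolding rule_cost_def
proof (rule cost_integrable[OF state_sq_integrable state_carrier])
  show "sq_integrable (\<lambda>\<omega>. plant_input P t (g (x t \<omega>)) \<omega> $ i)" if "i < nu * N" for i
    by (rule sq_integrable_bounded[OF rule_input_measurable[OF g state_measurable that] bound[OF _ that]])
qed

lemma feasible_rule_integrable:
  assumes g: "g \<in> feasible_rules P"
  shows "integrable (pspace P) (rule_cost P x t g)"
  by (rule rule_cost_integrable_if_input_bounded[OF feasible_decision[OF g] plant_input_hard_bound])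
    (use g state_carrier in \<open>auto simp: feasible_rules_def\<close>)

lemma const_decision_rule: "F \<in> policy_class P \<Longrightarrow> (\<lambda>_. F) \<in> decision_rules P"
  by (auto simp: decision_rules_def coords_carrier)

lemma constant_rule_integrable:
  assumes F: "F \<in> policy_class P"
  shows "integrable (pspace P) (rule_cost P x t (\<lambda>_. F))"
proof -
  obtain \<eta> \<Theta> \<Lambda> where FF: "F = (\<eta>, \<Theta>, \<Lambda>)" using F by (rule policy_class_cases)
  show ?thesis
    by (rule rule_cost_integrable_if_input_bounded[OF const_decision_rule[OF F]])
      (unfold FF, rule plant_input_bound[OF F[unfolded FF]])
qed

lemma state_algebra_subset: "sets (state_algebra P (x t)) \<subseteq> sets (info (past t))"
proof -
  have "x t \<in> space (pspace P) \<rightarrow> space (vec_borel nx)" using state_carrier by auto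
  then show ?thesis
    using measurable_sets[OF state_past[of t]]
    by (auto simp: state_algebra_def sets_vimage_algebra2)
qed

text \<open>
  The state is decided by the past, and the cost is a function of the state and of the future.
\<close>
lemma cond_exp_rule_cost:
  assumes g: "g \<in> decision_rules P" and int: "integrable (pspace P) (rule_cost P x t g)"
  shows "AE \<omega> in pspace P. real_cond_exp (pspace P) (state_algebra P (x t)) (rule_cost P x t g) \<omega> =
    expectation (cost P t (x t \<omega>) (g (x t \<omega>)))"
proof -
  let ?F = "state_algebra P (x t)" and ?G = "info (future t)"
  define f where "f = (\<lambda>p. cost P t (x t (fst p)) (g (x t (fst p))) (snd p))"
  have space: "space ?F = space (pspace P)" by (simp add: state_algebra_def)
  have sub: "subalgebra (pspace P) ?F"
    using state_algebra_subset[of t] subalgebra_info[of "past t"] by (auto simp: subalgebra_def space)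
  have "indep_set (sets ?F) (sets ?G)"
    using indep_setD[OF indep_info[OF past_future[of t]]] state_algebra_subset[of t] sub
      subalgebra_info[of "future t"] by (intro indep_setI) (auto simp: subalgebra_def)
  moreover have "f \<in> borel_measurable (?F \<Otimes>\<^sub>M ?G)"
    unfolding f_def
  proof (rule cost_measurable)
    have "x t \<in> ?F \<rightarrow>\<^sub>M vec_borel nx"
      unfolding state_algebra_def using state_carrier by (intro measurable_vimage_algebra1) auto
    then show xm: "(\<lambda>p. x t (fst p)) \<in> ?F \<Otimes>\<^sub>M ?G \<rightarrow>\<^sub>M vec_borel nx"
      by (rule measurable_compose[OF measurable_fst])
    show "g (x t (fst p)) \<in> policy_class P" if "p \<in> space (?F \<Otimes>\<^sub>M ?G)" for p
      using that state_carrier by (intro decision_rule_policy[OF g]) (auto simp: space_pair_measure space)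
    show "(\<lambda>p. policy_mat P (g (x t (fst p))) $$ (i, c)) \<in> borel_measurable (?F \<Otimes>\<^sub>M ?G)"
      if "i < nu * N" "c < ncols" for i c
      by (rule decision_rule_measurable[OF g xm that])
    show "(\<lambda>p. noise P (t + s) (snd p)) \<in> ?F \<Otimes>\<^sub>M ?G \<rightarrow>\<^sub>M vec_borel nx" for s
      by (rule measurable_compose[OF measurable_snd noise_info]) (auto simp: future_def)
    show "(\<lambda>p. channel P (t + s) (snd p)) \<in> borel_measurable (?F \<Otimes>\<^sub>M ?G)" for s
      by (rule measurable_compose[OF measurable_snd channel_info]) (auto simp: future_def)
  qed
  moreover have "integrable (pspace P) (\<lambda>\<omega>. f (\<omega>, \<omega>))"
    using int unfolding f_def rule_cost_def[abs_def] by simp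
  ultimately have "AE \<omega> in pspace P. real_cond_exp (pspace P) ?F (\<lambda>\<omega>. f (\<omega>, \<omega>)) \<omega> =
      expectation (\<lambda>\<omega>'. f (\<omega>, \<omega>'))"
    by (rule cond_exp_freeze[OF sub subalgebra_info])
  then show ?thesis by (simp add: f_def rule_cost_def[abs_def])
qed

end

end

section \<open>Block rows, block columns and diagonal matrices\<close>

lemma beside_carrier:
  "A \<in> carrier_mat r c \<Longrightarrow> B \<in> carrier_mat r c' \<Longrightarrow> beside A B \<in> carrier_mat r (c + c')"
  by (auto simp: dim_beside intro!: carrier_matI)

lemma beside_mult_vec:
  assumes A: "A \<in> carrier_mat r c" and B: "B \<in> carrier_mat r c'"
    and v: "v \<in> carrier_vec c" and w: "w \<in> carrier_vec c'"
  shows "beside A B *\<^sub>v (v @\<^sub>v w) = A *\<^sub>v v + B *\<^sub>v w"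
proof -
  have "beside A B = four_block_mat A B (0\<^sub>m 0 c) (0\<^sub>m 0 c')"
    using A B by (simp add: beside_def)
  then have "beside A B *\<^sub>v (v @\<^sub>v w) =
      (A *\<^sub>v v + B *\<^sub>v w) @\<^sub>v (0\<^sub>m 0 c *\<^sub>v v + 0\<^sub>m 0 c' *\<^sub>v w)"
    using four_block_mat_mult_vec[OF A B zero_carrier_mat zero_carrier_mat v w] by metis
  also have "\<dots> = A *\<^sub>v v + B *\<^sub>v w"
    by (rule eq_vecI) auto
  finally show ?thesis .
qed

abbreviation vconcat :: "('i \<Rightarrow> real vec) \<Rightarrow> 'i list \<Rightarrow> real vec" where
  "vconcat f ls \<equiv> foldr (@\<^sub>v) (map f ls) vNil"

lemma vconcat_carrier:
  assumes "\<And>l. l \<in> set ls \<Longrightarrow> f l \<in> carrier_vec (c l)"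
  shows "vconcat f ls \<in> carrier_vec (sum_list (map c ls))"
  using assms by (induction ls) auto

lemma vconcat_scalar_prod:
  assumes "\<And>l. l \<in> set ls \<Longrightarrow> f l \<in> carrier_vec (c l)" "\<And>l. l \<in> set ls \<Longrightarrow> g l \<in> carrier_vec (c l)"
  shows "vconcat f ls \<bullet> vconcat g ls = (\<Sum>l\<leftarrow>ls. f l \<bullet> g l)"
  using assms
proof (induction ls)
  case (Cons l ls)
  have "(f l @\<^sub>v vconcat f ls) \<bullet> (g l @\<^sub>v vconcat g ls) = f l \<bullet> g l + vconcat f ls \<bullet> vconcat g ls"
    by (rule scalar_prod_append[of _ "c l" _ "sum_list (map c ls)"])
      (use Cons.prems in \<open>auto intro: vconcat_carrier\<close>)
  then show ?case using Cons by simp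
qed (simp add: scalar_prod_def)

lemma hcat_carrier:
  assumes "\<And>l. l \<in> set ls \<Longrightarrow> M l \<in> carrier_mat r (c l)"
  shows "hcat r (map M ls) \<in> carrier_mat r (sum_list (map c ls))"
  using assms by (induction ls) (auto simp: hcat_def intro!: beside_carrier)

text \<open>
  Pairing with a fixed vector turns the product with a block row into a sum of numbers.
\<close>
lemma scalar_prod_hcat_mult:
  assumes "\<And>l. l \<in> set ls \<Longrightarrow> M l \<in> carrier_mat r (c l)" "\<And>l. l \<in> set ls \<Longrightarrow> f l \<in> carrier_vec (c l)"
    and v: "v \<in> carrier_vec r"
  shows "v \<bullet> (hcat r (map M ls) *\<^sub>v vconcat f ls) = (\<Sum>l\<leftarrow>ls. v \<bullet> (M l *\<^sub>v f l))"
  using assms(1,2)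
proof (induction ls)
  case Nil
  show ?case using v by (auto simp: hcat_def scalar_prod_def)
next
  case (Cons l ls)
  have c: "M l \<in> carrier_mat r (c l)" "hcat r (map M ls) \<in> carrier_mat r (sum_list (map c ls))"
    "f l \<in> carrier_vec (c l)" "vconcat f ls \<in> carrier_vec (sum_list (map c ls))"
    using Cons.prems by (auto intro: hcat_carrier vconcat_carrier)
  have "hcat r (map M (l # ls)) *\<^sub>v vconcat f (l # ls) = M l *\<^sub>v f l + hcat r (map M ls) *\<^sub>v vconcat f ls"
    using beside_mult_vec[OF c] by (simp add: hcat_def)
  then show ?case
    using Cons scalar_prod_add_distrib[OF v mult_mat_vec_carrier[OF c(1,3)] mult_mat_vec_carrier[OF c(2,4)]]
    by simp
qed

lemma vcat_carrier:
  assumes "\<And>l. l \<in> set ls \<Longrightarrow> M l \<in> carrier_mat (c l) k"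
  shows "vcat k (map M ls) \<in> carrier_mat (sum_list (map c ls)) k"
  using assms by (induction ls) (auto simp: vcat_def)

lemma vcat_mult_vec:
  assumes "\<And>l. l \<in> set ls \<Longrightarrow> M l \<in> carrier_mat (c l) k" and w: "w \<in> carrier_vec k"
  shows "vcat k (map M ls) *\<^sub>v w = vconcat (\<lambda>l. M l *\<^sub>v w) ls"
  using assms(1)
proof (induction ls)
  case Nil
  show ?case by (rule eq_vecI) (auto simp: vcat_def)
next
  case (Cons l ls)
  have "vcat k (map M (l # ls)) *\<^sub>v w = (M l *\<^sub>v w) @\<^sub>v (vcat k (map M ls) *\<^sub>v w)"
    unfolding vcat_def list.map foldr.simps comp_def
    by (rule mat_mult_append[OF _ _ w]) (use Cons.prems vcat_carrier[of ls M c k] in \<open>auto simp: vcat_def\<close>)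
  then show ?case using Cons by simp
qed

lemma scalar_prod_four_block:
  assumes A: "A \<in> carrier_mat r r" and B: "B \<in> carrier_mat r k" and D: "D \<in> carrier_mat k k"
    and v: "v \<in> carrier_vec r" and w: "w \<in> carrier_vec k"
  shows "(v @\<^sub>v w) \<bullet> (four_block_mat A B (B\<^sup>T) D *\<^sub>v (v @\<^sub>v w)) =
    v \<bullet> (A *\<^sub>v v) + 2 * (v \<bullet> (B *\<^sub>v w)) + w \<bullet> (D *\<^sub>v (w :: real vec))"
proof -
  have BT: "B\<^sup>T \<in> carrier_mat k r" using B by simp
  have c: "A *\<^sub>v v \<in> carrier_vec r" "B *\<^sub>v w \<in> carrier_vec r" "B\<^sup>T *\<^sub>v v \<in> carrier_vec k" "D *\<^sub>v w \<in> carrier_vec k"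
    using mult_mat_vec_carrier[OF A v] mult_mat_vec_carrier[OF B w] mult_mat_vec_carrier[OF BT v]
      mult_mat_vec_carrier[OF D w] by auto
  have "w \<bullet> (B\<^sup>T *\<^sub>v v) = v \<bullet> (B *\<^sub>v w)"
    unfolding transpose_vec_mult_scalar[OF B w v, symmetric] by (rule comm_scalar_prod[OF w c(3)])
  then show ?thesis
    unfolding four_block_mat_mult_vec[OF A B BT D v w]
      scalar_prod_append[OF v w add_carrier_vec[OF c(1,2)] add_carrier_vec[OF c(3,4)]]
    using v w c by (simp add: scalar_prod_add_distrib[of _ r] scalar_prod_add_distrib[of _ k])
qed

lemma tr_mult_index:
  assumes "A \<in> carrier_mat n k" "B \<in> carrier_mat k n"
  shows "tr (A * B) = (\<Sum>i<n. \<Sum>j<k. A $$ (i, j) * B $$ (j, i))"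
  using assms by (auto simp: tr_def scalar_prod_def lessThan_atLeast0 intro!: sum.cong)

lemma mult_mat_index:
  assumes "A \<in> carrier_mat n k" "B \<in> carrier_mat k m" "i < n" "j < m"
  shows "(A * B) $$ (i, j) = (\<Sum>l<k. A $$ (i, l) * B $$ (l, j))"
  using assms by (auto simp: scalar_prod_def lessThan_atLeast0)

definition diag_of :: "nat \<Rightarrow> (nat \<Rightarrow> real) \<Rightarrow> real mat" where
  "diag_of n s = mat n n (\<lambda>(i, j). if i = j then s i else 0)"

lemma diag_of_carrier [simp]: "diag_of n s \<in> carrier_mat n n"
  by (simp add: diag_of_def)

lemma transpose_diag_of: "(diag_of n s)\<^sup>T = diag_of n s"
  by (rule eq_matI) (auto simp: diag_of_def)

lemma diag_of_mult_index:
  assumes "A \<in> carrier_mat n k" "i < n" "j < k"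
  shows "(diag_of n s * A) $$ (i, j) = s i * A $$ (i, j)"
proof -
  have "(diag_of n s * A) $$ (i, j) = (\<Sum>l<n. if i = l then s i * A $$ (i, j) else 0)"
    unfolding mult_mat_index[OF diag_of_carrier assms]
    using assms by (intro sum.cong) (auto simp: diag_of_def)
  then show ?thesis using assms by simp
qed

lemma mult_diag_of_index:
  assumes "A \<in> carrier_mat k n" "i < k" "j < n"
  shows "(A * diag_of n s) $$ (i, j) = A $$ (i, j) * s j"
proof -
  have "(A * diag_of n s) $$ (i, j) = (\<Sum>l<n. if j = l then A $$ (i, j) * s j else 0)"
    unfolding mult_mat_index[OF assms(1) diag_of_carrier assms(2,3)]
    using assms by (intro sum.cong) (auto simp: diag_of_def)
  then show ?thesis using assms by simp
qed

lemma diag_of_sandwich_index: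
  assumes "A \<in> carrier_mat n n" "i < n" "j < n"
  shows "((diag_of n s)\<^sup>T * A * diag_of n s') $$ (i, j) = s i * A $$ (i, j) * s' j"
  unfolding transpose_diag_of
  using assms by (simp add: mult_diag_of_index[OF mult_carrier_mat[OF diag_of_carrier assms(1)]] diag_of_mult_index)

lemma diag_of_mult_vec_index:
  assumes "v \<in> carrier_vec n" "i < n"
  shows "(diag_of n s *\<^sub>v v) $ i = s i * v $ i"
proof -
  have "(diag_of n s *\<^sub>v v) $ i = (\<Sum>l<n. if i = l then s i * v $ i else 0)"
    unfolding mult_mat_vec_index[OF diag_of_carrier assms]
    using assms by (intro sum.cong) (auto simp: diag_of_def)
  then show ?thesis using assms by simp
qed

lemma sum_lessThan_split_first:
  fixes n :: nat and h :: "nat \<Rightarrow> real"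
  assumes "0 < n"
  shows "(\<Sum>l<n. h l) = h 0 + (\<Sum>l=1..<n. h l)"
  using assms by (simp add: lessThan_atLeast0 sum.atLeast_Suc_lessThan One_nat_def)

lemma sum_list_upt_from_1: "(\<Sum>l\<leftarrow>[1..<n]. h l) = (\<Sum>l=1..<n. h l)"
  by (simp add: interv_sum_list_conv_sum_set_nat)

section \<open>The matrices of the program in terms of entries\<close>

context networked_control
begin

text \<open>
  The random factor with which the \<open>l\<close>-th coefficient of a policy enters the plant input at row \<open>i\<close>:
  the diagonal entry of \<open>\<S>\<close> for \<open>l = 0\<close> and that of \<open>\<S>\<^sub>l\<close> otherwise. Counting the constant
  as coefficient zero treats \<open>\<eta>\<close> and the columns of \<open>\<Lambda>\<close> uniformly.
\<close>
definition mode :: "nat \<Rightarrow> nat \<Rightarrow> nat \<Rightarrow> 'w \<Rightarrow> real" where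
  "mode t l i \<omega> = (if l = 0 then 1 else channel P (t + l - 1) \<omega>) * gain (channel_vec P t N \<omega>) i"

fun mode_coeff :: "policy \<Rightarrow> nat \<Rightarrow> nat \<Rightarrow> real" where
  "mode_coeff (\<eta>, \<Theta>, \<Lambda>) l i = (if l = 0 then \<eta> $ i else \<Lambda> $$ (i, l - 1))"

lemma calS_eq: "calS P t \<omega> = diag_of (nu * N) (\<lambda>i. mode t 0 i \<omega>)"
  by (simp add: calS_def protocol_mat_eq diag_of_def mode_def)

lemma calS_l_eq: "1 \<le> l \<Longrightarrow> calS_l P t l \<omega> = diag_of (nu * N) (\<lambda>i. mode t l i \<omega>)"
  unfolding calS_l_def calS_eq by (rule eq_matI) (auto simp: diag_of_def mode_def)

lemma calS_l_fun: "1 \<le> l \<Longrightarrow> calS_l P t l = (\<lambda>\<omega>. diag_of (nu * N) (\<lambda>i. mode t l i \<omega>))"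
  by (rule ext) (rule calS_l_eq)

lemma alpha_carrier [simp]: "alpha P \<in> carrier_mat (nu * N) (nu * N)"
proof -
  have "(calB P)\<^sup>T * calQ P * calB P \<in> carrier_mat (nu * N) (nu * N)"
    by (intro mult_carrier_mat[of _ _ "nx * (N + 1)"]) (auto simp: transpose_carrier_mat)
  then show ?thesis by (simp add: alpha_def)
qed

abbreviation "mode_corr t n i l k \<equiv> expectation (\<lambda>\<omega>. mode t n i \<omega> * mode t l k \<omega>)"
abbreviation "sat_corr t j j' \<equiv> expectation (\<lambda>\<omega>. sat_vec P t \<omega> $ j * sat_vec P t \<omega> $ j')"
abbreviation "sat_noise_corr t j j' \<equiv> expectation (\<lambda>\<omega>. sat_vec P t \<omega> $ j * noise_vec P t \<omega> $ j')"
abbreviation "noise_corr t j j' \<equiv> expectation (\<lambda>\<omega>. noise_vec P t \<omega> $ j * noise_vec P t \<omega> $ j')"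

text \<open>
  All blocks of \<open>\<L>\<close> are, up to the factors \<open>calC\<close>, of this form.
\<close>
definition mode_moment :: "nat \<Rightarrow> nat \<Rightarrow> nat \<Rightarrow> real mat" where
  "mode_moment t n l = mat (nu * N) (nu * N)
     (\<lambda>(i, k). alpha P $$ (i, k) * mode_corr t n i l k)"

lemma mode_moment_carrier [simp]: "mode_moment t n l \<in> carrier_mat (nu * N) (nu * N)"
  by (simp add: mode_moment_def)

lemma mean_sq_sandwich:
  "mean_sq P (\<lambda>\<omega>. (diag_of (nu * N) (\<lambda>i. mode t n i \<omega>))\<^sup>T * alpha P * diag_of (nu * N) (\<lambda>i. mode t l i \<omega>)) =
    mode_moment t n l"
proof (rule eq_matI)
  fix i k assume "i < dim_row (mode_moment t n l)" "k < dim_col (mode_moment t n l)"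
  then have ik: "i < nu * N" "k < nu * N" by (auto simp: mode_moment_def)
  have "expectation (\<lambda>\<omega>. mode t n i \<omega> * alpha P $$ (i, k) * mode t l k \<omega>) =
      alpha P $$ (i, k) * mode_corr t n i l k"
    unfolding integral_mult_right_zero[symmetric] by (simp only: mult_ac)
  then show "mean_sq P (\<lambda>\<omega>. (diag_of (nu * N) (\<lambda>i. mode t n i \<omega>))\<^sup>T * alpha P * diag_of (nu * N) (\<lambda>i. mode t l i \<omega>)) $$ (i, k) =
      mode_moment t n l $$ (i, k)"
    using ik by (simp add: mean_sq_def mean_mat_def mode_moment_def diag_of_sandwich_index)
qed (simp_all add: mean_sq_def mean_mat_def mode_moment_def)

lemma Sigma_S_eq: "Sigma_S P t = mode_moment t 0 0"
  unfolding Sigma_S_def calS_eq mean_sq_sandwich ..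

lemma mean_sq_diag:
  "mean_sq P (\<lambda>\<omega>. diag_of (nu * N) (\<lambda>i. mode t l i \<omega>)) = diag_of (nu * N) (\<lambda>i. expectation (mode t l i))"
  by (rule eq_matI) (auto simp: mean_sq_def mean_mat_def diag_of_def)

lemma mu_S_eq: "mu_S P t = diag_of (nu * N) (\<lambda>i. expectation (mode t 0 i))"
  unfolding mu_S_def calS_eq[abs_def] mean_sq_diag ..

lemma calC_carrier: "l < N \<Longrightarrow> calC P l \<in> carrier_mat (nu * N) (nu * (N - l))"
proof -
  assume "l < N"
  then have "nu * l + nu * (N - l) = nu * N" by (simp flip: distrib_left)
  then show ?thesis
    using carrier_append_rows[of "0\<^sub>m (nu * l) (nu * (N - l))" "nu * l" "nu * (N - l)" "1\<^sub>m (nu * (N - l))" "nu * (N - l)"]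
    by (simp add: calC_def Let_def)
qed

lemma calC_mult_vec:
  assumes l: "l < N" and v: "v \<in> carrier_vec (nu * (N - l))"
  shows "calC P l *\<^sub>v v = 0\<^sub>v (nu * l) @\<^sub>v v"
  unfolding calC_def Let_def using v
  by (subst mat_mult_append[OF zero_carrier_mat one_carrier_mat v]) auto

text \<open>
  The matrix \<open>calC\<close> pads with zeros on top and its transpose removes the top, so on vectors that
  vanish on top the product is the identity. The columns of \<open>\<Lambda>\<close> are of this kind by strict block
  triangularity.
\<close>
lemma calC_projection:
  assumes l: "l < N" and v: "v \<in> carrier_vec (nu * N)" and z: "\<And>i. i < nu * l \<Longrightarrow> v $ i = 0"
  shows "calC P l *\<^sub>v ((calC P l)\<^sup>T *\<^sub>v v) = v"
proof -
  have split: "nu * N = nu * l + nu * (N - l)" using l by (simp flip: distrib_left)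
  define w where "w = vec_last v (nu * (N - l))"
  have w: "w \<in> carrier_vec (nu * (N - l))" by (simp add: w_def)
  have "vec_first v (nu * l) = 0\<^sub>v (nu * l)"
    using z by (intro eq_vecI) (auto simp: vec_first_def)
  then have vw: "v = 0\<^sub>v (nu * l) @\<^sub>v w"
    using vec_first_last_append[of v "nu * l" "nu * (N - l)"] v split by (simp add: w_def)
  have CT: "(calC P l)\<^sup>T *\<^sub>v v \<in> carrier_vec (nu * (N - l))"
    using calC_carrier[OF l] by (intro carrier_vecI) auto
  have "(calC P l)\<^sup>T *\<^sub>v v = w"
  proof (rule eq_vecI)
    fix j assume "j < dim_vec w"
    then have j: "j < nu * (N - l)" using w by simp
    let ?e = "unit_vec (nu * (N - l)) j :: real vec"
    have e: "?e \<in> carrier_vec (nu * (N - l))" by simp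
    have "((calC P l)\<^sup>T *\<^sub>v v) \<bullet> ?e = v \<bullet> (0\<^sub>v (nu * l) @\<^sub>v ?e)"
      using transpose_vec_mult_scalar[OF calC_carrier[OF l] e v] calC_mult_vec[OF l e] by simp
    also have "\<dots> = w \<bullet> ?e"
      unfolding vw by (subst scalar_prod_append[OF zero_carrier_vec w zero_carrier_vec e]) simp
    finally show "((calC P l)\<^sup>T *\<^sub>v v) $ j = w $ j"
      using CT w j by (simp add: scalar_prod_right_unit)
  qed (use CT w carrier_matD(2)[OF calC_carrier[OF l]] in simp)
  then show ?thesis using calC_mult_vec[OF l w] vw by simp
qed

lemma mode_coeff_projection:
  assumes F: "(\<eta>, \<Theta>, \<Lambda>) \<in> policy_class P" and l: "1 \<le> l" "l < N"
  shows "calC P l *\<^sub>v ((calC P l)\<^sup>T *\<^sub>v col \<Lambda> (l - 1)) = vec (nu * N) (mode_coeff (\<eta>, \<Theta>, \<Lambda>) l)"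
proof -
  have \<Lambda>: "\<Lambda> \<in> carrier_mat (nu * N) (N - 1)" using F by (simp add: policy_class_iff)
  have "col \<Lambda> (l - 1) = vec (nu * N) (mode_coeff (\<eta>, \<Theta>, \<Lambda>) l)"
    using l \<Lambda> by (intro eq_vecI) auto
  moreover have "vec (nu * N) (mode_coeff (\<eta>, \<Theta>, \<Lambda>) l) $ i = 0" if "i < nu * l" for i
  proof -
    have "nu * l \<le> nu * N" using l by (intro mult_le_mono2) simp
    with that have "i < nu * N" by linarith
    moreover have "\<not> l - 1 < i div nu"
      using that l less_mult_imp_div_less[of i l nu] by (simp add: mult.commute)
    moreover have "l - 1 < N - 1" using l by auto
    ultimately show ?thesis using F l unfolding policy_class_iff by simp
  qed
  ultimately show ?thesis using calC_projection[OF l(2)] by simp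
qed

lemma scalar_prod_mode_moment:
  "vec (nu * N) a \<bullet> (mode_moment t n l *\<^sub>v vec (nu * N) b) =
    (\<Sum>i<nu * N. \<Sum>k<nu * N. alpha P $$ (i, k) * (a i * b k * mode_corr t n i l k))"
  by (subst scalar_prod_mult_mat_vec[OF mode_moment_carrier])
    (auto simp: mode_moment_def mult_ac intro!: sum.cong)

lemma calB_T_carrier: "(calB P)\<^sup>T \<in> carrier_mat (nu * N) (nx * (N + 1))"
  by simp

lemma calQ_sym: "(calQ P)\<^sup>T = calQ P"
  using calQ_psd by (simp add: sym_psd_def)

lemma alpha_sym: "(alpha P)\<^sup>T = alpha P"
proof -
  have QB: "calQ P * calB P \<in> carrier_mat (nx * (N + 1)) (nu * N)"
    by (rule mult_carrier_mat[OF calQ_carrier calB_carrier])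
  have assoc: "(calB P)\<^sup>T * calQ P * calB P = (calB P)\<^sup>T * (calQ P * calB P)"
    by (rule assoc_mult_mat[OF calB_T_carrier calQ_carrier calB_carrier])
  have "((calB P)\<^sup>T * (calQ P * calB P))\<^sup>T = (calB P)\<^sup>T * calQ P * calB P"
    unfolding transpose_mult[OF calB_T_carrier QB] transpose_mult[OF calQ_carrier calB_carrier] calQ_sym
    by simp
  then have *: "((calB P)\<^sup>T * calQ P * calB P)\<^sup>T = (calB P)\<^sup>T * calQ P * calB P"
    unfolding assoc by (simp add: assoc[symmetric])
  have c: "(calB P)\<^sup>T * calQ P * calB P \<in> carrier_mat (nu * N) (nu * N)"
    unfolding assoc by (rule mult_carrier_mat[OF calB_T_carrier QB])
  show ?thesis
    unfolding alpha_def transpose_add[OF c calR_carrier] * using calR_psd by (simp add: sym_psd_def)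
qed

lemma alpha_sym_index: "i < nu * N \<Longrightarrow> k < nu * N \<Longrightarrow> alpha P $$ (k, i) = alpha P $$ (i, k)"
  using alpha_sym carrier_matD[OF alpha_carrier] index_transpose_mat(1)[of i "alpha P" k] by metis

text \<open>
  The part of \<open>\<Xi>\<close> below \<open>\<eta>\<close>.
\<close>
definition tail_part :: "real mat \<Rightarrow> real vec" where
  "tail_part \<Lambda> = vconcat (\<lambda>l. (calC P l)\<^sup>T *\<^sub>v col \<Lambda> (l - 1)) [1..<N]"

lemma tail_carriers:
  assumes "l \<in> set [1..<N]"
  shows "(calC P l)\<^sup>T *\<^sub>v v \<in> carrier_vec (nu * (N - l))"
    "(calC P l)\<^sup>T \<in> carrier_mat (nu * (N - l)) (nu * N)"
    "M \<in> carrier_mat (nu * N) (nu * N) \<Longrightarrow> M * calC P l \<in> carrier_mat (nu * N) (nu * (N - l))"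
  using calC_carrier[of l] assms by (auto intro!: carrier_vecI mult_carrier_mat)

text \<open>
  Moving the factors \<open>calC\<close> to the vectors restores the full columns of \<open>\<Lambda>\<close>. Symmetry of \<open>alpha\<close>
  makes the two off-diagonal blocks contribute equally, so the block form is the double sum over all
  coefficients.
\<close>
lemma calL_quadratic:
  assumes F: "(\<eta>, \<Theta>, \<Lambda>) \<in> policy_class P"
  defines "A \<equiv> mode_coeff (\<eta>, \<Theta>, \<Lambda>)"
  shows "Xi P (\<eta>, \<Theta>, \<Lambda>) \<bullet> (calL P t *\<^sub>v Xi P (\<eta>, \<Theta>, \<Lambda>)) =
    (\<Sum>n<N. \<Sum>l<N. \<Sum>i<nu * N. \<Sum>k<nu * N. alpha P $$ (i, k) *
       (A n i * A l k * mode_corr t n i l k))"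
proof -
  let ?k = "sum_list (map (\<lambda>l. nu * (N - l)) [1..<N])"
  let ?c = "\<lambda>l. vec (nu * N) (A l)"
  let ?T = "\<lambda>n l. ?c n \<bullet> (mode_moment t n l *\<^sub>v ?c l)"
  let ?f = "\<lambda>l. (calC P l)\<^sup>T *\<^sub>v col \<Lambda> (l - 1)"
  have \<eta>: "\<eta> = ?c 0" using F by (auto simp: policy_class_iff A_def)
  have proj: "calC P l *\<^sub>v ?f l = ?c l" if "l \<in> set [1..<N]" for l
    using mode_coeff_projection[OF F] that by (simp add: A_def)
  have f: "?f l \<in> carrier_vec (nu * (N - l))" if "l \<in> set [1..<N]" for l
    using tail_carriers(1)[OF that] .
  have step: "M * calC P l *\<^sub>v ?f l = M *\<^sub>v ?c l"
    if "l \<in> set [1..<N]" "M \<in> carrier_mat (nu * N) (nu * N)" for M l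
    using assoc_mult_mat_vec[OF that(2) calC_carrier f] that(1) proj[OF that(1)] by simp
  have SSl: "Sigma_SSl P t = hcat (nu * N) (map (\<lambda>l. mode_moment t 0 l * calC P l) [1..<N])"
    unfolding Sigma_SSl_def calS_eq
    by (intro arg_cong[where f = "hcat _"] map_cong refl) (simp add: calS_l_eq mean_sq_sandwich)
  have Snl: "Sigma_Snl P t = vcat ?k (map (\<lambda>n. hcat (nu * (N - n))
      (map (\<lambda>l. (calC P n)\<^sup>T * mode_moment t n l * calC P l) [1..<N])) [1..<N])"
    unfolding Sigma_Snl_def sum_list_upt_from_1
    by (intro arg_cong[where f = "vcat _"] map_cong refl arg_cong[where f = "hcat _"])
      (simp add: calS_l_eq mean_sq_sandwich)
  have SSl_c: "Sigma_SSl P t \<in> carrier_mat (nu * N) ?k"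
    unfolding SSl by (intro hcat_carrier tail_carriers mode_moment_carrier)
  have row_c: "(calC P n)\<^sup>T * mode_moment t n l * calC P l \<in> carrier_mat (nu * (N - n)) (nu * (N - l))"
    if "n \<in> set [1..<N]" "l \<in> set [1..<N]" for n l
    using calC_carrier[of n] calC_carrier[of l] that by (auto intro!: mult_carrier_mat[of _ _ "nu * N"])
  have rows_c: "hcat (nu * (N - n)) (map (\<lambda>l. (calC P n)\<^sup>T * mode_moment t n l * calC P l) [1..<N])
      \<in> carrier_mat (nu * (N - n)) ?k" if "n \<in> set [1..<N]" for n
    by (intro hcat_carrier row_c that)
  have Snl_c: "Sigma_Snl P t \<in> carrier_mat ?k ?k"
    unfolding Snl by (intro vcat_carrier rows_c)
  have tail_c: "tail_part \<Lambda> \<in> carrier_vec ?k"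
    unfolding tail_part_def by (intro vconcat_carrier f)
  have cross: "?c 0 \<bullet> (Sigma_SSl P t *\<^sub>v tail_part \<Lambda>) = (\<Sum>l=1..<N. ?T 0 l)"
  proof -
    have "?c 0 \<bullet> (Sigma_SSl P t *\<^sub>v tail_part \<Lambda>) =
        (\<Sum>l\<leftarrow>[1..<N]. ?c 0 \<bullet> (mode_moment t 0 l * calC P l *\<^sub>v ?f l))"
      unfolding SSl tail_part_def
      by (rule scalar_prod_hcat_mult) (use f tail_carriers(3) in auto)
    also have "\<dots> = (\<Sum>l\<leftarrow>[1..<N]. ?T 0 l)"
      by (intro arg_cong[where f = sum_list] map_cong refl) (simp only: step mode_moment_carrier)
    finally show ?thesis by (simp only: sum_list_upt_from_1)
  qed
  have low: "tail_part \<Lambda> \<bullet> (Sigma_Snl P t *\<^sub>v tail_part \<Lambda>) = (\<Sum>n=1..<N. \<Sum>l=1..<N. ?T n l)"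
  proof -
    have eq: "vcat ?k (map (\<lambda>n. hcat (nu * (N - n))
        (map (\<lambda>l. (calC P n)\<^sup>T * mode_moment t n l * calC P l) [1..<N])) [1..<N]) *\<^sub>v tail_part \<Lambda> =
      vconcat (\<lambda>n. hcat (nu * (N - n))
        (map (\<lambda>l. (calC P n)\<^sup>T * mode_moment t n l * calC P l) [1..<N]) *\<^sub>v tail_part \<Lambda>) [1..<N]"
      by (rule vcat_mult_vec[OF rows_c tail_c])
    have "tail_part \<Lambda> \<bullet> (Sigma_Snl P t *\<^sub>v tail_part \<Lambda>) = (\<Sum>n\<leftarrow>[1..<N]. ?f n \<bullet>
        (hcat (nu * (N - n)) (map (\<lambda>l. (calC P n)\<^sup>T * mode_moment t n l * calC P l) [1..<N]) *\<^sub>v tail_part \<Lambda>))"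
      unfolding Snl eq
      by (subst (1) tail_part_def, rule vconcat_scalar_prod[OF f mult_mat_vec_carrier[OF rows_c tail_c]])
    also have "\<dots> = (\<Sum>n\<leftarrow>[1..<N]. \<Sum>l\<leftarrow>[1..<N]. ?f n \<bullet> ((calC P n)\<^sup>T * mode_moment t n l * calC P l *\<^sub>v ?f l))"
    proof (intro arg_cong[where f = sum_list] map_cong refl)
      fix n assume n: "n \<in> set [1..<N]"
      show "?f n \<bullet> (hcat (nu * (N - n)) (map (\<lambda>l. (calC P n)\<^sup>T * mode_moment t n l * calC P l) [1..<N]) *\<^sub>v
          tail_part \<Lambda>) = (\<Sum>l\<leftarrow>[1..<N]. ?f n \<bullet> ((calC P n)\<^sup>T * mode_moment t n l * calC P l *\<^sub>v ?f l))"
        unfolding tail_part_def by (rule scalar_prod_hcat_mult[OF row_c[OF n] f f[OF n]])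
    qed
    also have "\<dots> = (\<Sum>n\<leftarrow>[1..<N]. \<Sum>l\<leftarrow>[1..<N]. ?T n l)"
    proof (intro arg_cong[where f = sum_list] map_cong refl)
      fix n l assume n: "n \<in> set [1..<N]" and l: "l \<in> set [1..<N]"
      let ?M = "mode_moment t n l"
      have C: "calC P n \<in> carrier_mat (nu * N) (nu * (N - n))" using n by (intro calC_carrier) simp
      have Cl: "calC P l \<in> carrier_mat (nu * N) (nu * (N - l))" using l by (intro calC_carrier) simp
      have Mc: "?M *\<^sub>v ?c l \<in> carrier_vec (nu * N)" by (rule mult_mat_vec_carrier[OF mode_moment_carrier]) simp
      have "(calC P n)\<^sup>T * ?M * calC P l *\<^sub>v ?f l = (calC P n)\<^sup>T * ?M *\<^sub>v ?c l"
        by (subst assoc_mult_mat_vec[OF mult_carrier_mat[OF tail_carriers(2)[OF n] mode_moment_carrier] Cl f[OF l]])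
          (simp only: proj[OF l])
      also have "\<dots> = (calC P n)\<^sup>T *\<^sub>v (?M *\<^sub>v ?c l)"
        by (rule assoc_mult_mat_vec[OF tail_carriers(2)[OF n] mode_moment_carrier]) simp
      finally have "?f n \<bullet> ((calC P n)\<^sup>T * ?M * calC P l *\<^sub>v ?f l) =
          ((calC P n)\<^sup>T *\<^sub>v (?M *\<^sub>v ?c l)) \<bullet> ?f n"
        using comm_scalar_prod[OF f[OF n] tail_carriers(1)[OF n]] by simp
      also have "\<dots> = (?M *\<^sub>v ?c l) \<bullet> (calC P n *\<^sub>v ?f n)"
        by (rule transpose_vec_mult_scalar[OF C f[OF n] Mc])
      also have "\<dots> = ?T n l"
        unfolding proj[OF n] by (rule comm_scalar_prod[OF Mc]) simp
      finally show "?f n \<bullet> ((calC P n)\<^sup>T * ?M * calC P l *\<^sub>v ?f l) = ?T n l" .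
    qed
    finally show ?thesis by (simp only: sum_list_upt_from_1)
  qed
  have sym: "?T n 0 = ?T 0 n" for n
  proof -
    have "?T n 0 = (\<Sum>i<nu * N. \<Sum>k<nu * N. alpha P $$ (k, i) *
        (A 0 i * A n k * mode_corr t n k 0 i))"
      unfolding scalar_prod_mode_moment by (subst sum.swap) (simp add: mult_ac)
    also have "\<dots> = ?T 0 n"
      unfolding scalar_prod_mode_moment
      by (intro sum.cong refl) (simp add: alpha_sym_index mult.commute)
    finally show ?thesis .
  qed
  note split = sum_lessThan_split_first[OF N_pos]
  have "Xi P (\<eta>, \<Theta>, \<Lambda>) = ?c 0 @\<^sub>v tail_part \<Lambda>"
    using \<eta> by (simp add: Xi.simps tail_part_def)
  then have "Xi P (\<eta>, \<Theta>, \<Lambda>) \<bullet> (calL P t *\<^sub>v Xi P (\<eta>, \<Theta>, \<Lambda>)) =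
      ?T 0 0 + 2 * (\<Sum>l=1..<N. ?T 0 l) + (\<Sum>n=1..<N. \<Sum>l=1..<N. ?T n l)"
    unfolding calL_def
    using scalar_prod_four_block[OF _ SSl_c Snl_c _ tail_c, of "Sigma_S P t" "?c 0"] cross low
    by (simp add: Sigma_S_eq)
  also have "\<dots> = (\<Sum>n<N. \<Sum>l<N. ?T n l)"
  proof -
    have "(\<Sum>n=1..<N. ?T n 0) = (\<Sum>n=1..<N. ?T 0 n)" by (intro sum.cong refl sym)
    then show ?thesis by (simp only: split sum.distrib)
  qed
  finally show ?thesis by (simp only: scalar_prod_mode_moment)
qed

lemma calM_linear:
  assumes F: "(\<eta>, \<Theta>, \<Lambda>) \<in> policy_class P" and p: "p \<in> carrier_vec (nx * (N + 1))"
  defines "A \<equiv> mode_coeff (\<eta>, \<Theta>, \<Lambda>)"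
  shows "(calM P t *\<^sub>v p) \<bullet> Xi P (\<eta>, \<Theta>, \<Lambda>) =
    2 * (\<Sum>i<nu * N. ((calQ P * calB P)\<^sup>T *\<^sub>v p) $ i * (\<Sum>l<N. A l i * expectation (mode t l i)))"
proof -
  let ?k = "sum_list (map (\<lambda>l. nu * (N - l)) [1..<N])"
  let ?c = "\<lambda>l. vec (nu * N) (A l)"
  let ?f = "\<lambda>l. (calC P l)\<^sup>T *\<^sub>v col \<Lambda> (l - 1)"
  let ?D = "\<lambda>l. diag_of (nu * N) (\<lambda>i. expectation (mode t l i))"
  define W where "W = calQ P * calB P"
  have W: "W \<in> carrier_mat (nx * (N + 1)) (nu * N)"
    unfolding W_def by (rule mult_carrier_mat[OF calQ_carrier calB_carrier])
  define q where "q = W\<^sup>T *\<^sub>v p"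
  have q: "q \<in> carrier_vec (nu * N)"
    unfolding q_def using W p by (intro mult_mat_vec_carrier) auto
  have move: "p \<bullet> (W *\<^sub>v v) = q \<bullet> v" if "v \<in> carrier_vec (nu * N)" for v
    unfolding q_def using transpose_vec_mult_scalar[OF W that p] by simp
  have \<eta>: "\<eta> = ?c 0" using F by (auto simp: policy_class_iff A_def)
  have f: "?f l \<in> carrier_vec (nu * (N - l))" if "l \<in> set [1..<N]" for l
    using tail_carriers(1)[OF that] .
  have mu: "mu_Sl P t = hcat (nu * N) (map (\<lambda>l. ?D l * calC P l) [1..<N])"
    unfolding mu_Sl_def
    by (intro arg_cong[where f = "hcat _"] map_cong refl) (simp add: calS_l_fun mean_sq_diag)
  have mu_c: "mu_Sl P t \<in> carrier_mat (nu * N) ?k"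
    unfolding mu by (intro hcat_carrier tail_carriers diag_of_carrier)
  have tail_c: "tail_part \<Lambda> \<in> carrier_vec ?k"
    unfolding tail_part_def by (intro vconcat_carrier f)
  have q_diag: "q \<bullet> (?D l *\<^sub>v ?c l) = (\<Sum>i<nu * N. q $ i * (A l i * expectation (mode t l i)))" for l
  proof -
    have "dim_vec (?D l *\<^sub>v ?c l) = nu * N" by (simp add: diag_of_def)
    then show ?thesis
      unfolding scalar_prod_def lessThan_atLeast0
      by (intro sum.cong) (simp_all del: index_mult_mat_vec add: diag_of_mult_vec_index mult_ac)
  qed
  have tail: "q \<bullet> (mu_Sl P t *\<^sub>v tail_part \<Lambda>) = (\<Sum>l=1..<N. q \<bullet> (?D l *\<^sub>v ?c l))"
  proof -
    have "q \<bullet> (mu_Sl P t *\<^sub>v tail_part \<Lambda>) = (\<Sum>l\<leftarrow>[1..<N]. q \<bullet> (?D l * calC P l *\<^sub>v ?f l))"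
      unfolding mu tail_part_def
      by (rule scalar_prod_hcat_mult[OF _ f q]) (use tail_carriers(3) in auto)
    also have "\<dots> = (\<Sum>l\<leftarrow>[1..<N]. q \<bullet> (?D l *\<^sub>v ?c l))"
    proof (intro arg_cong[where f = sum_list] map_cong refl)
      fix l assume l: "l \<in> set [1..<N]"
      then have "?D l * calC P l *\<^sub>v ?f l = ?D l *\<^sub>v (calC P l *\<^sub>v ?f l)"
        by (intro assoc_mult_mat_vec[OF diag_of_carrier calC_carrier f]) auto
      also have "calC P l *\<^sub>v ?f l = ?c l"
        using mode_coeff_projection[OF F] l by (simp add: A_def)
      finally show "q \<bullet> (?D l * calC P l *\<^sub>v ?f l) = q \<bullet> (?D l *\<^sub>v ?c l)" by simp
    qed
    finally show ?thesis by (simp only: sum_list_upt_from_1)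
  qed
  note split = sum_lessThan_split_first[OF N_pos]
  have Xi: "Xi P (\<eta>, \<Theta>, \<Lambda>) = ?c 0 @\<^sub>v tail_part \<Lambda>"
    using \<eta> by (simp add: Xi.simps tail_part_def)
  have c0: "?c 0 \<in> carrier_vec (nu * N)" by simp
  have WD: "W * mu_S P t \<in> carrier_mat (nx * (N + 1)) (nu * N)"
    unfolding mu_S_eq by (rule mult_carrier_mat[OF W diag_of_carrier])
  have Wm: "W * mu_Sl P t \<in> carrier_mat (nx * (N + 1)) ?k"
    by (rule mult_carrier_mat[OF W mu_c])
  let ?b = "beside (W * mu_S P t) (W * mu_Sl P t)"
  have b: "?b \<in> carrier_mat (nx * (N + 1)) (nu * N + ?k)" by (rule beside_carrier[OF WD Wm])
  have X_c: "?c 0 @\<^sub>v tail_part \<Lambda> \<in> carrier_vec (nu * N + ?k)" using tail_c by simp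
  have bp: "?b\<^sup>T *\<^sub>v p \<in> carrier_vec (nu * N + ?k)" using b p by (intro mult_mat_vec_carrier) auto
  have D0: "?D 0 *\<^sub>v ?c 0 \<in> carrier_vec (nu * N)" "mu_Sl P t *\<^sub>v tail_part \<Lambda> \<in> carrier_vec (nu * N)"
    using mult_mat_vec_carrier[OF diag_of_carrier c0] mult_mat_vec_carrier[OF mu_c tail_c] by auto
  have "calM P t *\<^sub>v p = 2 \<cdot>\<^sub>v (?b\<^sup>T *\<^sub>v p)"
    unfolding calM_def W_def[symmetric]
    using b p by (intro eq_vecI) (simp_all add: scalar_prod_def sum_distrib_left mult.assoc)
  then have "(calM P t *\<^sub>v p) \<bullet> (?c 0 @\<^sub>v tail_part \<Lambda>) = 2 * ((?b\<^sup>T *\<^sub>v p) \<bullet> (?c 0 @\<^sub>v tail_part \<Lambda>))"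
    using smult_scalar_prod_distrib[OF bp X_c] by simp
  also have "(?b\<^sup>T *\<^sub>v p) \<bullet> (?c 0 @\<^sub>v tail_part \<Lambda>) = p \<bullet> (?b *\<^sub>v (?c 0 @\<^sub>v tail_part \<Lambda>))"
    by (rule transpose_vec_mult_scalar[OF b X_c p])
  also have "?b *\<^sub>v (?c 0 @\<^sub>v tail_part \<Lambda>) = W *\<^sub>v (?D 0 *\<^sub>v ?c 0) + W *\<^sub>v (mu_Sl P t *\<^sub>v tail_part \<Lambda>)"
    unfolding beside_mult_vec[OF WD Wm c0 tail_c] assoc_mult_mat_vec[OF W mu_c tail_c]
    unfolding mu_S_eq assoc_mult_mat_vec[OF W diag_of_carrier c0] ..
  also have "p \<bullet> \<dots> = q \<bullet> (?D 0 *\<^sub>v ?c 0) + q \<bullet> (mu_Sl P t *\<^sub>v tail_part \<Lambda>)"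
    using mult_mat_vec_carrier[OF W D0(1)] mult_mat_vec_carrier[OF W D0(2)] p
    by (simp add: scalar_prod_add_distrib[of _ "nx * (N + 1)"] move[OF D0(1)] move[OF D0(2)])
  also have "\<dots> = (\<Sum>l<N. q \<bullet> (?D l *\<^sub>v ?c l))"
    by (simp only: split tail)
  also have "\<dots> = (\<Sum>i<nu * N. q $ i * (\<Sum>l<N. A l i * expectation (mode t l i)))"
    unfolding q_diag sum_distrib_left by (rule sum.swap)
  finally show ?thesis unfolding Xi q_def W_def .
qed

end

section \<open>Moments of the plant input and the expected cost\<close>

lemma transpose_sandwich_index:
  fixes A M B :: "real mat"
  assumes A: "A \<in> carrier_mat r k" and M: "M \<in> carrier_mat r r" and B: "B \<in> carrier_mat r l"
    and "i < k" "j < l"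
  shows "(A\<^sup>T * M * B) $$ (i, j) = (\<Sum>a<r. \<Sum>b<r. A $$ (a, i) * M $$ (a, b) * B $$ (b, j))"
proof -
  have AT: "A\<^sup>T \<in> carrier_mat k r" using A by simp
  have "(A\<^sup>T * M * B) $$ (i, j) = (\<Sum>b<r. (\<Sum>a<r. A\<^sup>T $$ (i, a) * M $$ (a, b)) * B $$ (b, j))"
    using assms by (simp only: mult_mat_index[OF mult_carrier_mat[OF AT M] B] mult_mat_index[OF AT M] cong: sum.cong)
      (auto intro!: sum.cong simp: mult_mat_index[OF AT M] simp del: index_mult_mat)
  also have "\<dots> = (\<Sum>b<r. \<Sum>a<r. A $$ (a, i) * M $$ (a, b) * B $$ (b, j))"
    unfolding sum_distrib_right using A assms(4) by (intro sum.cong refl) auto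
  also have "\<dots> = (\<Sum>a<r. \<Sum>b<r. A $$ (a, i) * M $$ (a, b) * B $$ (b, j))" by (rule sum.swap)
  finally show ?thesis .
qed

lemma sum_lessThan_add: "(\<Sum>j<a + b. f j) = (\<Sum>j<a. f j) + (\<Sum>j<b. f (a + j))" for f :: "nat \<Rightarrow> real"
  by (induction b) (auto simp: add.assoc)

context networked_control
begin

abbreviation "BQD \<equiv> (calB P)\<^sup>T * calQ P * calD P"
abbreviation "DQD \<equiv> (calD P)\<^sup>T * calQ P * calD P"

lemma QB_carrier: "calQ P * calB P \<in> carrier_mat (nx * (N + 1)) (nu * N)"
  by (rule mult_carrier_mat[OF calQ_carrier calB_carrier])

lemma QD_carrier: "calQ P * calD P \<in> carrier_mat (nx * (N + 1)) (nx * N)"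
  by (rule mult_carrier_mat[OF calQ_carrier calD_carrier])

lemma calD_T_carrier: "(calD P)\<^sup>T \<in> carrier_mat (nx * N) (nx * (N + 1))"
  by simp

lemma BQD_carrier: "BQD \<in> carrier_mat (nu * N) (nx * N)"
  by (rule mult_carrier_mat[OF mult_carrier_mat[OF calB_T_carrier calQ_carrier] calD_carrier])

lemma DQD_carrier: "DQD \<in> carrier_mat (nx * N) (nx * N)"
  by (rule mult_carrier_mat[OF mult_carrier_mat[OF calD_T_carrier calQ_carrier] calD_carrier])

lemma Q_form:
  assumes X: "X \<in> carrier_mat (nx * (N + 1)) k" and Y: "Y \<in> carrier_mat (nx * (N + 1)) l"
    and v: "v \<in> carrier_vec k" and w: "w \<in> carrier_vec l"
  shows "(X *\<^sub>v v) \<bullet> (calQ P *\<^sub>v (Y *\<^sub>v w)) = v \<bullet> ((X\<^sup>T * calQ P * Y) *\<^sub>v w)"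
proof -
  have XT: "X\<^sup>T \<in> carrier_mat k (nx * (N + 1))" using X by simp
  have Xv: "X *\<^sub>v v \<in> carrier_vec (nx * (N + 1))" and Yw: "Y *\<^sub>v w \<in> carrier_vec (nx * (N + 1))"
    using mult_mat_vec_carrier[OF X v] mult_mat_vec_carrier[OF Y w] by auto
  have z: "calQ P *\<^sub>v (Y *\<^sub>v w) \<in> carrier_vec (nx * (N + 1))" (is "?z \<in> _")
    by (rule mult_mat_vec_carrier[OF calQ_carrier Yw])
  have "(X *\<^sub>v v) \<bullet> ?z = ?z \<bullet> (X *\<^sub>v v)" by (rule comm_scalar_prod[OF Xv z])
  also have "\<dots> = (X\<^sup>T *\<^sub>v ?z) \<bullet> v" by (rule transpose_vec_mult_scalar[OF X v z, symmetric])
  also have "\<dots> = v \<bullet> (X\<^sup>T *\<^sub>v ?z)" by (rule comm_scalar_prod[OF mult_mat_vec_carrier[OF XT z] v])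
  also have "X\<^sup>T *\<^sub>v ?z = (X\<^sup>T * calQ P * Y) *\<^sub>v w"
    unfolding assoc_mult_mat_vec[OF mult_carrier_mat[OF XT calQ_carrier] Y w]
      assoc_mult_mat_vec[OF XT calQ_carrier Yw] ..
  finally show ?thesis .
qed

lemma calQ_form_sym:
  assumes v: "v \<in> carrier_vec (nx * (N + 1))" and w: "w \<in> carrier_vec (nx * (N + 1))"
  shows "w \<bullet> (calQ P *\<^sub>v v) = v \<bullet> (calQ P *\<^sub>v w)"
proof -
  have "w \<bullet> (calQ P *\<^sub>v v) = (calQ P *\<^sub>v w) \<bullet> v"
    using transpose_vec_mult_scalar[OF calQ_carrier v w] by (simp add: calQ_sym)
  also have "\<dots> = v \<bullet> (calQ P *\<^sub>v w)"
    by (rule comm_scalar_prod[OF mult_mat_vec_carrier[OF calQ_carrier w] v])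
  finally show ?thesis .
qed

text \<open>
  Expand the square around the uncontrolled response \<open>p\<close> to the state; the input and
  the noise enter through \<open>calB\<close> and \<open>calD\<close>.
\<close>
lemma cost_expand:
  assumes y: "y \<in> carrier_vec nx"
  defines "p \<equiv> calA P *\<^sub>v y" and "q \<equiv> (calQ P * calB P)\<^sup>T *\<^sub>v (calA P *\<^sub>v y)"
    and "r \<equiv> (calQ P * calD P)\<^sup>T *\<^sub>v (calA P *\<^sub>v y)"
  shows "cost P t y F \<omega> = p \<bullet> (calQ P *\<^sub>v p) +
    2 * (\<Sum>i<nu * N. q $ i * plant_input P t F \<omega> $ i) + 2 * (\<Sum>j<nx * N. r $ j * noise_vec P t \<omega> $ j) +
    (\<Sum>i<nu * N. \<Sum>k<nu * N. alpha P $$ (i, k) * (plant_input P t F \<omega> $ i * plant_input P t F \<omega> $ k)) +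
    2 * (\<Sum>i<nu * N. \<Sum>j<nx * N. BQD $$ (i, j) * (plant_input P t F \<omega> $ i * noise_vec P t \<omega> $ j)) +
    (\<Sum>i<nx * N. \<Sum>j<nx * N. DQD $$ (i, j) * (noise_vec P t \<omega> $ i * noise_vec P t \<omega> $ j))"
proof -
  let ?n = "nx * (N + 1)"
  define u w where "u = plant_input P t F \<omega>" and "w = noise_vec P t \<omega>"
  have u: "u \<in> carrier_vec (nu * N)" and w: "w \<in> carrier_vec (nx * N)"
    by (simp_all add: u_def w_def plant_input_carrier noise_vec_carrier)
  define b c where "b = calB P *\<^sub>v u" and "c = calD P *\<^sub>v w"
  have p: "p \<in> carrier_vec ?n" unfolding p_def by (rule mult_mat_vec_carrier[OF calA_carrier y])
  have b: "b \<in> carrier_vec ?n" unfolding b_def by (rule mult_mat_vec_carrier[OF calB_carrier u])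
  have c: "c \<in> carrier_vec ?n" unfolding c_def by (rule mult_mat_vec_carrier[OF calD_carrier w])
  note Qc = mult_mat_vec_carrier[OF calQ_carrier]
  let ?Q = "\<lambda>v z. v \<bullet> (calQ P *\<^sub>v z)"
  have add1: "?Q (v + z) x = ?Q v x + ?Q z x" if "v \<in> carrier_vec ?n" "z \<in> carrier_vec ?n" "x \<in> carrier_vec ?n" for v z x
    by (rule add_scalar_prod_distrib[OF that(1,2) Qc[OF that(3)]])
  have add2: "?Q x (v + z) = ?Q x v + ?Q x z" if "v \<in> carrier_vec ?n" "z \<in> carrier_vec ?n" "x \<in> carrier_vec ?n" for v z x
    using mult_add_distrib_mat_vec[OF calQ_carrier that(1,2)]
      scalar_prod_add_distrib[OF that(3) Qc[OF that(1)] Qc[OF that(2)]] by simp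
  have pb: "p + b \<in> carrier_vec ?n" using p b by simp
  have "?Q (p + b + c) (p + b + c) = ?Q p p + 2 * ?Q p b + 2 * ?Q p c + ?Q b b + 2 * ?Q b c + ?Q c c"
    using calQ_form_sym[OF p b] calQ_form_sym[OF p c] calQ_form_sym[OF b c]
    by (simp add: add1[OF pb c add_carrier_vec[OF pb c]] add1[OF p b add_carrier_vec[OF pb c]]
        add2[OF pb c p] add2[OF p b p] add2[OF pb c b] add2[OF p b b] add2[OF pb c c] add2[OF p b c])
  moreover have "cost P t y F \<omega> = ?Q (p + b + c) (p + b + c) + u \<bullet> (calR P *\<^sub>v u)"
    by (simp add: cost_def stacked_state_def p_def b_def c_def u_def w_def)
  moreover have "?Q p b = (\<Sum>i<nu * N. q $ i * u $ i)"
  proof -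
    have "?Q p b = p \<bullet> ((calQ P * calB P) *\<^sub>v u)"
      unfolding b_def assoc_mult_mat_vec[OF calQ_carrier calB_carrier u] ..
    also have "\<dots> = q \<bullet> u"
      unfolding q_def p_def[symmetric] by (rule transpose_vec_mult_scalar[OF QB_carrier u p, symmetric])
    finally show ?thesis using u by (simp add: scalar_prod_def lessThan_atLeast0)
  qed
  moreover have "?Q p c = (\<Sum>j<nx * N. r $ j * w $ j)"
  proof -
    have "?Q p c = p \<bullet> ((calQ P * calD P) *\<^sub>v w)"
      unfolding c_def assoc_mult_mat_vec[OF calQ_carrier calD_carrier w] ..
    also have "\<dots> = r \<bullet> w"
      unfolding r_def p_def[symmetric] by (rule transpose_vec_mult_scalar[OF QD_carrier w p, symmetric])
    finally show ?thesis using w by (simp add: scalar_prod_def lessThan_atLeast0)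
  qed
  moreover have "?Q b b + u \<bullet> (calR P *\<^sub>v u) =
      (\<Sum>i<nu * N. \<Sum>k<nu * N. alpha P $$ (i, k) * (u $ i * u $ k))"
  proof -
    have BQB: "(calB P)\<^sup>T * calQ P * calB P \<in> carrier_mat (nu * N) (nu * N)"
      by (rule mult_carrier_mat[OF mult_carrier_mat[OF calB_T_carrier calQ_carrier] calB_carrier])
    have "?Q b b + u \<bullet> (calR P *\<^sub>v u) = u \<bullet> (alpha P *\<^sub>v u)"
      unfolding b_def Q_form[OF calB_carrier calB_carrier u u] alpha_def
        add_mult_distrib_mat_vec[OF BQB calR_carrier u]
      by (rule scalar_prod_add_distrib[OF u mult_mat_vec_carrier[OF BQB u]
            mult_mat_vec_carrier[OF calR_carrier u], symmetric])
    then show ?thesis by (simp add: scalar_prod_mult_mat_vec[OF alpha_carrier u u] mult_ac)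
  qed
  moreover have "?Q b c = (\<Sum>i<nu * N. \<Sum>j<nx * N. BQD $$ (i, j) * (u $ i * w $ j))"
    unfolding b_def c_def Q_form[OF calB_carrier calD_carrier u w] scalar_prod_mult_mat_vec[OF BQD_carrier u w]
    by (intro sum.cong refl) (simp only: mult_ac)
  moreover have "?Q c c = (\<Sum>i<nx * N. \<Sum>j<nx * N. DQD $$ (i, j) * (w $ i * w $ j))"
    unfolding c_def Q_form[OF calD_carrier calD_carrier w w] scalar_prod_mult_mat_vec[OF DQD_carrier w w]
    by (intro sum.cong refl) (simp only: mult_ac)
  ultimately show ?thesis unfolding u_def w_def by linarith
qed

lemma alpha_psd: "sym_psd (nu * N) (alpha P)"
  unfolding sym_psd_def
proof (intro conjI ballI alpha_carrier alpha_sym)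
  fix u :: "real vec" assume u: "u \<in> carrier_vec (nu * N)"
  have BQB: "(calB P)\<^sup>T * calQ P * calB P \<in> carrier_mat (nu * N) (nu * N)"
    by (rule mult_carrier_mat[OF mult_carrier_mat[OF calB_T_carrier calQ_carrier] calB_carrier])
  have "u \<bullet> (alpha P *\<^sub>v u) = (calB P *\<^sub>v u) \<bullet> (calQ P *\<^sub>v (calB P *\<^sub>v u)) + u \<bullet> (calR P *\<^sub>v u)"
    unfolding Q_form[OF calB_carrier calB_carrier u u] alpha_def
      add_mult_distrib_mat_vec[OF BQB calR_carrier u]
    by (rule scalar_prod_add_distrib[OF u mult_mat_vec_carrier[OF BQB u]
          mult_mat_vec_carrier[OF calR_carrier u]])
  also have "0 \<le> \<dots>"
    using calQ_psd calR_psd u mult_mat_vec_carrier[OF calB_carrier u] by (simp add: sym_psd_def)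
  finally show "0 \<le> u \<bullet> (alpha P *\<^sub>v u)" .
qed

text \<open>
  Integrability and value of a mean in one predicate, so that sums of integrals are evaluated by
  introduction rules without separate integrability proofs.
\<close>
abbreviation hbi :: "('w \<Rightarrow> real) \<Rightarrow> real \<Rightarrow> bool" where
  "hbi \<equiv> has_bochner_integral (pspace P)"

lemma hbi_expectation: "integrable (pspace P) f \<Longrightarrow> hbi f (expectation f)"
  by (rule has_bochner_integral_integrable)

lemma hbi_cmult: "hbi f v \<Longrightarrow> hbi (\<lambda>\<omega>. c * f \<omega>) (c * v)"
  by (intro has_bochner_integral_mult_right)

lemma hbi_const: "hbi (\<lambda>_. c) c"
  using hbi_expectation[of "\<lambda>_. c"] prob_space by simp

abbreviation channels :: "(nat + nat) set" where "channels \<equiv> range Inr"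
abbreviation noises :: "(nat + nat) set" where "noises \<equiv> range Inl"

lemma hbi_indep:
  assumes "f \<in> borel_measurable (info channels)" "g \<in> borel_measurable (info noises)"
    "integrable (pspace P) f" "integrable (pspace P) g"
  shows "hbi (\<lambda>\<omega>. f \<omega> * g \<omega>) (expectation f * expectation g)"
proof -
  have "channels \<inter> noises = ({} :: (nat + nat) set)" by auto
  from integrable_indep[OF this assms] integral_indep[OF this assms]
  show ?thesis by (simp add: has_bochner_integral_iff)
qed

lemma mode_measurable: "i < nu * N \<Longrightarrow> mode t n i \<in> borel_measurable (info channels)"
  unfolding mode_def
  by (cases "n = 0") (auto intro!: borel_measurable_times gain_measurable channel_info)

lemma mode_bound: "\<omega> \<in> space (pspace P) \<Longrightarrow> i < nu * N \<Longrightarrow> \<bar>mode t n i \<omega>\<bar> \<le> 1"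
  using gain_channel_range[of \<omega> i t] channel_range[of \<omega> "t + n - 1"] by (auto simp: mode_def)

lemma mode_sq_integrable: "i < nu * N \<Longrightarrow> sq_integrable (mode t n i)"
  by (rule sq_integrable_bounded[OF measurable_info[OF mode_measurable] mode_bound])

lemma sat_vec_info: "j < nx * (N - 1) \<Longrightarrow> (\<lambda>\<omega>. sat_vec P t \<omega> $ j) \<in> borel_measurable (info noises)"
  using sat_vec_measurable[of j t "\<lambda>\<omega>. \<omega>" "info noises"] by (simp add: noise_info)

lemma noise_vec_info: "j < nx * N \<Longrightarrow> (\<lambda>\<omega>. noise_vec P t \<omega> $ j) \<in> borel_measurable (info noises)"
  using noise_info[of "t + j div nx" noises] nx_pos by (simp add: noise_vec_index measurable_vec_borel_iff)

lemma sat_vec_sq_integrable: "j < nx * (N - 1) \<Longrightarrow> sq_integrable (\<lambda>\<omega>. sat_vec P t \<omega> $ j)"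
  by (rule sq_integrable_bounded[OF measurable_info[OF sat_vec_info] sat_vec_bound])

lemma noise_vec_mean: "j < nx * N \<Longrightarrow> expectation (\<lambda>\<omega>. noise_vec P t \<omega> $ j) = 0"
  using nx_pos by (simp add: noise_vec_index noise_mean)

text \<open>
  An odd function changes sign when the noise is reflected, and reflection preserves its distribution.
\<close>
lemma sat_vec_mean:
  assumes j: "j < nx * (N - 1)"
  shows "expectation (\<lambda>\<omega>. sat_vec P t \<omega> $ j) = 0"
proof -
  let ?s = "t + j div nx" and ?c = "j mod nx"
  obtain \<sigma> where \<sigma>: "\<sigma> \<in> borel_measurable borel" "\<And>r. \<sigma> (- r) = - \<sigma> r"
    "\<And>\<omega>. noise P ?s \<omega> \<in> carrier_vec nx \<Longrightarrow> sat_vec P t \<omega> $ j = \<sigma> (noise P ?s \<omega> $ ?c)"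
    using sat_vec_component[OF j] by metis
  have c: "?c < nx" using nx_pos by simp
  let ?h = "\<lambda>v. \<sigma> (v $ ?c)"
  have h: "?h \<in> borel_measurable (vec_borel nx)"
    by (rule measurable_compose[OF measurable_vec_index[OF c] \<sigma>(1)])
  have neg: "(\<lambda>\<omega>. - noise P ?s \<omega>) \<in> pspace P \<rightarrow>\<^sub>M vec_borel nx"
  proof -
    have "(\<lambda>\<omega>. (- noise P ?s \<omega>) $ i) \<in> borel_measurable (pspace P)" if "i < nx" for i
    proof (rule iffD2[OF measurable_cong])
      show "(- noise P ?s \<omega>) $ i = - (noise P ?s \<omega> $ i)" if "\<omega> \<in> space (pspace P)" for \<omega>
        using noise_carrier[OF that, of ?s] \<open>i < nx\<close> by auto
      show "(\<lambda>\<omega>. - (noise P ?s \<omega> $ i)) \<in> borel_measurable (pspace P)"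
        using noise_measurable[of ?s] \<open>i < nx\<close> by (simp add: measurable_vec_borel_iff)
    qed
    then show ?thesis using noise_carrier by (auto simp: measurable_vec_borel_iff)
  qed
  have "expectation (\<lambda>\<omega>. sat_vec P t \<omega> $ j) = expectation (\<lambda>\<omega>. ?h (noise P ?s \<omega>))"
    by (intro Bochner_Integration.integral_cong refl \<sigma>(3) noise_carrier)
  also have "\<dots> = integral\<^sup>L (distr (pspace P) (vec_borel nx) (noise P ?s)) ?h"
    by (rule integral_distr[OF noise_measurable h, symmetric])
  also have "\<dots> = integral\<^sup>L (distr (pspace P) (vec_borel nx) (\<lambda>\<omega>. - noise P ?s \<omega>)) ?h"
    by (simp only: noise_symmetric)
  also have "\<dots> = expectation (\<lambda>\<omega>. ?h (- noise P ?s \<omega>))"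
    by (rule integral_distr[OF neg h])
  also have "\<dots> = expectation (\<lambda>\<omega>. - (sat_vec P t \<omega> $ j))"
  proof (intro Bochner_Integration.integral_cong refl)
    fix \<omega> assume "\<omega> \<in> space (pspace P)"
    then have "noise P ?s \<omega> \<in> carrier_vec nx" by (rule noise_carrier)
    then show "?h (- noise P ?s \<omega>) = - (sat_vec P t \<omega> $ j)"
      using c by (simp add: \<sigma>(2,3))
  qed
  also have "\<dots> = - expectation (\<lambda>\<omega>. sat_vec P t \<omega> $ j)" by simp
  finally show ?thesis by simp
qed

text \<open>
  The cost is a polynomial of degree two in input and noise, hence its mean is determined by the first
  and second moments. The moments are parameters because they are computed in two ways: for the
  entries of the program, and for its convexity.
\<close>
lemma expected_cost:
  assumes y: "y \<in> carrier_vec nx"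
    and m1: "\<And>i. i < nu * N \<Longrightarrow> hbi (\<lambda>\<omega>. plant_input P t F \<omega> $ i) (m1 i)"
    and m2: "\<And>i k. i < nu * N \<Longrightarrow> k < nu * N \<Longrightarrow> hbi (\<lambda>\<omega>. plant_input P t F \<omega> $ i * plant_input P t F \<omega> $ k) (m2 i k)"
    and m3: "\<And>i j. i < nu * N \<Longrightarrow> j < nx * N \<Longrightarrow> hbi (\<lambda>\<omega>. plant_input P t F \<omega> $ i * noise_vec P t \<omega> $ j) (m3 i j)"
  shows "expectation (cost P t y F) = (calA P *\<^sub>v y) \<bullet> (calQ P *\<^sub>v (calA P *\<^sub>v y)) +
    2 * (\<Sum>i<nu * N. ((calQ P * calB P)\<^sup>T *\<^sub>v (calA P *\<^sub>v y)) $ i * m1 i) +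
    (\<Sum>i<nu * N. \<Sum>k<nu * N. alpha P $$ (i, k) * m2 i k) +
    2 * (\<Sum>i<nu * N. \<Sum>j<nx * N. BQD $$ (i, j) * m3 i j) +
    (\<Sum>i<nx * N. \<Sum>j<nx * N. DQD $$ (i, j) * noise_corr t i j)"
proof -
  have w: "hbi (\<lambda>\<omega>. noise_vec P t \<omega> $ j) 0" if "j < nx * N" for j
    using hbi_expectation[OF sq_integrable_integrable[OF noise_vec_sq_integrable[OF that]]]
      noise_vec_mean[OF that] by simp
  have ww: "hbi (\<lambda>\<omega>. noise_vec P t \<omega> $ i * noise_vec P t \<omega> $ j)
      (noise_corr t i j)" if "i < nx * N" "j < nx * N" for i j
    by (intro hbi_expectation sq_integrable_mult noise_vec_sq_integrable that)
  have "hbi (cost P t y F) ((calA P *\<^sub>v y) \<bullet> (calQ P *\<^sub>v (calA P *\<^sub>v y)) +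
    2 * (\<Sum>i<nu * N. ((calQ P * calB P)\<^sup>T *\<^sub>v (calA P *\<^sub>v y)) $ i * m1 i) +
    2 * (\<Sum>j<nx * N. ((calQ P * calD P)\<^sup>T *\<^sub>v (calA P *\<^sub>v y)) $ j * 0) +
    (\<Sum>i<nu * N. \<Sum>k<nu * N. alpha P $$ (i, k) * m2 i k) +
    2 * (\<Sum>i<nu * N. \<Sum>j<nx * N. BQD $$ (i, j) * m3 i j) +
    (\<Sum>i<nx * N. \<Sum>j<nx * N. DQD $$ (i, j) * noise_corr t i j))"
    unfolding cost_expand[OF y, abs_def]
    by (intro has_bochner_integral_add has_bochner_integral_sum hbi_cmult hbi_const m1 m2 m3 w ww) auto
  then show ?thesis by (simp add: has_bochner_integral_iff)
qed

lemma plant_input_modes: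
  assumes F: "(\<eta>, \<Theta>, \<Lambda>) \<in> policy_class P" and i: "i < nu * N"
  shows "plant_input P t (\<eta>, \<Theta>, \<Lambda>) \<omega> $ i = (\<Sum>n<N. mode_coeff (\<eta>, \<Theta>, \<Lambda>) n i * mode t n i \<omega>) +
    (\<Sum>j<nx * (N - 1). \<Theta> $$ (i, j) * (mode t 0 i \<omega> * sat_vec P t \<omega> $ j))"
proof -
  have "(\<Sum>n<N. mode_coeff (\<eta>, \<Theta>, \<Lambda>) n i * mode t n i \<omega>) =
      (\<Sum>n<Suc (N - 1). mode_coeff (\<eta>, \<Theta>, \<Lambda>) n i * mode t n i \<omega>)"
    using N_pos by simp
  also have "\<dots> = gain (channel_vec P t N \<omega>) i * (\<eta> $ i + (\<Sum>j<N - 1. \<Lambda> $$ (i, j) * channel_vec P t (N - 1) \<omega> $ j))"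
    unfolding sum.lessThan_Suc_shift distrib_left sum_distrib_left
    by (simp add: mode_def channel_vec_index mult_ac)
  finally show ?thesis
    unfolding plant_input_index[OF F i] control_index[OF F sat_vec_carrier channel_vec_carrier i]
    by (simp add: algebra_simps sum_distrib_left mode_def)
qed

text \<open>
  Each mixed term is a product of a channel factor and a noise factor, so its mean factorizes. Terms with
  a single saturated entry, and terms of the channel part with the noise, vanish because those noise
  factors have mean zero.
\<close>
lemma plant_input_moments:
  assumes F: "(\<eta>, \<Theta>, \<Lambda>) \<in> policy_class P" and i: "i < nu * N"
  defines "A \<equiv> mode_coeff (\<eta>, \<Theta>, \<Lambda>)"
  shows plant_input_mean: "hbi (\<lambda>\<omega>. plant_input P t (\<eta>, \<Theta>, \<Lambda>) \<omega> $ i) (\<Sum>n<N. A n i * expectation (mode t n i))"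
    and plant_input_second_moment: "k < nu * N \<Longrightarrow>
      hbi (\<lambda>\<omega>. plant_input P t (\<eta>, \<Theta>, \<Lambda>) \<omega> $ i * plant_input P t (\<eta>, \<Theta>, \<Lambda>) \<omega> $ k)
        ((\<Sum>n<N. \<Sum>l<N. A n i * A l k * mode_corr t n i l k) +
         (\<Sum>j<nx * (N - 1). \<Sum>j'<nx * (N - 1). \<Theta> $$ (i, j) * \<Theta> $$ (k, j') *
            (mode_corr t 0 i 0 k * sat_corr t j j')))"
    and plant_input_noise_moment: "j < nx * N \<Longrightarrow>
      hbi (\<lambda>\<omega>. plant_input P t (\<eta>, \<Theta>, \<Lambda>) \<omega> $ i * noise_vec P t \<omega> $ j)
        (\<Sum>j'<nx * (N - 1). \<Theta> $$ (i, j') *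
            (expectation (mode t 0 i) * sat_noise_corr t j' j))"
proof -
  let ?e = "\<lambda>j \<omega>. sat_vec P t \<omega> $ j" and ?w = "\<lambda>j \<omega>. noise_vec P t \<omega> $ j"
  have mode: "hbi (mode t n i) (expectation (mode t n i))" if "i < nu * N" for n i
    by (intro hbi_expectation sq_integrable_integrable mode_sq_integrable that)
  have mode2: "hbi (\<lambda>\<omega>. mode t n i \<omega> * mode t l k \<omega>) (mode_corr t n i l k)"
    if "i < nu * N" "k < nu * N" for n l i k
    by (intro hbi_expectation sq_integrable_mult mode_sq_integrable that)
  have indep1: "hbi (\<lambda>\<omega>. mode t n i \<omega> * z \<omega>) (expectation (mode t n i) * expectation z)"
    if "z \<in> borel_measurable (info noises)" "integrable (pspace P) z" "i < nu * N" for n i z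
    by (intro hbi_indep mode_measurable sq_integrable_integrable mode_sq_integrable that)
  have indep2: "hbi (\<lambda>\<omega>. (mode t n i \<omega> * mode t l k \<omega>) * z \<omega>)
      (mode_corr t n i l k * expectation z)"
    if "z \<in> borel_measurable (info noises)" "integrable (pspace P) z" "i < nu * N" "k < nu * N" for n l i k z
    by (intro hbi_indep borel_measurable_times mode_measurable sq_integrable_mult mode_sq_integrable that)
  have ei: "integrable (pspace P) (?e j)" if "j < nx * (N - 1)" for j
    by (intro sq_integrable_integrable sat_vec_sq_integrable that)
  show "hbi (\<lambda>\<omega>. plant_input P t (\<eta>, \<Theta>, \<Lambda>) \<omega> $ i) (\<Sum>n<N. A n i * expectation (mode t n i))"
  proof -
    have "hbi (\<lambda>\<omega>. (\<Sum>n<N. A n i * mode t n i \<omega>) + (\<Sum>j<nx * (N - 1). \<Theta> $$ (i, j) * (mode t 0 i \<omega> * ?e j \<omega>)))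
        ((\<Sum>n<N. A n i * expectation (mode t n i)) +
         (\<Sum>j<nx * (N - 1). \<Theta> $$ (i, j) * (expectation (mode t 0 i) * expectation (?e j))))"
      by (intro has_bochner_integral_add has_bochner_integral_sum hbi_cmult mode indep1 sat_vec_info ei i) auto
    then show ?thesis
      unfolding plant_input_modes[OF F i] A_def[symmetric] by (simp add: sat_vec_mean)
  qed
  show "hbi (\<lambda>\<omega>. plant_input P t (\<eta>, \<Theta>, \<Lambda>) \<omega> $ i * plant_input P t (\<eta>, \<Theta>, \<Lambda>) \<omega> $ k)
        ((\<Sum>n<N. \<Sum>l<N. A n i * A l k * mode_corr t n i l k) +
         (\<Sum>j<nx * (N - 1). \<Sum>j'<nx * (N - 1). \<Theta> $$ (i, j) * \<Theta> $$ (k, j') *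
            (mode_corr t 0 i 0 k * expectation (\<lambda>\<omega>. ?e j \<omega> * ?e j' \<omega>))))"
    if k: "k < nu * N"
  proof -
    let ?M = "nx * (N - 1)"
    let ?u = "\<lambda>\<omega>. (\<Sum>n<N. \<Sum>l<N. A n i * A l k * (mode t n i \<omega> * mode t l k \<omega>)) +
        (\<Sum>n<N. \<Sum>j<?M. A n i * \<Theta> $$ (k, j) * ((mode t n i \<omega> * mode t 0 k \<omega>) * ?e j \<omega>)) +
        (\<Sum>n<N. \<Sum>j<?M. A n k * \<Theta> $$ (i, j) * ((mode t n k \<omega> * mode t 0 i \<omega>) * ?e j \<omega>)) +
        (\<Sum>j<?M. \<Sum>j'<?M. \<Theta> $$ (i, j) * \<Theta> $$ (k, j') * ((mode t 0 i \<omega> * mode t 0 k \<omega>) * (?e j \<omega> * ?e j' \<omega>)))"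
    have "hbi ?u
      ((\<Sum>n<N. \<Sum>l<N. A n i * A l k * mode_corr t n i l k) +
        (\<Sum>n<N. \<Sum>j<?M. A n i * \<Theta> $$ (k, j) * (mode_corr t n i 0 k * expectation (?e j))) +
        (\<Sum>n<N. \<Sum>j<?M. A n k * \<Theta> $$ (i, j) * (mode_corr t n k 0 i * expectation (?e j))) +
        (\<Sum>j<?M. \<Sum>j'<?M. \<Theta> $$ (i, j) * \<Theta> $$ (k, j') * (mode_corr t 0 i 0 k *
          expectation (\<lambda>\<omega>. ?e j \<omega> * ?e j' \<omega>))))"
      by (intro has_bochner_integral_add has_bochner_integral_sum hbi_cmult mode2 indep2 borel_measurable_times
          sat_vec_info ei i k sq_integrable_mult sat_vec_sq_integrable) auto
    moreover have "plant_input P t (\<eta>, \<Theta>, \<Lambda>) \<omega> $ i * plant_input P t (\<eta>, \<Theta>, \<Lambda>) \<omega> $ k =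
        ?u \<omega>" for \<omega>
    proof -
      have comm: "(\<Sum>j<?M. \<Theta> $$ (i, j) * (mode t 0 i \<omega> * ?e j \<omega>)) * (\<Sum>l<N. A l k * mode t l k \<omega>) =
          (\<Sum>l<N. A l k * mode t l k \<omega>) * (\<Sum>j<?M. \<Theta> $$ (i, j) * (mode t 0 i \<omega> * ?e j \<omega>))"
        by (rule mult.commute)
      show ?thesis
        unfolding plant_input_modes[OF F i] plant_input_modes[OF F k] A_def[symmetric]
          distrib_left distrib_right
        unfolding comm unfolding sum_product by (simp add: mult_ac)
    qed
    ultimately show ?thesis by (simp add: sat_vec_mean)
  qed
  show "hbi (\<lambda>\<omega>. plant_input P t (\<eta>, \<Theta>, \<Lambda>) \<omega> $ i * ?w j \<omega>)
        (\<Sum>j'<nx * (N - 1). \<Theta> $$ (i, j') *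
            (expectation (mode t 0 i) * expectation (\<lambda>\<omega>. ?e j' \<omega> * ?w j \<omega>)))"
    if j: "j < nx * N"
  proof -
    have "hbi (\<lambda>\<omega>. (\<Sum>n<N. A n i * (mode t n i \<omega> * ?w j \<omega>)) +
        (\<Sum>j'<nx * (N - 1). \<Theta> $$ (i, j') * (mode t 0 i \<omega> * (?e j' \<omega> * ?w j \<omega>))))
      ((\<Sum>n<N. A n i * (expectation (mode t n i) * expectation (?w j))) +
        (\<Sum>j'<nx * (N - 1). \<Theta> $$ (i, j') * (expectation (mode t 0 i) * expectation (\<lambda>\<omega>. ?e j' \<omega> * ?w j \<omega>))))"
      by (intro has_bochner_integral_add has_bochner_integral_sum hbi_cmult indep1 borel_measurable_times
          sat_vec_info noise_vec_info i j sq_integrable_integrable[OF noise_vec_sq_integrable]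
          sq_integrable_mult sat_vec_sq_integrable noise_vec_sq_integrable) auto
    moreover have "plant_input P t (\<eta>, \<Theta>, \<Lambda>) \<omega> $ i * ?w j \<omega> = (\<Sum>n<N. A n i * (mode t n i \<omega> * ?w j \<omega>)) +
        (\<Sum>j'<nx * (N - 1). \<Theta> $$ (i, j') * (mode t 0 i \<omega> * (?e j' \<omega> * ?w j \<omega>)))" for \<omega>
      unfolding plant_input_modes[OF F i] A_def[symmetric] distrib_right sum_distrib_right
      by (simp add: mult_ac)
    ultimately show ?thesis by (simp add: noise_vec_mean[OF j])
  qed
qed

end

section \<open>The program as the mean of the cost\<close>

lemma sum_swap3:
  fixes g :: "'a \<Rightarrow> 'b \<Rightarrow> 'c \<Rightarrow> real"
  shows "(\<Sum>l\<in>B. \<Sum>i\<in>C. \<Sum>k\<in>D. g l i k) = (\<Sum>i\<in>C. \<Sum>k\<in>D. \<Sum>l\<in>B. g l i k)"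
proof -
  have "(\<Sum>l\<in>B. \<Sum>i\<in>C. \<Sum>k\<in>D. g l i k) = (\<Sum>i\<in>C. \<Sum>l\<in>B. \<Sum>k\<in>D. g l i k)" by (rule sum.swap)
  also have "\<dots> = (\<Sum>i\<in>C. \<Sum>k\<in>D. \<Sum>l\<in>B. g l i k)" by (intro sum.cong refl sum.swap)
  finally show ?thesis .
qed

lemma sum_swap4:
  fixes g :: "'a \<Rightarrow> 'b \<Rightarrow> 'c \<Rightarrow> 'd \<Rightarrow> real"
  shows "(\<Sum>n\<in>A. \<Sum>l\<in>B. \<Sum>i\<in>C. \<Sum>k\<in>D. g n l i k) = (\<Sum>i\<in>C. \<Sum>k\<in>D. \<Sum>n\<in>A. \<Sum>l\<in>B. g n l i k)"
proof -
  have "(\<Sum>n\<in>A. \<Sum>l\<in>B. \<Sum>i\<in>C. \<Sum>k\<in>D. g n l i k) = (\<Sum>n\<in>A. \<Sum>i\<in>C. \<Sum>k\<in>D. \<Sum>l\<in>B. g n l i k)"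
    by (intro sum.cong refl sum_swap3)
  also have "\<dots> = (\<Sum>i\<in>C. \<Sum>k\<in>D. \<Sum>n\<in>A. \<Sum>l\<in>B. g n l i k)" by (rule sum_swap3)
  finally show ?thesis .
qed

context networked_control
begin

lemma mean_outer_index:
  assumes "i < r" "j < c" "\<And>\<omega>. v \<omega> \<in> carrier_vec r" "\<And>\<omega>. w \<omega> \<in> carrier_vec c"
  shows "mean_mat P r c (\<lambda>\<omega>. outer (v \<omega>) (w \<omega>)) $$ (i, j) = expectation (\<lambda>\<omega>. v \<omega> $ i * w \<omega> $ j)"
proof -
  have "dim_vec (v \<omega>) = r" "dim_vec (w \<omega>) = c" for \<omega> using assms(3,4) by auto
  then show ?thesis using assms(1,2) by (simp add: mean_mat_def outer_def)
qed

lemma trace_noise: "tr (DQD * Sigma_W P t) =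
    (\<Sum>i<nx * N. \<Sum>j<nx * N. DQD $$ (i, j) * noise_corr t i j)"
proof -
  have "Sigma_W P t \<in> carrier_mat (nx * N) (nx * N)" by (simp add: Sigma_W_def mean_mat_def)
  then show ?thesis
    unfolding tr_mult_index[OF DQD_carrier \<open>Sigma_W P t \<in> _\<close>]
    by (intro sum.cong refl) (simp add: Sigma_W_def mean_outer_index noise_vec_carrier mult.commute)
qed

lemma trace_saturation:
  assumes \<Theta>: "\<Theta> \<in> carrier_mat (nu * N) (nx * (N - 1))"
  shows "tr (\<Theta>\<^sup>T * Sigma_S P t * \<Theta> * Sigma_e P t) =
    (\<Sum>i<nu * N. \<Sum>k<nu * N. alpha P $$ (i, k) *
      (\<Sum>j<nx * (N - 1). \<Sum>j'<nx * (N - 1). \<Theta> $$ (i, j) * \<Theta> $$ (k, j') *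
        (mode_corr t 0 i 0 k *
         sat_corr t j j')))"
proof -
  let ?M = "nx * (N - 1)"
  let ?t = "\<lambda>j j' i k. alpha P $$ (i, k) *
    (\<Theta> $$ (i, j) * \<Theta> $$ (k, j') * (mode_corr t 0 i 0 k * sat_corr t j j'))"
  have \<Theta>T: "\<Theta>\<^sup>T \<in> carrier_mat ?M (nu * N)" using \<Theta> by simp
  have S: "Sigma_S P t \<in> carrier_mat (nu * N) (nu * N)" by (simp add: Sigma_S_eq)
  have X: "\<Theta>\<^sup>T * Sigma_S P t * \<Theta> \<in> carrier_mat ?M ?M"
    by (rule mult_carrier_mat[OF mult_carrier_mat[OF \<Theta>T S] \<Theta>])
  have E: "Sigma_e P t \<in> carrier_mat ?M ?M" by (simp add: Sigma_e_def mean_mat_def)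
  have "tr (\<Theta>\<^sup>T * Sigma_S P t * \<Theta> * Sigma_e P t) = (\<Sum>j<?M. \<Sum>j'<?M. \<Sum>i<nu * N. \<Sum>k<nu * N. ?t j j' i k)"
    unfolding tr_mult_index[OF X E]
  proof (intro sum.cong refl)
    fix j j' assume j: "j \<in> {..<?M}" "j' \<in> {..<?M}"
    have S_e: "Sigma_e P t $$ (j', j) = sat_corr t j j'"
      using j by (simp add: Sigma_e_def mean_outer_index sat_vec_carrier mult.commute)
    have X_index: "(\<Theta>\<^sup>T * Sigma_S P t * \<Theta>) $$ (j, j') =
        (\<Sum>i<nu * N. \<Sum>k<nu * N. \<Theta> $$ (i, j) * Sigma_S P t $$ (i, k) * \<Theta> $$ (k, j'))"
      using j by (intro transpose_sandwich_index[OF \<Theta> S \<Theta>]) auto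
    show "(\<Theta>\<^sup>T * Sigma_S P t * \<Theta>) $$ (j, j') * Sigma_e P t $$ (j', j) =
      (\<Sum>i<nu * N. \<Sum>k<nu * N. ?t j j' i k)"
      unfolding S_e X_index sum_distrib_right
      by (intro sum.cong refl) (simp add: Sigma_S_eq mode_moment_def mult_ac)
  qed
  also have "\<dots> = (\<Sum>i<nu * N. \<Sum>k<nu * N. \<Sum>j<?M. \<Sum>j'<?M. ?t j j' i k)"
    by (rule sum_swap4)
  finally show ?thesis by (simp only: sum_distrib_left)
qed

lemma trace_noise_saturation:
  assumes \<Theta>: "\<Theta> \<in> carrier_mat (nu * N) (nx * (N - 1))"
  shows "tr (\<Theta>\<^sup>T * (mu_S P t)\<^sup>T * (calB P)\<^sup>T * calQ P * calD P * Sigma_e' P t) =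
    (\<Sum>i<nu * N. \<Sum>j<nx * N. BQD $$ (i, j) *
      (\<Sum>j'<nx * (N - 1). \<Theta> $$ (i, j') *
        (expectation (mode t 0 i) * sat_noise_corr t j' j)))"
proof -
  let ?M = "nx * (N - 1)" and ?D = "diag_of (nu * N) (\<lambda>i. expectation (mode t 0 i))"
  have \<Theta>T: "\<Theta>\<^sup>T \<in> carrier_mat ?M (nu * N)" using \<Theta> by simp
  note T = mult_carrier_mat[OF \<Theta>T diag_of_carrier]
  have mu: "(mu_S P t)\<^sup>T = ?D" by (simp add: mu_S_eq transpose_diag_of)
  have "\<Theta>\<^sup>T * ?D * (calB P)\<^sup>T * calQ P * calD P = \<Theta>\<^sup>T * ?D * BQD"
    unfolding assoc_mult_mat[OF T calB_T_carrier calQ_carrier]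
      assoc_mult_mat[OF T mult_carrier_mat[OF calB_T_carrier calQ_carrier] calD_carrier] ..
  also have "\<dots> = \<Theta>\<^sup>T * (?D * BQD)"
    by (rule assoc_mult_mat[OF \<Theta>T diag_of_carrier BQD_carrier])
  finally have X: "\<Theta>\<^sup>T * (mu_S P t)\<^sup>T * (calB P)\<^sup>T * calQ P * calD P = \<Theta>\<^sup>T * (?D * BQD)"
    unfolding mu .
  have DB: "?D * BQD \<in> carrier_mat (nu * N) (nx * N)"
    by (rule mult_carrier_mat[OF diag_of_carrier BQD_carrier])
  have E: "Sigma_e' P t \<in> carrier_mat (nx * N) ?M" by (simp add: Sigma_e'_def mean_mat_def)
  let ?t = "\<lambda>j' j i. BQD $$ (i, j) * (\<Theta> $$ (i, j') *
        (expectation (mode t 0 i) * sat_noise_corr t j' j))"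
  have "tr (\<Theta>\<^sup>T * (?D * BQD) * Sigma_e' P t) = (\<Sum>j'<?M. \<Sum>j<nx * N. \<Sum>i<nu * N. ?t j' j i)"
    unfolding tr_mult_index[OF mult_carrier_mat[OF \<Theta>T DB] E]
  proof (intro sum.cong refl)
    fix j' j assume "j' \<in> {..<?M}" "j \<in> {..<nx * N}"
    then have j: "j' < ?M" "j < nx * N" by auto
    have S_e: "Sigma_e' P t $$ (j, j') = sat_noise_corr t j' j"
      using j by (simp add: Sigma_e'_def mean_outer_index sat_vec_carrier noise_vec_carrier mult.commute)
    have X_index: "(\<Theta>\<^sup>T * (?D * BQD)) $$ (j', j) =
        (\<Sum>i<nu * N. \<Theta> $$ (i, j') * (expectation (mode t 0 i) * BQD $$ (i, j)))"
      unfolding mult_mat_index[OF \<Theta>T DB j]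
      using \<Theta> j by (intro sum.cong refl) (simp add: diag_of_mult_index[OF BQD_carrier] del: index_mult_mat)
    show "(\<Theta>\<^sup>T * (?D * BQD)) $$ (j', j) * Sigma_e' P t $$ (j, j') = (\<Sum>i<nu * N. ?t j' j i)"
      unfolding S_e X_index sum_distrib_right by (intro sum.cong refl) (simp only: mult_ac)
  qed
  also have "\<dots> = (\<Sum>j<nx * N. \<Sum>i<nu * N. \<Sum>j'<?M. ?t j' j i)" by (rule sum_swap3)
  also have "\<dots> = (\<Sum>i<nu * N. \<Sum>j<nx * N. \<Sum>j'<?M. ?t j' j i)" by (rule sum.swap)
  finally show ?thesis unfolding X by (simp only: sum_distrib_left)
qed

text \<open>
  Both sides are sums over entries of the same moments, in a different order of summation.
\<close>
lemma expected_cost_eq_qp: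
  assumes F: "F \<in> policy_class P" and y: "y \<in> carrier_vec nx"
  shows "expectation (cost P t y F) = qp_quadratic P t y F"
proof -
  obtain \<eta> \<Theta> \<Lambda> where FF: "F = (\<eta>, \<Theta>, \<Lambda>)" and \<Theta>: "\<Theta> \<in> carrier_mat (nu * N) (nx * (N - 1))"
    using F by (rule policy_class_cases)
  note F' = F[unfolded FF]
  have p: "calA P *\<^sub>v y \<in> carrier_vec (nx * (N + 1))"
    by (rule mult_mat_vec_carrier[OF calA_carrier y])
  show ?thesis
    unfolding FF qp_quadratic.simps Let_def calL_quadratic[OF F'] calM_linear[OF F' p] trace_noise
      trace_saturation[OF \<Theta>] trace_noise_saturation[OF \<Theta>]
    by (rule trans[OF expected_cost[OF y plant_input_mean[OF F'] plant_input_second_moment[OF F']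
            plant_input_noise_moment[OF F']]], assumption+, subst sum_swap4)
      (simp add: sum_distrib_left[symmetric] distrib_left sum.distrib)
qed

section \<open>Convexity of the quadratic part\<close>

text \<open>
  The vector \<open>(1, e, \<nu>)\<close>, by which \<open>policy_mat\<close> is multiplied to give the control.
\<close>
definition feature :: "nat \<Rightarrow> nat \<Rightarrow> 'w \<Rightarrow> real" where
  "feature t c \<omega> = (case c of 0 \<Rightarrow> 1 | Suc j \<Rightarrow>
     if j < nx * (N - 1) then sat_vec P t \<omega> $ j else channel P (t + (j - nx * (N - 1))) \<omega>)"

text \<open>
  The random matrix that maps the coordinates of a policy to the plant input. Coordinate \<open>k\<close> is the entry
  of \<open>policy_mat\<close> in row \<open>k div ncols\<close>, so it affects that input only.
\<close>
definition input_map :: "nat \<Rightarrow> nat \<Rightarrow> nat \<Rightarrow> 'w \<Rightarrow> real" where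
  "input_map t i k \<omega> =
     (if k div ncols = i then gain (channel_vec P t N \<omega>) i * feature t (k mod ncols) \<omega> else 0)"

lemma plant_input_linear:
  assumes F: "F \<in> policy_class P" and i: "i < nu * N"
  shows "plant_input P t F \<omega> $ i = (\<Sum>k<num_coords P. input_map t i k \<omega> * coords P F $ k)"
proof -
  obtain \<eta> \<Theta> \<Lambda> where FF: "F = (\<eta>, \<Theta>, \<Lambda>)" using F by (rule policy_class_cases)
  let ?g = "gain (channel_vec P t N \<omega>) i"
  have ncols_pos: "0 < ncols" by (simp add: ncols_def)
  have "plant_input P t F \<omega> $ i = ?g * (\<Sum>c<ncols. policy_mat P F $$ (i, c) * feature t c \<omega>)"
    unfolding plant_input_index[OF F i] unfolding FF
    unfolding control_index[OF F[unfolded FF] sat_vec_carrier channel_vec_carrier i]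
    by (simp add: ncols_def sum.lessThan_Suc_shift sum_lessThan_add policy_mat_index[OF F[unfolded FF] i]
        feature_def channel_vec_index del: sum.lessThan_Suc)
  also have "\<dots> = (\<Sum>c<ncols. input_map t i (i * ncols + c) \<omega> * coords P F $ (i * ncols + c))"
    unfolding sum_distrib_left
    by (intro sum.cong refl) (simp add: input_map_def coords_index[OF F i])
  also have "\<dots> = (\<Sum>m<nu * N. if m = i then \<Sum>c<ncols. input_map t i (i * ncols + c) \<omega> * coords P F $ (i * ncols + c) else 0)"
    using i by simp
  also have "\<dots> = (\<Sum>m<nu * N. \<Sum>c<ncols. input_map t i (m * ncols + c) \<omega> * coords P F $ (m * ncols + c))"
  proof (intro sum.cong refl)
    fix m
    show "(if m = i then \<Sum>c<ncols. input_map t i (i * ncols + c) \<omega> * coords P F $ (i * ncols + c) else 0) =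
        (\<Sum>c<ncols. input_map t i (m * ncols + c) \<omega> * coords P F $ (m * ncols + c))"
      by (cases "m = i") (auto simp: input_map_def)
  qed
  also have "\<dots> = (\<Sum>m<nu * N. \<Sum>k=m * ncols..<m * ncols + ncols. input_map t i k \<omega> * coords P F $ k)"
  proof (rule sum.cong[OF refl])
    fix m
    show "(\<Sum>c<ncols. input_map t i (m * ncols + c) \<omega> * coords P F $ (m * ncols + c)) =
        (\<Sum>k=m * ncols..<m * ncols + ncols. input_map t i k \<omega> * coords P F $ k)"
      using sum.shift_bounds_nat_ivl[of "\<lambda>k. input_map t i k \<omega> * coords P F $ k" 0 "m * ncols" ncols]
      by (simp add: lessThan_atLeast0 add.commute)
  qed
  also have "\<dots> = (\<Sum>k<num_coords P. input_map t i k \<omega> * coords P F $ k)"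
    unfolding num_coords_eq by (rule sum.nat_group)
  finally show ?thesis .
qed

lemma input_map_sq_integrable:
  assumes i: "i < nu * N" and k: "k < num_coords P"
  shows "sq_integrable (input_map t i k)"
proof -
  define c where "c = k mod ncols"
  have c: "c < ncols" by (simp add: c_def ncols_def)
  have f: "feature t c \<in> borel_measurable (pspace P)"
    "\<And>\<omega>. \<omega> \<in> space (pspace P) \<Longrightarrow> \<bar>feature t c \<omega>\<bar> \<le> 1 + phi_max P"
  proof -
    consider "c = 0" | j where "c = Suc j" "j < nx * (N - 1)"
      | j where "c = Suc j" "\<not> j < nx * (N - 1)" by (cases c) auto
    note cases = this
    show "feature t c \<in> borel_measurable (pspace P)"
      using cases by cases (auto simp: feature_def[abs_def] channel_measurable
          intro: measurable_info[OF sat_vec_info])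
    fix \<omega> assume \<omega>: "\<omega> \<in> space (pspace P)"
    show "\<bar>feature t c \<omega>\<bar> \<le> 1 + phi_max P"
      using cases
    proof cases
      case (2 j)
      then show ?thesis using sat_vec_bound[OF \<omega>, of j t] by (simp add: feature_def)
    next
      case (3 j)
      then show ?thesis using channel_range[OF \<omega>, of "t + (j - nx * (N - 1))"] phi_max
        by (auto simp: feature_def)
    qed (simp add: feature_def phi_max)
  qed
  show ?thesis
  proof (cases "k div ncols = i")
    case True
    have "(\<lambda>\<omega>. gain (channel_vec P t N \<omega>) i * feature t c \<omega>) \<in> borel_measurable (pspace P)"
      by (intro borel_measurable_times gain_measurable i channel_measurable f)
    moreover have "\<bar>gain (channel_vec P t N \<omega>) i * feature t c \<omega>\<bar> \<le> 1 + phi_max P"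
      if "\<omega> \<in> space (pspace P)" for \<omega>
      using gain_channel_range[OF that i, of t] f(2)[OF that] phi_max by auto
    ultimately show ?thesis
      using True unfolding input_map_def c_def by (auto intro: sq_integrable_bounded)
  qed (simp add: input_map_def[abs_def] sq_integrable_const)
qed

text \<open>
  With \<open>G\<close> the random matrix \<open>input_map\<close>, the quadratic part is \<open>v \<bullet> (H *\<^sub>v v)\<close> for \<open>H\<close> the mean of
  \<open>G\<^sup>T * alpha * G\<close>. For every vector \<open>v\<close>, also one that is not the coordinate vector of a policy, this is
  the mean of the form of \<open>alpha\<close> at \<open>G *\<^sub>v v\<close>, hence nonnegative.
\<close>
lemma convex_quadratic_qp:
  assumes y: "y \<in> carrier_vec nx"
  shows "convex_quadratic P (qp_quadratic P t y)"
proof -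
  let ?n = "num_coords P" and ?m = "nu * N"
  let ?G = "input_map t" and ?w = "\<lambda>j \<omega>. noise_vec P t \<omega> $ j"
  let ?GG = "\<lambda>i k j l. expectation (\<lambda>\<omega>. ?G i k \<omega> * ?G j l \<omega>)"
    and ?Gw = "\<lambda>i k j. expectation (\<lambda>\<omega>. ?G i k \<omega> * ?w j \<omega>)"
  (* The coefficients arise by substituting u = G v into the expansion of the cost and averaging. *)
  define q where "q = (calQ P * calB P)\<^sup>T *\<^sub>v (calA P *\<^sub>v y)"
  define H where "H = mat ?n ?n (\<lambda>(k, l). \<Sum>i<?m. \<Sum>j<?m. alpha P $$ (i, j) * ?GG i k j l)"
  define c where "c = vec ?n (\<lambda>k. 2 * (\<Sum>i<?m. q $ i * expectation (?G i k)) +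
    2 * (\<Sum>i<?m. \<Sum>j<nx * N. BQD $$ (i, j) * ?Gw i k j))"
  define r where "r = (calA P *\<^sub>v y) \<bullet> (calQ P *\<^sub>v (calA P *\<^sub>v y)) +
    (\<Sum>i<nx * N. \<Sum>j<nx * N. DQD $$ (i, j) * expectation (\<lambda>\<omega>. ?w i \<omega> * ?w j \<omega>))"
  have H_carrier: "H \<in> carrier_mat ?n ?n" by (simp add: H_def)
  have GG: "hbi (\<lambda>\<omega>. ?G i k \<omega> * ?G j l \<omega>) (?GG i k j l)"
    if "i < ?m" "j < ?m" "k < ?n" "l < ?n" for i j k l
    by (intro hbi_expectation sq_integrable_mult input_map_sq_integrable that)
  have Gi: "hbi (?G i k) (expectation (?G i k))" if "i < ?m" "k < ?n" for i k
    by (intro hbi_expectation sq_integrable_integrable input_map_sq_integrable that)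
  have Gw: "hbi (\<lambda>\<omega>. ?G i k \<omega> * ?w j \<omega>) (?Gw i k j)"
    if "i < ?m" "k < ?n" "j < nx * N" for i j k
    by (intro hbi_expectation sq_integrable_mult input_map_sq_integrable noise_vec_sq_integrable that)
  have second: "hbi (\<lambda>\<omega>. (\<Sum>k<?n. ?G i k \<omega> * v $ k) * (\<Sum>l<?n. ?G j l \<omega> * v $ l))
      (\<Sum>k<?n. \<Sum>l<?n. (v $ k * v $ l) * ?GG i k j l)"
    if ij: "i < ?m" "j < ?m" for i j and v :: "real vec"
  proof -
    have "hbi (\<lambda>\<omega>. \<Sum>k<?n. \<Sum>l<?n. (v $ k * v $ l) * (?G i k \<omega> * ?G j l \<omega>))
      (\<Sum>k<?n. \<Sum>l<?n. (v $ k * v $ l) * ?GG i k j l)"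
      by (intro has_bochner_integral_sum hbi_cmult GG ij) auto
    then show ?thesis by (simp add: sum_product mult_ac)
  qed
  have H_form: "v \<bullet> (H *\<^sub>v v) = (\<Sum>i<?m. \<Sum>j<?m. alpha P $$ (i, j) *
      (\<Sum>k<?n. \<Sum>l<?n. (v $ k * v $ l) * ?GG i k j l))"
    if v: "v \<in> carrier_vec ?n" for v
  proof -
    have "v \<bullet> (H *\<^sub>v v) = (\<Sum>k<?n. \<Sum>l<?n. \<Sum>i<?m. \<Sum>j<?m. alpha P $$ (i, j) *
        ((v $ k * v $ l) * ?GG i k j l))"
      unfolding scalar_prod_mult_mat_vec[OF H_carrier v v]
      by (intro sum.cong refl) (simp add: H_def sum_distrib_left sum_distrib_right mult_ac)
    also have "\<dots> = (\<Sum>i<?m. \<Sum>j<?m. \<Sum>k<?n. \<Sum>l<?n. alpha P $$ (i, j) *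
        ((v $ k * v $ l) * ?GG i k j l))"
      by (rule sum_swap4)
    finally show ?thesis by (simp only: sum_distrib_left)
  qed
  have "sym_psd ?n H"
    unfolding sym_psd_def
  proof (intro conjI ballI H_carrier)
    show "H\<^sup>T = H"
    proof (rule eq_matI)
      fix k l assume "k < dim_row H" "l < dim_col H"
      then have kl: "k < ?n" "l < ?n" by (auto simp: H_def)
      have "H\<^sup>T $$ (k, l) = (\<Sum>i<?m. \<Sum>j<?m. alpha P $$ (i, j) * ?GG i l j k)"
        using kl by (simp add: H_def)
      also have "\<dots> = (\<Sum>j<?m. \<Sum>i<?m. alpha P $$ (i, j) * ?GG i l j k)"
        by (rule sum.swap)
      also have "\<dots> = (\<Sum>j<?m. \<Sum>i<?m. alpha P $$ (j, i) * ?GG j k i l)"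
        by (intro sum.cong refl) (simp add: alpha_sym_index mult.commute)
      also have "\<dots> = H $$ (k, l)" using kl by (simp add: H_def)
      finally show "H\<^sup>T $$ (k, l) = H $$ (k, l)" .
    qed (simp_all add: H_def)
    fix v :: "real vec" assume v: "v \<in> carrier_vec ?n"
    let ?Gv = "\<lambda>i \<omega>. \<Sum>k<?n. ?G i k \<omega> * v $ k"
    have "hbi (\<lambda>\<omega>. \<Sum>i<?m. \<Sum>j<?m. alpha P $$ (i, j) * (?Gv i \<omega> * ?Gv j \<omega>)) (v \<bullet> (H *\<^sub>v v))"
      unfolding H_form[OF v]
      by (intro has_bochner_integral_sum hbi_cmult second) auto
    moreover have "0 \<le> (\<Sum>i<?m. \<Sum>j<?m. alpha P $$ (i, j) * (?Gv i \<omega> * ?Gv j \<omega>))" for \<omega>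
    proof -
      let ?z = "vec ?m (\<lambda>i. ?Gv i \<omega>)"
      have z: "?z \<in> carrier_vec ?m" by simp
      have "0 \<le> ?z \<bullet> (alpha P *\<^sub>v ?z)" using alpha_psd z unfolding sym_psd_def by blast
      also have "\<dots> = (\<Sum>i<?m. \<Sum>j<?m. alpha P $$ (i, j) * (?Gv i \<omega> * ?Gv j \<omega>))"
        unfolding scalar_prod_mult_mat_vec[OF alpha_carrier z z]
        by (intro sum.cong refl) (simp add: mult_ac)
      finally show ?thesis .
    qed
    ultimately show "0 \<le> v \<bullet> (H *\<^sub>v v)"
      unfolding has_bochner_integral_iff by (metis (no_types, lifting) Bochner_Integration.integral_nonneg)
  qed
  moreover have "qp_quadratic P t y F = coords P F \<bullet> (H *\<^sub>v coords P F) + c \<bullet> coords P F + r"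
    if F: "F \<in> policy_class P" for F
  proof -
    define v where "v = coords P F"
    have v: "v \<in> carrier_vec ?n" by (simp add: v_def coords_carrier)
    have u: "plant_input P t F \<omega> $ i = (\<Sum>k<?n. ?G i k \<omega> * v $ k)" if "i < ?m" for i \<omega>
      using plant_input_linear[OF F that] by (simp add: v_def)
    have m1: "hbi (\<lambda>\<omega>. plant_input P t F \<omega> $ i) (\<Sum>k<?n. v $ k * expectation (?G i k))" if i: "i < ?m" for i
    proof -
      have "hbi (\<lambda>\<omega>. \<Sum>k<?n. v $ k * ?G i k \<omega>) (\<Sum>k<?n. v $ k * expectation (?G i k))"
        by (intro has_bochner_integral_sum hbi_cmult Gi i) auto
      then show ?thesis unfolding u[OF i] by (simp add: mult.commute)
    qed
    have m2: "hbi (\<lambda>\<omega>. plant_input P t F \<omega> $ i * plant_input P t F \<omega> $ j)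
        (\<Sum>k<?n. \<Sum>l<?n. (v $ k * v $ l) * ?GG i k j l)"
      if "i < ?m" "j < ?m" for i j
      unfolding u[OF that(1)] u[OF that(2)] by (rule second[OF that])
    have m3: "hbi (\<lambda>\<omega>. plant_input P t F \<omega> $ i * ?w j \<omega>)
        (\<Sum>k<?n. v $ k * ?Gw i k j)"
      if i: "i < ?m" and j: "j < nx * N" for i j
    proof -
      have "hbi (\<lambda>\<omega>. \<Sum>k<?n. v $ k * (?G i k \<omega> * ?w j \<omega>)) (\<Sum>k<?n. v $ k * ?Gw i k j)"
        by (intro has_bochner_integral_sum hbi_cmult Gw i j) auto
      then show ?thesis unfolding u[OF i] sum_distrib_right by (simp only: mult_ac)
    qed
    have lin1: "(\<Sum>k<?n. (\<Sum>i<?m. q $ i * expectation (?G i k)) * v $ k) =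
        (\<Sum>i<?m. q $ i * (\<Sum>k<?n. v $ k * expectation (?G i k)))"
      unfolding sum_distrib_left sum_distrib_right by (subst sum.swap) (simp add: mult_ac)
    have lin2: "(\<Sum>k<?n. (\<Sum>i<?m. \<Sum>j<nx * N. BQD $$ (i, j) * ?Gw i k j) * v $ k) =
        (\<Sum>i<?m. \<Sum>j<nx * N. BQD $$ (i, j) * (\<Sum>k<?n. v $ k * ?Gw i k j))"
      unfolding sum_distrib_left sum_distrib_right by (subst sum_swap3) (simp add: mult_ac)
    have "c \<bullet> v = (\<Sum>k<?n. c $ k * v $ k)"
      using v by (simp add: scalar_prod_def lessThan_atLeast0)
    also have "\<dots> = 2 * (\<Sum>k<?n. (\<Sum>i<?m. q $ i * expectation (?G i k)) * v $ k) +
        2 * (\<Sum>k<?n. (\<Sum>i<?m. \<Sum>j<nx * N. BQD $$ (i, j) * ?Gw i k j) * v $ k)"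
      unfolding sum_distrib_left[of 2] sum.distrib[symmetric]
      by (intro sum.cong refl) (simp add: c_def distrib_right del: index_mult_mat)
    finally have "c \<bullet> v = 2 * (\<Sum>i<?m. q $ i * (\<Sum>k<?n. v $ k * expectation (?G i k))) +
        2 * (\<Sum>i<?m. \<Sum>j<nx * N. BQD $$ (i, j) * (\<Sum>k<?n. v $ k * ?Gw i k j))"
      unfolding lin1 lin2 .
    moreover have "qp_quadratic P t y F = expectation (cost P t y F)"
      using expected_cost_eq_qp[OF F y] by simp
    ultimately show ?thesis
      using expected_cost[OF y m1 m2 m3] unfolding v_def[symmetric] H_form[OF v] r_def q_def by simp
  qed
  moreover have "c \<in> carrier_vec ?n" by (simp add: c_def)
  ultimately show ?thesis unfolding convex_quadratic_def by blast
qed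

lemma convex_quadratic_program_qp: "y \<in> carrier_vec nx \<Longrightarrow> convex_quadratic_program P t y"
  unfolding convex_quadratic_program_def
  using convex_quadratic_qp cpl_regularizer cpl_qp_constraint by blast

section \<open>Objective and feasible rules\<close>

lemma qp_objective_convex:
  assumes y: "y \<in> carrier_vec nx" and F: "F \<in> policy_class P" "G \<in> policy_class P" and u: "u \<in> {0..1}"
  shows "qp_objective P t y (mix u F G) \<le> u * qp_objective P t y F + (1 - u) * qp_objective P t y G"
  using convex_quadratic_convex[OF convex_quadratic_qp[OF y, of t] F u] cpl_convex[OF cpl_regularizer F u]
  unfolding qp_objective_def by (simp add: algebra_simps)

lemma mix_feasible_rule:
  assumes g: "g \<in> feasible_rules P" and h: "h \<in> feasible_rules P" and u: "u \<in> {0..1}"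
  shows "(\<lambda>y. mix u (g y) (h y)) \<in> feasible_rules P"
proof -
  have hard: "mix u (g y) (h y) \<in> hard_feasible P" if "y \<in> carrier_vec nx" for y
    using convex_qp_feasible g h u that unfolding convex_policies_def hard_feasible_eq[symmetric]
    by (auto simp: feasible_rules_def)
  have cl: "g y \<in> policy_class P" "h y \<in> policy_class P" if "y \<in> carrier_vec nx" for y
    using decision_rule_policy[OF feasible_decision] g h that by auto
  have "(\<lambda>y. coords P (mix u (g y) (h y)) $ k) \<in> borel_measurable (vec_borel nx)"
    if k: "k < num_coords P" for k
  proof (rule iffD2[OF measurable_cong])
    show "coords P (mix u (g y) (h y)) $ k = u * coords P (g y) $ k + (1 - u) * coords P (h y) $ k"
      if "y \<in> space (vec_borel nx)" for y
      using that k coords_carrier[of "g y"] coords_carrier[of "h y"] by (simp add: coords_mix cl)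
    have "(\<lambda>y. coords P (g y) $ k) \<in> borel_measurable (vec_borel nx)"
      "(\<lambda>y. coords P (h y) $ k) \<in> borel_measurable (vec_borel nx)"
      using g h k by (auto simp: feasible_rules_def decision_rules_def measurable_vec_borel_iff)
    then show "(\<lambda>y. u * coords P (g y) $ k + (1 - u) * coords P (h y) $ k) \<in> borel_measurable (vec_borel nx)"
      by measurable
  qed
  then have "(\<lambda>y. mix u (g y) (h y)) \<in> decision_rules P"
    unfolding decision_rules_def using mix_policy_class[OF cl] coords_carrier
    by (auto simp: measurable_vec_borel_iff)
  then show ?thesis using hard by (simp add: feasible_rules_def)
qed

context
  fixes K :: "nat \<Rightarrow> real vec \<Rightarrow> policy" and x :: "nat \<Rightarrow> 'w \<Rightarrow> real vec"
  assumes K: "\<And>k. K k \<in> feasible_rules P" and loop: "closed_loop P K x"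
begin

lemma objective_eq_qp:
  assumes g: "g \<in> decision_rules P" and int: "integrable (pspace P) (rule_cost P x t g)"
  shows "AE \<omega> in pspace P. objective P x t g \<omega> = qp_objective P t (x t \<omega>) (g (x t \<omega>))"
  using cond_exp_rule_cost[OF K loop g int] AE_space
proof eventually_elim
  case (elim \<omega>)
  have "x t \<omega> \<in> carrier_vec nx" by (rule state_carrier[OF K loop elim(2)])
  then show ?case
    using elim(1) expected_cost_eq_qp[OF decision_rule_policy[OF g], of "x t \<omega>" "x t \<omega>" t]
    by (simp add: objective_def qp_objective_def)
qed

text \<open>
  Almost surely all three conditional expectations agree with the program at the current state, so
  the inequality reduces to convexity of the program at that state.
\<close>
lemma objective_convex:
  assumes g: "g \<in> feasible_rules P" and h: "h \<in> feasible_rules P" and u: "u \<in> {0..1}"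
  shows "AE \<omega> in pspace P. objective P x t (\<lambda>y. mix u (g y) (h y)) \<omega> \<le>
    u * objective P x t g \<omega> + (1 - u) * objective P x t h \<omega>"
proof -
  have eq: "AE \<omega> in pspace P. objective P x t f \<omega> = qp_objective P t (x t \<omega>) (f (x t \<omega>))"
    if "f \<in> feasible_rules P" for f
    by (rule objective_eq_qp[OF feasible_decision[OF that] feasible_rule_integrable[OF K loop that]])
  show ?thesis
    using eq[OF g] eq[OF h] eq[OF mix_feasible_rule[OF g h u]] AE_space
  proof eventually_elim
    case (elim \<omega>)
    have "x t \<omega> \<in> carrier_vec nx" by (rule state_carrier[OF K loop elim(4)])
    then show ?case
      unfolding elim(1-3)
      using qp_objective_convex decision_rule_policy[OF feasible_decision] g h u by blast
  qed
qed

end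

end

theorem theorem2:
  fixes P :: "'w ncs"
    and K :: "nat \<Rightarrow> real vec \<Rightarrow> policy"
    and x :: "nat \<Rightarrow> 'w \<Rightarrow> real vec"
    and j t :: nat
  assumes "networked_control P"
    and "\<And>k. K k \<in> feasible_rules P"
    and "closed_loop P K x"
    and "t = j * recalc P"
  shows "convex_policies (hard_feasible P) \<and>
    (\<forall>g\<in>feasible_rules P. \<forall>h\<in>feasible_rules P. \<forall>u\<in>{0..1}. AE \<omega> in pspace P.
       objective P x t (\<lambda>y. mix u (g y) (h y)) \<omega> \<le>
         u * objective P x t g \<omega> + (1 - u) * objective P x t h \<omega>) \<and>
    hard_feasible P \<noteq> {} \<and>
    (\<forall>F\<in>policy_class P. integrable (pspace P) (rule_cost P x t (\<lambda>_. F))) \<and>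
    (\<forall>g\<in>feasible_rules P. integrable (pspace P) (rule_cost P x t g)) \<and>
    (\<forall>g\<in>decision_rules P. integrable (pspace P) (rule_cost P x t g) \<longrightarrow>
       (AE \<omega> in pspace P. objective P x t g \<omega> = qp_objective P t (x t \<omega>) (g (x t \<omega>)))) \<and>
    hard_feasible P = qp_feasible P \<and>
    (\<forall>y\<in>carrier_vec (dim_x P). convex_quadratic_program P t y)"
proof -
  interpret networked_control P by (rule assms(1))
  note KL = assms(2,3)
  show ?thesis
    unfolding hard_feasible_eq
    using convex_qp_feasible qp_feasible_nonempty convex_quadratic_program_qp
      objective_convex[OF KL] constant_rule_integrable[OF KL] feasible_rule_integrable[OF KL]
      objective_eq_qp[OF KL]
    by (intro conjI ballI impI) simp_all
qed

end
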